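(* Let $s\in(0,1)$, let $N>2s$ be an integer, and let $a,c,f:\mathbb{R}^N\to\mathbb{R}$ satisfy the following, for some $\sigma\in(0,1)$: $a\in C^{0,\sigma}_{loc}(\mathbb{R}^N)$ with $a(x)>0$ for all $x\in\mathbb{R}^N$; there exist $C_0>0$ and $\alpha>2s$ such that $a(x)\ge C_0(1+|x|^2)^{\alpha/2}$ for all $x\in\mathbb{R}^N$; and $c,f\in C^{0,\sigma}_{loc}(\mathbb{R}^N)\cap L^\infty(\mathbb{R}^N)$. Let $g\in C([0,\infty))\cap L^\infty((0,\infty))$, $u_0\in C(\mathbb{R}^N)\cap L^\infty(\mathbb{R}^N)$, $c\le 0$, and suppose that $\lim_{|x|\to\infty}u_0(x)=g(0)$ and that the limit $\gamma:=\lim_{t\to\infty}g(t)\in\mathbb{R}$ exists. Let $u$ be the unique solution (in the viscosity sense defined in the context) of the problem $$\partial_t u=-a(-\Delta)^s u+cu+f \ \text{ in } \mathbb{R}^N\times(0,\infty),\qquad u=u_0\ \text{ in }\mathbb{R}^N\times\{0\},$$ such that $\lim_{|x|\to\infty}u(x,t)=g(t)$ uniformly with respect to $t\in[0,\infty)$. Then $$\lim_{t\to\infty}u(x,t)=W(x)\quad\text{for all }x\in\mathbb{R}^N,$$ where $W$ is the unique solution (in the viscosity sense defined in the context) of the equation $$a(-\Delta)^sW-cW=f\quad\text{in }\mathbb{R}^N$$ satisfying $\lim_{|x|\to\infty}W(x)=\gamma$.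
   Context: Let $S_\infty:=\mathbb{R}^N\times(0,\infty)$ and $\overline{S_\infty}=\mathbb{R}^N\times[0,\infty)$. The fractional Laplacian (acting in the space variable) is $(-\Delta)^s u(x)=C_{N,s}\,\mathrm{P.V.}\int_{\mathbb{R}^N}\frac{u(x)-u(y)}{|x-y|^{N+2s}}\,dy$ with $C_{N,s}=\frac{2^{2s}s\,\Gamma((N+2s)/2)}{\pi^{N/2}\Gamma(1-s)}$, for functions that are sufficiently regular near $x$ and belong to $\mathcal{L}^s(\mathbb{R}^N):=\{u \text{ measurable}: \int_{\mathbb{R}^N}\frac{|u(x)|}{1+|x|^{N+2s}}dx<\infty\}$. Sub- and supersolutions below are understood to belong to $\mathcal{L}^s(\mathbb{R}^N)$ in $x$ (for every $t$ in the parabolic case), so that the expressions make sense. Parabolic equation: $u$ is a subsolution of $\partial_t u=-a(-\Delta)^su+cu+f$ in $S_\infty$ if (i) $u$ is upper semicontinuous in $S_\infty$; (ii) for any open bounded subset $U\subset S_\infty$, any $(x_0,t_0)\in U$, and any test function $\varphi\in C^2(S_\infty)$ such that $u(x_0,t_0)=\varphi(x_0,t_0)$ and $u(x_0,t_0)-\varphi(x_0,t_0)\ge u(x,t)-\varphi(x,t)$ for all $(x,t)\in U$, one has $$\partial_t\psi(x_0,t_0)\le -a(x_0)(-\Delta)^s\psi(x_0,t_0)+c(x_0)u(x_0,t_0)+f(x_0),$$ where $\psi:=\varphi$ in $U$ and $\psi:=u$ in $S_\infty\setminus U$. Supersolution: the same with "lower semicontinuous" and with both inequalities (in the touching condition and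 in the equation) reversed. Cauchy problem: a subsolution is a function upper semicontinuous in $\overline{S_\infty}$ that is a subsolution of the equation in $S_\infty$ and satisfies $u(x,0)\le u_0(x)$ for all $x\in\mathbb{R}^N$. A supersolution is a function lower semicontinuous in $\overline{S_\infty}$ that is a supersolution of the equation in $S_\infty$ and satisfies $u(x,0)\ge u_0(x)$ for all $x$. A solution is both a subsolution and a supersolution (hence continuous on $\overline{S_\infty}$ with $u(\cdot,0)=u_0$). Elliptic equation: $u$ is a subsolution of $a(-\Delta)^su-cu=f$ in $\mathbb{R}^N$ if (i) $u$ is upper semicontinuous in $\mathbb{R}^N$; (ii) for any open bounded subset $U\subset\mathbb{R}^N$, any $x_0\in U$, and any test function $\varphi\in C^2(\mathbb{R}^N)$ such that $u(x_0)=\varphi(x_0)$ and $u(x_0)-\varphi(x_0)\ge u(x)-\varphi(x)$ for all $x\in U$, one has $$a(x_0)(-\Delta)^s\psi(x_0)-c(x_0)u(x_0)\le f(x_0),$$ where $\psi:=\varphi$ in $U$ and $\psi:=u$ in $\mathbb{R}^N\setminus U$. Supersolution: the same with "lower semicontinuous" and both inequalities reversed. A solution is both a subsolution and a supersolution. *)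

theory Defs
  imports "HOL-Analysis.Analysis"
begin

section \<open>Function spaces\<close>

definition ess_bounded :: "'a measure \<Rightarrow> ('a \<Rightarrow> real) \<Rightarrow> bool" where
  "ess_bounded M f \<longleftrightarrow> f \<in> borel_measurable M \<and> (\<exists>K. AE x in M. \<bar>f x\<bar> \<le> K)"

definition locally_Holder :: "real \<Rightarrow> ('a::metric_space \<Rightarrow> real) \<Rightarrow> bool" where
  "locally_Holder \<sigma> f \<longleftrightarrow>
     (\<forall>K. compact K \<longrightarrow> (\<exists>L. \<forall>x\<in>K. \<forall>y\<in>K. \<bar>f x - f y\<bar> \<le> L * dist x y powr \<sigma>))"

text \<open>Semicontinuity is relative to the subspace topology of \<open>S\<close>.\<close>

definition usc_on :: "'a::topological_space set \<Rightarrow> ('a \<Rightarrow> real) \<Rightarrow> bool" where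
  "usc_on S f \<longleftrightarrow> (\<forall>x\<in>S. \<forall>r>f x. \<forall>\<^sub>F y in at x within S. f y < r)"

definition lsc_on :: "'a::topological_space set \<Rightarrow> ('a \<Rightarrow> real) \<Rightarrow> bool" where
  "lsc_on S f \<longleftrightarrow> (\<forall>x\<in>S. \<forall>r<f x. \<forall>\<^sub>F y in at x within S. r < f y)"

text \<open>\<open>C\<^sup>2\<close> in the Frechet sense; meant for open \<open>S\<close>.\<close>

definition C2_on :: "'a::real_normed_vector set \<Rightarrow> ('a \<Rightarrow> real) \<Rightarrow> bool" where
  "C2_on S f \<longleftrightarrow>
     (\<exists>(f' :: 'a \<Rightarrow> 'a \<Rightarrow>\<^sub>L real) (f'' :: 'a \<Rightarrow> 'a \<Rightarrow>\<^sub>L 'a \<Rightarrow>\<^sub>L real).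
        (\<forall>x\<in>S. (f has_derivative blinfun_apply (f' x)) (at x)) \<and>
        (\<forall>x\<in>S. (f' has_derivative blinfun_apply (f'' x)) (at x)) \<and>
        continuous_on S f'')"

section \<open>The fractional Laplacian\<close>

definition Ls_space :: "real \<Rightarrow> (real ^ 'n \<Rightarrow> real) set" where
  "Ls_space s = {u. u \<in> borel_measurable lebesgue \<and>
     integrable lebesgue (\<lambda>x. \<bar>u x\<bar> / (1 + norm x powr (real CARD('n) + 2 * s)))}"

definition frac_const :: "nat \<Rightarrow> real \<Rightarrow> real" where
  "frac_const N s = 2 powr (2 * s) * s * Gamma ((real N + 2 * s) / 2)
     / (pi powr (real N / 2) * Gamma (1 - s))"

text \<open>The principal value excises balls around \<open>x\<close>. If the limit does not exist, the value
  is unspecified; it exists whenever \<open>u\<close> is in \<open>Ls_space s\<close> and \<open>C\<^sup>2\<close> near \<open>x\<close>.\<close>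

definition frac_laplacian :: "real \<Rightarrow> (real ^ 'n \<Rightarrow> real) \<Rightarrow> real ^ 'n \<Rightarrow> real" where
  "frac_laplacian s u x = frac_const CARD('n) s *
     Lim (at_right 0) (\<lambda>\<epsilon>. LINT y:{y. \<epsilon> < norm (x - y)}|lebesgue.
       (u x - u y) / norm (x - y) powr (real CARD('n) + 2 * s))"

definition splice_on :: "'a set \<Rightarrow> ('a \<Rightarrow> real) \<Rightarrow> ('a \<Rightarrow> real) \<Rightarrow> 'a \<Rightarrow> real" where
  "splice_on U \<phi> u z = (if z \<in> U then \<phi> z else u z)"

section \<open>Viscosity solutions of the elliptic equation \<open>a (-\<Delta>)\<^sup>s u - c u = f\<close>\<close>

definition elliptic_subsolution ::
  "real \<Rightarrow> (real ^ 'n \<Rightarrow> real) \<Rightarrow> (real ^ 'n \<Rightarrow> real) \<Rightarrow> (real ^ 'n \<Rightarrow> real) \<Rightarrow>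
   (real ^ 'n \<Rightarrow> real) \<Rightarrow> bool" where
  "elliptic_subsolution s a c f u \<longleftrightarrow>
     u \<in> Ls_space s \<and> usc_on UNIV u \<and>
     (\<forall>U x0 \<phi>. open U \<and> bounded U \<and> x0 \<in> U \<and> C2_on UNIV \<phi> \<and> u x0 = \<phi> x0 \<and>
        (\<forall>x\<in>U. u x0 - \<phi> x0 \<ge> u x - \<phi> x) \<longrightarrow>
        a x0 * frac_laplacian s (splice_on U \<phi> u) x0 - c x0 * u x0 \<le> f x0)"

definition elliptic_supersolution ::
  "real \<Rightarrow> (real ^ 'n \<Rightarrow> real) \<Rightarrow> (real ^ 'n \<Rightarrow> real) \<Rightarrow> (real ^ 'n \<Rightarrow> real) \<Rightarrow>
   (real ^ 'n \<Rightarrow> real) \<Rightarrow> bool" where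
  "elliptic_supersolution s a c f u \<longleftrightarrow>
     u \<in> Ls_space s \<and> lsc_on UNIV u \<and>
     (\<forall>U x0 \<phi>. open U \<and> bounded U \<and> x0 \<in> U \<and> C2_on UNIV \<phi> \<and> u x0 = \<phi> x0 \<and>
        (\<forall>x\<in>U. u x0 - \<phi> x0 \<le> u x - \<phi> x) \<longrightarrow>
        a x0 * frac_laplacian s (splice_on U \<phi> u) x0 - c x0 * u x0 \<ge> f x0)"

definition elliptic_solution ::
  "real \<Rightarrow> (real ^ 'n \<Rightarrow> real) \<Rightarrow> (real ^ 'n \<Rightarrow> real) \<Rightarrow> (real ^ 'n \<Rightarrow> real) \<Rightarrow>
   (real ^ 'n \<Rightarrow> real) \<Rightarrow> bool" where
  "elliptic_solution s a c f u \<longleftrightarrow>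
     elliptic_subsolution s a c f u \<and> elliptic_supersolution s a c f u"

section \<open>Viscosity solutions of the parabolic equation \<open>\<partial>\<^sub>t u = - a (-\<Delta>)\<^sup>s u + c u + f\<close>\<close>

text \<open>Space-time functions are total functions of \<open>(x, t)\<close>; their values for \<open>t < 0\<close> play no
  role.\<close>

definition S_inf :: "((real ^ 'n) \<times> real) set" where
  "S_inf = UNIV \<times> {0<..}"

definition S_inf_closed :: "((real ^ 'n) \<times> real) set" where
  "S_inf_closed = UNIV \<times> {0..}"

definition parabolic_subsolution ::
  "real \<Rightarrow> (real ^ 'n \<Rightarrow> real) \<Rightarrow> (real ^ 'n \<Rightarrow> real) \<Rightarrow> (real ^ 'n \<Rightarrow> real) \<Rightarrow>
   ((real ^ 'n) \<times> real \<Rightarrow> real) \<Rightarrow> bool" where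
  "parabolic_subsolution s a c f u \<longleftrightarrow>
     (\<forall>t>0. (\<lambda>x. u (x, t)) \<in> Ls_space s) \<and> usc_on S_inf u \<and>
     (\<forall>U x0 t0 \<phi>. open U \<and> bounded U \<and> U \<subseteq> S_inf \<and> (x0, t0) \<in> U \<and> C2_on S_inf \<phi> \<and>
        u (x0, t0) = \<phi> (x0, t0) \<and>
        (\<forall>z\<in>U. u (x0, t0) - \<phi> (x0, t0) \<ge> u z - \<phi> z) \<longrightarrow>
        deriv (\<lambda>t. splice_on U \<phi> u (x0, t)) t0 \<le>
          - a x0 * frac_laplacian s (\<lambda>x. splice_on U \<phi> u (x, t0)) x0
          + c x0 * u (x0, t0) + f x0)"

definition parabolic_supersolution ::
  "real \<Rightarrow> (real ^ 'n \<Rightarrow> real) \<Rightarrow> (real ^ 'n \<Rightarrow> real) \<Rightarrow> (real ^ 'n \<Rightarrow> real) \<Rightarrow>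
   ((real ^ 'n) \<times> real \<Rightarrow> real) \<Rightarrow> bool" where
  "parabolic_supersolution s a c f u \<longleftrightarrow>
     (\<forall>t>0. (\<lambda>x. u (x, t)) \<in> Ls_space s) \<and> lsc_on S_inf u \<and>
     (\<forall>U x0 t0 \<phi>. open U \<and> bounded U \<and> U \<subseteq> S_inf \<and> (x0, t0) \<in> U \<and> C2_on S_inf \<phi> \<and>
        u (x0, t0) = \<phi> (x0, t0) \<and>
        (\<forall>z\<in>U. u (x0, t0) - \<phi> (x0, t0) \<le> u z - \<phi> z) \<longrightarrow>
        deriv (\<lambda>t. splice_on U \<phi> u (x0, t)) t0 \<ge>
          - a x0 * frac_laplacian s (\<lambda>x. splice_on U \<phi> u (x, t0)) x0
          + c x0 * u (x0, t0) + f x0)"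

definition cauchy_subsolution ::
  "real \<Rightarrow> (real ^ 'n \<Rightarrow> real) \<Rightarrow> (real ^ 'n \<Rightarrow> real) \<Rightarrow> (real ^ 'n \<Rightarrow> real) \<Rightarrow>
   (real ^ 'n \<Rightarrow> real) \<Rightarrow> ((real ^ 'n) \<times> real \<Rightarrow> real) \<Rightarrow> bool" where
  "cauchy_subsolution s a c f u0 u \<longleftrightarrow>
     usc_on S_inf_closed u \<and> parabolic_subsolution s a c f u \<and> (\<forall>x. u (x, 0) \<le> u0 x)"

definition cauchy_supersolution ::
  "real \<Rightarrow> (real ^ 'n \<Rightarrow> real) \<Rightarrow> (real ^ 'n \<Rightarrow> real) \<Rightarrow> (real ^ 'n \<Rightarrow> real) \<Rightarrow>
   (real ^ 'n \<Rightarrow> real) \<Rightarrow> ((real ^ 'n) \<times> real \<Rightarrow> real) \<Rightarrow> bool" where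
  "cauchy_supersolution s a c f u0 u \<longleftrightarrow>
     lsc_on S_inf_closed u \<and> parabolic_supersolution s a c f u \<and> (\<forall>x. u (x, 0) \<ge> u0 x)"

definition cauchy_solution ::
  "real \<Rightarrow> (real ^ 'n \<Rightarrow> real) \<Rightarrow> (real ^ 'n \<Rightarrow> real) \<Rightarrow> (real ^ 'n \<Rightarrow> real) \<Rightarrow>
   (real ^ 'n \<Rightarrow> real) \<Rightarrow> ((real ^ 'n) \<times> real \<Rightarrow> real) \<Rightarrow> bool" where
  "cauchy_solution s a c f u0 u \<longleftrightarrow>
     cauchy_subsolution s a c f u0 u \<and> cauchy_supersolution s a c f u0 u"

end

theory Submission
  imports Defs
begin

text \<open>Let \<open>W\<close> and \<open>W'\<close> be the upper and lower relaxed limits of \<open>u (y, t)\<close> as \<open>y \<rightarrow> x\<close> and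
  \<open>t \<rightarrow> \<infinity>\<close>. They are sub- and supersolution of the elliptic equation, and both tend to \<open>\<gamma>\<close> at
  infinity because \<open>u\<close> is uniformly close to \<open>g\<close> there. Comparison then gives \<open>W \<le> W'\<close>; since
  \<open>W' \<le> W\<close> is trivial, \<open>W = W'\<close> is the solution and \<open>u\<close> converges to it.
  Nonlocality replaces barriers: at a positive maximum of a difference that vanishes at infinity,
  the fractional Laplacian is bounded below by the contribution of the far field. This yields
  both the comparison principle (after division by \<open>a\<close> and doubling of variables) and the
  boundedness of \<open>u\<close>. Throughout, a test function is only used on a ball of radius \<open>d\<close>, where its
  contribution is at most a constant times \<open>\<integral> near_kernel s d\<close>, which vanishes as \<open>d \<rightarrow> 0\<close>.\<close>

section \<open>The kernel near the origin and near infinity\<close>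

text \<open>The relaxed limits are merely semicontinuous, so nothing better than one-sided
  information on the increments of \<open>u\<close> survives as \<open>t\<close> tends to infinity.
  It passes through the nonlocal term by a Fatou-type estimate at a fixed radius \<open>d\<close>;
  only afterwards does \<open>d\<close> tend to 0. Since \<open>c \<le> 0\<close> may vanish, the
  zeroth-order term gives no strict inequality at a doubled maximum. Strictness comes from the mass
  of the kernel far away, a quantity that does not depend on the doubling penalty. The penalty is
  therefore fixed once, after the moduli of continuity of \<open>f / a\<close> and
  \<open>c / a\<close> on a compact set, and no limit in it is taken. Division by \<open>a\<close>
  puts the same operator at both points of the doubled maximum, so that the two families of
  increments can be added. \<open>Lim\<close> and \<open>deriv\<close> are total functions, with
  arbitrary values where no limit exists. Exchanging sub- and supersolutions by a change of sign is
  thus legitimate only once the principal value and the time derivative of the spliced test function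
  are known to exist.\<close>

definition tail_kernel :: "real \<Rightarrow> real \<Rightarrow> real ^ 'n \<Rightarrow> real" where
  "tail_kernel s d z = (if d \<le> norm z then 1 / norm z powr (real CARD('n) + 2 * s) else 0)"

text \<open>The factor \<open>(norm z)\<^sup>2\<close> is the size of a second difference of a
  smooth function, and it makes the singularity integrable when \<open>s < 1\<close>. The open ball
  here is exactly the complement of the region used in \<open>tail_kernel\<close>.\<close>

definition near_kernel :: "real \<Rightarrow> real \<Rightarrow> real ^ 'n \<Rightarrow> real" where
  "near_kernel s d z =
     (if norm z < d then (norm z)\<^sup>2 / norm z powr (real CARD('n) + 2 * s) else 0)"

lemma tail_kernel_nonneg [simp]: "0 \<le> tail_kernel s d z"
  by (simp add: tail_kernel_def)

lemma near_kernel_nonneg [simp]: "0 \<le> near_kernel s d z"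
  by (simp add: near_kernel_def)

lemma borel_measurable_tail_kernel [measurable]: "tail_kernel s d \<in> borel_measurable borel"
  unfolding tail_kernel_def by measurable

lemma borel_measurable_near_kernel [measurable]: "near_kernel s d \<in> borel_measurable borel"
  unfolding near_kernel_def by measurable

section \<open>Integrability of the kernels by dyadic decomposition\<close>

lemma lborel_integral_shift:
  fixes h :: "'a::euclidean_space \<Rightarrow> real"
  assumes [measurable]: "h \<in> borel_measurable borel"
  shows "(LINT z|lborel. h (x + z)) = (LINT z|lborel. h z)"
    and "integrable lborel (\<lambda>z. h (x + z)) \<longleftrightarrow> integrable lborel h"
  using integral_distr[of "(+) x" lborel borel h] integrable_distr_eq[of "(+) x" lborel borel h]
  by (simp_all add: lborel_distr_plus)

lemma lborel_integral_reflect: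
  fixes h :: "'a::euclidean_space \<Rightarrow> real"
  assumes [measurable]: "h \<in> borel_measurable borel"
  shows "(LINT z|lborel. h (- z)) = (LINT z|lborel. h z)"
    and "integrable lborel (\<lambda>z. h (- z)) \<longleftrightarrow> integrable lborel h"
proof -
  have "distr lborel borel uminus = (lborel :: 'a measure)"
    by (subst lborel_affine[of "-1" 0]) (auto simp: density_1 one_ennreal_def[symmetric])
  with integral_distr[of "uminus" lborel borel h] integrable_distr_eq[of "uminus" lborel borel h]
  show "(LINT z|lborel. h (- z)) = (LINT z|lborel. h z)"
    and "integrable lborel (\<lambda>z. h (- z)) \<longleftrightarrow> integrable lborel h"
    by simp_all
qed

text \<open>A substitute for polar coordinates. Each point of the support lies in some ball on which
  \<open>c j\<close> bounds \<open>h\<close>, so \<open>h\<close> is at most the sum of the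
  functions \<open>c j\<close> times the indicator of the ball; the integral of that sum is the
  volume of the unit ball times the given series.\<close>

lemma integrable_from_balls:
  fixes h :: "'a::euclidean_space \<Rightarrow> real"
  assumes h: "h \<in> borel_measurable borel" and nn: "\<And>z. 0 \<le> h z"
    and r: "\<And>j. 0 \<le> r j" and c: "\<And>j. 0 \<le> c j"
    and cover: "\<And>z. h z \<noteq> 0 \<Longrightarrow> \<exists>j. norm z < r j \<and> h z \<le> c j"
    and sm: "summable (\<lambda>j::nat. c j * r j ^ DIM('a))"
  shows "integrable lborel h"
proof (rule integrableI_bounded)
  have "(\<integral>\<^sup>+z. ennreal (norm (h z)) \<partial>lborel)
      \<le> (\<integral>\<^sup>+z. (\<Sum>j. ennreal (c j) * indicator (ball 0 (r j)) z) \<partial>(lborel::'a measure))"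
  proof (rule nn_integral_mono)
    fix z :: 'a
    show "ennreal (norm (h z)) \<le> (\<Sum>j. ennreal (c j) * indicator (ball 0 (r j)) z)"
    proof (cases "h z = 0")
      case False
      then obtain j where j: "norm z < r j" "h z \<le> c j" using cover by blast
      have "ennreal (norm (h z)) \<le> ennreal (c j) * indicator (ball 0 (r j)) z"
        using j nn[of z] by (simp add: ennreal_leI)
      also have "\<dots> = (\<Sum>i\<in>{j}. ennreal (c i) * indicator (ball 0 (r i)) z)"
        by (simp only: sum.insert sum.empty finite.emptyI empty_iff not_False_eq_True add_0_right)
      also have "\<dots> \<le> (\<Sum>i. ennreal (c i) * indicator (ball 0 (r i)) z)"
        by (rule sum_le_suminf) auto
      finally show ?thesis .
    qed simp
  qed
  also have "\<dots> = (\<Sum>j. \<integral>\<^sup>+z. ennreal (c j) * indicator (ball 0 (r j)) z \<partial>(lborel::'a measure))"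
  proof (rule nn_integral_suminf)
    fix j
    have "(indicator (ball 0 (r j)) :: 'a \<Rightarrow> ennreal) \<in> borel_measurable lborel"
      by (rule borel_measurable_indicator) simp
    then show "(\<lambda>z::'a. ennreal (c j) * indicator (ball 0 (r j)) z) \<in> borel_measurable lborel"
      by (intro borel_measurable_times_ennreal) simp_all
  qed
  also have "\<dots> = (\<Sum>j. ennreal (unit_ball_vol DIM('a) * (c j * r j ^ DIM('a))))"
    using r c by (intro suminf_cong)
      (simp add: nn_integral_cmult_indicator emeasure_ball ennreal_mult[symmetric] ac_simps)
  also have "\<dots> < \<infinity>"
  proof -
    have "summable (\<lambda>j. unit_ball_vol DIM('a) * (c j * r j ^ DIM('a)))"
      using sm by (rule summable_mult)
    moreover have "\<And>j. 0 \<le> unit_ball_vol DIM('a) * (c j * r j ^ DIM('a))"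
      using r c by simp
    ultimately have "(\<Sum>j. ennreal (unit_ball_vol DIM('a) * (c j * r j ^ DIM('a))))
        = ennreal (\<Sum>j. unit_ball_vol DIM('a) * (c j * r j ^ DIM('a)))"
      by (intro suminf_ennreal2)
    then show ?thesis by (simp only: infinity_ennreal_def ennreal_less_top)
  qed
  finally show "(\<integral>\<^sup>+z. ennreal (norm (h z)) \<partial>lborel) < \<infinity>" .
qed (use h in simp)

lemma dyadic_scale:
  fixes q :: real
  assumes "1 \<le> q"
  obtains j :: nat where "2 ^ j \<le> q" "q < 2 ^ Suc j"
proof -
  obtain m :: nat where m: "q < 2 ^ m" using real_arch_pow[of 2 q] by auto
  define i where "i = (LEAST m::nat. q < 2 ^ m)"
  have i: "q < 2 ^ i" unfolding i_def by (rule LeastI[of _ m]) (rule m)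
  have "i \<noteq> 0" using i assms by (intro notI) simp
  then obtain j where j: "i = Suc j" by (cases i) auto
  have "\<not> q < 2 ^ j" using not_less_Least[of j "\<lambda>m. q < 2 ^ m"] j i_def by simp
  then show ?thesis using that[of j] i j by simp
qed

text \<open>On the shell between the radii \<open>d * 2 ^ j\<close> and \<open>d * 2 ^ Suc j\<close>
  the kernel times the volume is of order \<open>(d * 2 ^ j) powr (- 2 * s)\<close>: a geometric
  series of ratio \<open>2 powr (- 2 * s)\<close>, which is below 1 because
  \<open>0 < s\<close>.\<close>

lemma integrable_tail_kernel:
  assumes s: "0 < s" and d: "0 < d"
  shows "integrable lborel (tail_kernel s d :: real ^ 'n \<Rightarrow> real)"
proof (rule integrable_from_balls)
  define p where "p = real CARD('n) + 2 * s"
  let ?r = "\<lambda>j. d * 2 ^ Suc j" and ?c = "\<lambda>j. (d * 2 ^ j) powr (- p)"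
  show "\<exists>j. norm z < ?r j \<and> tail_kernel s d z \<le> ?c j" if "tail_kernel s d z \<noteq> 0"
    for z :: "real ^ 'n"
  proof -
    have z: "d \<le> norm z" using that by (auto simp: tail_kernel_def split: if_splits)
    then have "1 \<le> norm z / d" using d by simp
    then obtain j where j: "2 ^ j \<le> norm z / d" "norm z / d < 2 ^ Suc j"
      by (rule dyadic_scale)
    have *: "d * 2 ^ j \<le> norm z" "norm z < d * 2 ^ Suc j"
      using j d by (simp_all add: field_simps)
    moreover have "tail_kernel s d z = norm z powr (- p)"
      using z powr_minus_divide[of "norm z" p] by (simp add: tail_kernel_def p_def[symmetric])
    moreover have "norm z powr (- p) \<le> (d * 2 ^ j) powr (- p)"
      using * d s by (intro powr_mono2') (auto simp: p_def)
    ultimately show ?thesis by (intro exI[of _ j]) simp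
  qed
  have "?c j * ?r j ^ DIM(real ^ 'n) = (d powr (- 2 * s) * 2 ^ CARD('n)) * (2 powr (- 2 * s)) ^ j" for j
  proof -
    have "?c j = (d * 2 ^ j) powr (- 2 * s) * (d * 2 ^ j) powr (- real CARD('n))"
      unfolding p_def by (simp add: powr_add[symmetric] algebra_simps)
    also have "\<dots> * ?r j ^ DIM(real ^ 'n) = (d * 2 ^ j) powr (- 2 * s) * 2 ^ CARD('n)"
      using d by (simp add: powr_minus powr_realpow power_mult_distrib field_simps)
    also have "(d * 2 ^ j) powr (- 2 * s) = d powr (- 2 * s) * (2 powr (- 2 * s)) ^ j"
      using d by (simp add: powr_mult powr_realpow[symmetric] powr_powr mult.commute)
    finally show ?thesis by simp
  qed
  moreover have "summable (\<lambda>j. (d powr (- 2 * s) * 2 ^ CARD('n)) * (2 powr (- 2 * s)) ^ j)"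
    using s by (intro summable_mult summable_geometric) (simp add: powr_less_one)
  ultimately show "summable (\<lambda>j. ?c j * ?r j ^ DIM(real ^ 'n))" by presburger
qed (use d in auto)

text \<open>The same count on shells shrinking to the origin; the two extra powers of the radius
  change the ratio to \<open>2 powr (- (2 - 2 * s))\<close>, which is below 1 because
  \<open>s < 1\<close>.\<close>

lemma integrable_near_kernel:
  assumes s: "0 < s" "s < 1" and d: "0 < d"
  shows "integrable lborel (near_kernel s d :: real ^ 'n \<Rightarrow> real)"
proof (rule integrable_from_balls)
  define p where "p = real CARD('n) + 2 * s"
  \<comment> \<open>The shell reaches its outer radius \<open>d / 2 ^ j\<close>. Doubling that
    radius puts the shell inside an open ball at the price of a constant factor.\<close>
  let ?r = "\<lambda>j. 2 * d / 2 ^ j" and ?c = "\<lambda>j. (2 * d / 2 ^ j)\<^sup>2 * (d / 2 ^ Suc j) powr (- p)"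
  show "\<exists>j. norm z < ?r j \<and> near_kernel s d z \<le> ?c j" if "near_kernel s d z \<noteq> 0"
    for z :: "real ^ 'n"
  proof -
    have z: "norm z < d" "0 < norm z" using that by (auto simp: near_kernel_def split: if_splits)
    then have "1 \<le> d / norm z" by simp
    then obtain j where j: "2 ^ j \<le> d / norm z" "d / norm z < 2 ^ Suc j"
      by (rule dyadic_scale)
    have *: "norm z \<le> d / 2 ^ j" "d / 2 ^ Suc j < norm z"
      using j z by (simp_all add: field_simps)
    have "norm z < ?r j" using *(1) d
      by (smt (verit) divide_strict_right_mono zero_less_power)
    moreover have "near_kernel s d z = (norm z)\<^sup>2 * norm z powr (- p)"
      using z powr_minus_divide[of "norm z" p] by (simp add: near_kernel_def p_def[symmetric])
    moreover have "norm z powr (- p) \<le> (d / 2 ^ Suc j) powr (- p)"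
      using * d s by (intro powr_mono2') (auto simp: p_def)
    moreover have "(norm z)\<^sup>2 \<le> (?r j)\<^sup>2" using \<open>norm z < ?r j\<close> by (intro power_mono) auto
    ultimately show ?thesis by (intro exI[of _ j]) (auto intro: mult_mono)
  qed
  have "?c j * ?r j ^ DIM(real ^ 'n)
      = (d powr (2 - 2 * s) * 4 * 4 ^ CARD('n) * 2 powr (2 * s)) * (2 powr (- (2 - 2 * s))) ^ j" for j
  proof -
    define e where "e = d / 2 ^ j"
    have e: "0 < e" using d by (simp add: e_def)
    have "?c j * ?r j ^ DIM(real ^ 'n) = (2 * e)\<^sup>2 * (e / 2) powr (- p) * (2 * e) ^ CARD('n)"
      by (simp add: e_def mult.commute)
    also have "(e / 2) powr (- p) = (e / 2) powr (- 2 * s) * (e / 2) powr (- real CARD('n))"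
      unfolding p_def by (simp add: powr_add[symmetric] algebra_simps)
    also have "(e / 2) powr (- real CARD('n)) = 2 ^ CARD('n) / e ^ CARD('n)"
      using e by (simp add: powr_minus powr_realpow power_divide field_simps)
    also have "(2 * e)\<^sup>2 * ((e / 2) powr (- 2 * s) * (2 ^ CARD('n) / e ^ CARD('n))) * (2 * e) ^ CARD('n)
        = 4 * 4 ^ CARD('n) * (e\<^sup>2 * (e / 2) powr (- 2 * s))"
      using e power_mult_distrib[of "2::real" 2 "CARD('n)"] by (simp add: power_mult_distrib field_simps)
    also have "e\<^sup>2 * (e / 2) powr (- 2 * s) = 2 powr (2 * s) * (e powr (2 - 2 * s))"
    proof -
      have "e\<^sup>2 = e powr 2" using e by (simp add: powr_numeral)
      then show ?thesis using e
        by (simp add: powr_divide powr_minus powr_diff field_simps)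
    qed
    also have "e powr (2 - 2 * s) = d powr (2 - 2 * s) * (2 powr (- (2 - 2 * s))) ^ j"
    proof -
      have "e = d * 2 powr (- real j)"
        by (simp add: e_def powr_minus_divide powr_realpow)
      then have "e powr (2 - 2 * s) = d powr (2 - 2 * s) * 2 powr (- real j * (2 - 2 * s))"
        using d by (simp only: powr_mult powr_powr)
      moreover have "(2 powr (- (2 - 2 * s))) ^ j = 2 powr (- (2 - 2 * s) * real j)"
        using powr_realpow[of "2 powr (- (2 - 2 * s))" j] by (simp only: powr_powr powr_gt_zero)
      moreover have "- real j * (2 - 2 * s) = - (2 - 2 * s) * real j" by (simp add: algebra_simps)
      ultimately show ?thesis by metis
    qed
    finally show ?thesis by (simp only: mult.assoc mult.left_commute mult.commute)
  qed
  moreover have "summable (\<lambda>j. (d powr (2 - 2 * s) * 4 * 4 ^ CARD('n) * 2 powr (2 * s))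
      * (2 powr (- (2 - 2 * s))) ^ j)"
    using s by (intro summable_mult summable_geometric) (simp add: powr_less_one)
  ultimately show "summable (\<lambda>j. ?c j * ?r j ^ DIM(real ^ 'n))" by presburger
qed (use d in auto)

text \<open>The supports shrink to the origin, where the kernel is 0 by the convention on division
  by 0, and \<open>near_kernel s 1\<close> dominates. The substitution \<open>d = inverse t\<close>
  brings the limit into the form of dominated convergence at infinity.\<close>

lemma near_kernel_integral_tendsto_0:
  assumes s: "0 < s" "s < 1"
  shows "((\<lambda>d. LINT z|lborel. near_kernel s d (z :: real ^ 'n)) \<longlongrightarrow> 0) (at_right 0)"
  unfolding filterlim_at_right_to_top
proof -
  have "((\<lambda>t. LINT z|lborel. near_kernel s (inverse t) (z :: real ^ 'n)) \<longlongrightarrow>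
      (LINT z|lborel. (\<lambda>_::real ^ 'n. 0::real) z)) at_top"
  proof (rule integral_dominated_convergence_at_top)
    show "integrable lborel (near_kernel s 1 :: real ^ 'n \<Rightarrow> real)"
      by (rule integrable_near_kernel) (use s in auto)
    show "\<forall>\<^sub>F t in at_top. AE z in lborel. norm (near_kernel s (inverse t) z) \<le> near_kernel s 1 (z :: real ^ 'n)"
      using eventually_ge_at_top[of "1::real"]
    proof eventually_elim
      case (elim t)
      then have "inverse t \<le> 1" by (simp add: inverse_le_1_iff)
      then show ?case by (intro AE_I2) (auto simp: near_kernel_def)
    qed
    show "AE z in lborel. ((\<lambda>t. near_kernel s (inverse t) (z :: real ^ 'n)) \<longlongrightarrow> 0) at_top"
    proof (rule AE_I2)
      fix z :: "real ^ 'n"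
      have "\<forall>\<^sub>F t in at_top. near_kernel s (inverse t) z = 0"
      proof (cases "z = 0")
        case False
        have "\<forall>\<^sub>F t in at_top. inverse t < norm z"
          using tendsto_inverse_0_at_top[OF filterlim_ident] False
          by (auto dest!: order_tendstoD(2)[where a = "norm z"])
        then show ?thesis by eventually_elim (simp add: near_kernel_def)
      qed (simp add: near_kernel_def)
      then show "((\<lambda>t. near_kernel s (inverse t) z) \<longlongrightarrow> 0) at_top"
        by (rule tendsto_eventually)
    qed
  qed auto
  then show "((\<lambda>t. LINT z|lborel. near_kernel s (inverse t) (z :: real ^ 'n)) \<longlongrightarrow> 0) at_top"
    by simp
qed

lemma frac_const_pos: "0 < s \<Longrightarrow> s < 1 \<Longrightarrow> 0 < frac_const N s"
  unfolding frac_const_def by (intro divide_pos_pos mult_pos_pos Gamma_real_pos) auto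

text \<open>Source of the strict inequality that both maximum arguments contradict. A ball of radius
  \<open>d\<close> centred at distance \<open>2 * d\<close> from the origin has positive measure and
  lies where the kernel is positive.\<close>

lemma tail_kernel_integral_pos:
  assumes "0 < s" "0 < d"
  shows "0 < (LINT z|lborel. tail_kernel s d (z :: real ^ 'n))"
proof -
  let ?k = "tail_kernel s d :: real ^ 'n \<Rightarrow> real"
  obtain b :: "real ^ 'n" where b: "norm b = 1" using vector_choose_size[of 1] by auto
  have "(LINT z|lborel. ?k z) \<noteq> 0"
  proof
    assume "(LINT z|lborel. ?k z) = 0"
    then have "AE z in lborel. ?k z = 0"
      using integrable_tail_kernel[OF assms, where ?'n='n] by (subst (asm) integral_nonneg_eq_0_iff_AE) auto
    then have "AE z in lborel. z \<notin> ball ((2 * d) *\<^sub>R b) d"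
    proof eventually_elim
      case (elim z)
      have "d < norm z" if "z \<in> ball ((2 * d) *\<^sub>R b) d"
      proof -
        have "norm ((2 * d) *\<^sub>R b) - norm z < d"
          using norm_triangle_ineq2[of "(2 * d) *\<^sub>R b" z] that by (simp add: dist_norm)
        then show ?thesis using b assms by simp
      qed
      then show ?case using elim assms by (fastforce simp: tail_kernel_def)
    qed
    then have "emeasure lborel (ball ((2 * d) *\<^sub>R b) d) = 0"
      by (subst (asm) AE_iff_measurable[where N = "ball ((2 * d) *\<^sub>R b) d"]) auto
    then show False using assms unit_ball_vol_pos[of "real CARD('n)"] by (simp add: emeasure_ball)
  qed
  moreover have "0 \<le> (LINT z|lborel. ?k z)" by (rule integral_nonneg_AE) auto
  ultimately show ?thesis by linarith
qed

section \<open>The principal value as an absolutely convergent integral\<close>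

lemma Ls_space_borel_iff:
  fixes v :: "real ^ 'n \<Rightarrow> real"
  assumes [measurable]: "v \<in> borel_measurable borel"
  shows "v \<in> Ls_space s \<longleftrightarrow>
    integrable lborel (\<lambda>x. \<bar>v x\<bar> / (1 + norm x powr (real CARD('n) + 2 * s)))"
  unfolding Ls_space_def by (simp add: integrable_completion measurable_completion)

lemma integrable_Ls_tail:
  fixes v :: "real ^ 'n \<Rightarrow> real"
  assumes [measurable]: "v \<in> borel_measurable borel" and v: "v \<in> Ls_space s"
    and s: "0 < s" and d: "0 < d"
  shows "integrable lborel (\<lambda>z. v (x + z) * tail_kernel s d z)"
proof (rule Bochner_Integration.integrable_bound)
  define p where "p = real CARD('n) + 2 * s"
  have p: "0 < p" using s by (simp add: p_def)
  \<comment> \<open>For \<open>d \<le> norm z\<close> the two summands bound \<open>1\<close> and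
    \<open>norm (x + z) powr p\<close>, respectively, by multiples of \<open>norm z powr p\<close>.
    So the tail of the kernel is at most \<open>C\<close> times the translated weight of
    \<open>Ls_space\<close>.\<close>
  define C where "C = 1 / d powr p + (norm x / d + 1) powr p"
  have "integrable lborel (\<lambda>y. \<bar>v y\<bar> / (1 + norm y powr p))"
    using v by (simp add: Ls_space_borel_iff p_def)
  then have "integrable lborel (\<lambda>z. \<bar>v (x + z)\<bar> / (1 + norm (x + z) powr p))"
    by (subst lborel_integral_shift(2)[of "\<lambda>y. \<bar>v y\<bar> / (1 + norm y powr p)"]) measurable
  then show "integrable lborel (\<lambda>z. C * (\<bar>v (x + z)\<bar> / (1 + norm (x + z) powr p)))"
    by (rule integrable_mult_right)
  show "AE z in lborel. norm (v (x + z) * tail_kernel s d z)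
      \<le> norm (C * (\<bar>v (x + z)\<bar> / (1 + norm (x + z) powr p)))"
  proof (rule AE_I2)
    fix z :: "real ^ 'n"
    have C: "0 \<le> C" by (simp add: C_def)
    have "tail_kernel s d z \<le> C / (1 + norm (x + z) powr p)"
    proof (cases "d \<le> norm z")
      case True
      then have z: "0 < norm z" using d by (rule less_le_trans[rotated])
      have "norm (x + z) \<le> norm x + norm z" by (rule norm_triangle_ineq)
      also have "norm x \<le> norm x / d * norm z"
        using True d mult_left_mono[OF True norm_ge_zero[of x]] by (simp add: field_simps)
      finally have "norm (x + z) \<le> (norm x / d + 1) * norm z" by (simp add: algebra_simps)
      then have "norm (x + z) powr p \<le> ((norm x / d + 1) * norm z) powr p"
        using p by (intro powr_mono2) auto
      also have "\<dots> = (norm x / d + 1) powr p * norm z powr p"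
        using d by (simp add: powr_mult)
      finally have 1: "norm (x + z) powr p \<le> (norm x / d + 1) powr p * norm z powr p" .
      have "d powr p \<le> norm z powr p" using True d p by (intro powr_mono2) auto
      then have "1 \<le> 1 / d powr p * norm z powr p" using d by (simp add: field_simps)
      with 1 have "1 + norm (x + z) powr p \<le> C * norm z powr p"
        by (simp add: C_def algebra_simps)
      moreover have "0 < 1 + norm (x + z) powr p" by (simp add: add_pos_nonneg)
      moreover have "tail_kernel s d z = 1 / norm z powr p"
        using True by (simp add: tail_kernel_def p_def)
      moreover have "1 / norm z powr p \<le> C / (1 + norm (x + z) powr p)"
        if "1 + norm (x + z) powr p \<le> C * norm z powr p" "0 < 1 + norm (x + z) powr p"
        using z that by (simp add: field_simps)
      ultimately show ?thesis by simp
    next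
      case False
      then show ?thesis using C by (simp add: tail_kernel_def add_nonneg_nonneg)
    qed
    then have "\<bar>v (x + z)\<bar> * tail_kernel s d z \<le> \<bar>v (x + z)\<bar> * (C / (1 + norm (x + z) powr p))"
      by (rule mult_left_mono) simp
    also have "\<dots> = norm (C * (\<bar>v (x + z)\<bar> / (1 + norm (x + z) powr p)))"
    proof -
      have "0 \<le> 1 + norm (x + z) powr p" by simp
      then show ?thesis using C by (simp add: abs_mult)
    qed
    finally show "norm (v (x + z) * tail_kernel s d z)
      \<le> norm (C * (\<bar>v (x + z)\<bar> / (1 + norm (x + z) powr p)))"
      by (simp add: abs_mult)
  qed
qed measurable

lemma integrable_increment_tail:
  fixes v :: "real ^ 'n \<Rightarrow> real"
  assumes "v \<in> borel_measurable borel" "v \<in> Ls_space s" "0 < s" "0 < d"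
  shows "integrable lborel (\<lambda>z. (b - v (x + z)) * tail_kernel s d z)"
  using integrable_Ls_tail[OF assms, of x] integrable_tail_kernel[OF assms(3,4), where ?'n='n]
  by (simp add: left_diff_distrib)

text \<open>Symmetrised in \<open>z\<close>, so every increment is counted twice; this is why
  \<open>near_part\<close> always enters with a factor 1/2.\<close>

definition near_part :: "real \<Rightarrow> real \<Rightarrow> (real ^ 'n \<Rightarrow> real) \<Rightarrow> real ^ 'n \<Rightarrow> real" where
  "near_part s d v x = (LINT z|lborel. (if norm z < d then
     (2 * v x - v (x + z) - v (x - z)) / norm z powr (real CARD('n) + 2 * s) else 0))"

definition far_part :: "real \<Rightarrow> real \<Rightarrow> (real ^ 'n \<Rightarrow> real) \<Rightarrow> real ^ 'n \<Rightarrow> real" where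
  "far_part s d v x = (LINT z|lborel. ((v x - v (x + z)) * tail_kernel s d z))"

text \<open>The symmetric difference at one point is all that the principal value sees. The
  condition survives splicing, a change of sign and restriction to a time slice, so derivatives
  serve only to produce the constant \<open>B\<close>.\<close>

definition C2_bounded_at :: "real \<Rightarrow> real \<Rightarrow> ('a::real_normed_vector \<Rightarrow> real) \<Rightarrow> 'a \<Rightarrow> bool" where
  "C2_bounded_at d B v x \<longleftrightarrow> (\<forall>z. norm z < d \<longrightarrow> \<bar>v (x + z) + v (x - z) - 2 * v x\<bar> \<le> B * (norm z)\<^sup>2)"

lemma near_integrand_le:
  fixes v :: "real ^ 'n \<Rightarrow> real"
  assumes "C2_bounded_at d B v x"
  shows "\<bar>if norm z < d then (2 * v x - v (x + z) - v (x - z)) / norm z powr (real CARD('n) + 2 * s) else 0\<bar>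
    \<le> B * near_kernel s d z"
proof (cases "norm z < d")
  case True
  then have "\<bar>2 * v x - v (x + z) - v (x - z)\<bar> \<le> B * (norm z)\<^sup>2"
    using assms unfolding C2_bounded_at_def by (smt (verit))
  then have "\<bar>2 * v x - v (x + z) - v (x - z)\<bar> / norm z powr (real CARD('n) + 2 * s)
      \<le> B * (norm z)\<^sup>2 / norm z powr (real CARD('n) + 2 * s)"
    by (rule divide_right_mono) simp
  then show ?thesis using True by (simp add: near_kernel_def)
qed (simp add: near_kernel_def)

lemma integrable_near_part:
  fixes v :: "real ^ 'n \<Rightarrow> real"
  assumes [measurable]: "v \<in> borel_measurable borel" and b: "C2_bounded_at d B v x"
    and s: "0 < s" "s < 1" and d: "0 < d"
  shows "integrable lborel (\<lambda>z. if norm z < d then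
     (2 * v x - v (x + z) - v (x - z)) / norm z powr (real CARD('n) + 2 * s) else 0)"
proof (rule Bochner_Integration.integrable_bound)
  show "integrable lborel (\<lambda>z::real ^ 'n. B * near_kernel s d z)"
    using integrable_near_kernel[OF s d, where ?'n='n] by simp
  show "AE z in lborel. norm (if norm z < d then
     (2 * v x - v (x + z) - v (x - z)) / norm z powr (real CARD('n) + 2 * s) else 0)
     \<le> norm (B * near_kernel s d z)"
    using order_trans[OF near_integrand_le[OF b, of _ s] abs_ge_self]
    by (intro AE_I2) (simp only: real_norm_def)
qed measurable

lemma near_part_bound:
  fixes v :: "real ^ 'n \<Rightarrow> real"
  assumes [measurable]: "v \<in> borel_measurable borel" and b: "C2_bounded_at d B v x"
    and s: "0 < s" "s < 1" and d: "0 < d"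
  shows "\<bar>near_part s d v x\<bar> \<le> B * (LINT z|lborel. near_kernel s d (z :: real ^ 'n))"
proof -
  have "\<bar>near_part s d v x\<bar> \<le> (LINT z|lborel. B * near_kernel s d (z :: real ^ 'n))"
    unfolding near_part_def
    by (rule integral_abs_bound_integral)
      (use near_integrand_le[OF b, of _ s] integrable_near_part[OF assms]
        integrable_near_kernel[OF s d, where ?'n='n] in simp_all)
  then show ?thesis by simp
qed

lemma truncated_frac_integral:
  fixes v :: "real ^ 'n \<Rightarrow> real"
  assumes [measurable]: "v \<in> borel_measurable borel"
  shows "(LINT y:{y. e < norm (x - y)}|lebesgue. (v x - v y) / norm (x - y) powr (real CARD('n) + 2 * s))
    = (LINT z|lborel. (if e < norm z then (v x - v (x + z)) / norm z powr (real CARD('n) + 2 * s) else 0))"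
proof -
  let ?h = "\<lambda>y. if e < norm (x - y) then (v x - v y) / norm (x - y) powr (real CARD('n) + 2 * s) else 0"
  have "(LINT y:{y. e < norm (x - y)}|lebesgue. (v x - v y) / norm (x - y) powr (real CARD('n) + 2 * s))
      = (LINT y|lebesgue. ?h y)"
    unfolding set_lebesgue_integral_def by (rule Bochner_Integration.integral_cong) auto
  also have "\<dots> = (LINT y|lborel. ?h y)"
    by (rule integral_completion) measurable
  also have "\<dots> = (LINT z|lborel. ?h (x + z))"
    by (rule lborel_integral_shift(1)[symmetric]) measurable
  also have "\<dots> = (LINT z|lborel. (if e < norm z then (v x - v (x + z)) / norm z powr (real CARD('n) + 2 * s) else 0))"
    by (rule Bochner_Integration.integral_cong) simp_all
  finally show ?thesis .
qed

text \<open>Averaging the annulus integral over \<open>z\<close> and \<open>- z\<close> turns increments into second differences,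
  which makes the principal value an absolutely convergent integral.\<close>

lemma truncated_frac_split:
  fixes v :: "real ^ 'n \<Rightarrow> real"
  assumes [measurable]: "v \<in> borel_measurable borel" and v: "v \<in> Ls_space s"
    and b: "C2_bounded_at d B v x" and s: "0 < s" "s < 1" and e: "0 < e" "e < d"
  shows "(LINT z|lborel. (if e < norm z then (v x - v (x + z)) / norm z powr (real CARD('n) + 2 * s) else 0))
    = far_part s d v x + near_part s d v x / 2
      - (LINT z|lborel. (if norm z \<le> e then
          (2 * v x - v (x + z) - v (x - z)) / norm z powr (real CARD('n) + 2 * s) else 0)) / 2"
proof -
  define k where "k z = 1 / norm z powr (real CARD('n) + 2 * s)" for z :: "real ^ 'n"
  define A where "A z = (if e < norm z \<and> norm z < d then (v x - v (x + z)) * k z else 0)" for z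
  have k: "k (- z) = k z" for z by (simp add: k_def)
  have [measurable]: "k \<in> borel_measurable borel" unfolding k_def by measurable
  have [measurable]: "A \<in> borel_measurable borel" unfolding A_def by measurable
  have iA: "integrable lborel A"
  proof (rule Bochner_Integration.integrable_bound)
    show "integrable lborel (\<lambda>z. (v x - v (x + z)) * tail_kernel s e z)"
      by (rule integrable_increment_tail) (use v s e in auto)
    show "AE z in lborel. norm (A z) \<le> norm ((v x - v (x + z)) * tail_kernel s e z)"
      by (intro AE_I2) (auto simp: A_def k_def tail_kernel_def)
  qed measurable
  have iA': "integrable lborel (\<lambda>z. A (- z))" "(LINT z|lborel. A (- z)) = (LINT z|lborel. A z)"
    using iA lborel_integral_reflect[of A] by simp_all
  have iF: "integrable lborel (\<lambda>z. (v x - v (x + z)) * tail_kernel s d z)"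
    by (rule integrable_increment_tail) (use v s e in auto)
  have iN: "integrable lborel (\<lambda>z. if norm z < d then (2 * v x - v (x + z) - v (x - z)) / norm z powr (real CARD('n) + 2 * s) else 0)"
    by (rule integrable_near_part[OF _ b]) (use s e in auto)
  have iE: "integrable lborel (\<lambda>z. if norm z \<le> e then (2 * v x - v (x + z) - v (x - z)) / norm z powr (real CARD('n) + 2 * s) else 0)"
    by (rule Bochner_Integration.integrable_bound[OF iN]) (use e in \<open>auto intro!: AE_I2\<close>)
  have "(LINT z|lborel. (if e < norm z then (v x - v (x + z)) / norm z powr (real CARD('n) + 2 * s) else 0))
      = (LINT z|lborel. (v x - v (x + z)) * tail_kernel s d z + A z)"
    by (rule Bochner_Integration.integral_cong) (use e in \<open>auto simp: A_def k_def tail_kernel_def\<close>)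
  also have "\<dots> = far_part s d v x + (LINT z|lborel. A z)"
    using iF iA by (simp add: far_part_def)
  also have "(LINT z|lborel. A z) = (LINT z|lborel. A z + A (- z)) / 2"
    using iA iA' by simp
  also have "(LINT z|lborel. A z + A (- z)) = (LINT z|lborel.
      (if norm z < d then (2 * v x - v (x + z) - v (x - z)) / norm z powr (real CARD('n) + 2 * s) else 0)
      - (if norm z \<le> e then (2 * v x - v (x + z) - v (x - z)) / norm z powr (real CARD('n) + 2 * s) else 0))"
    by (rule Bochner_Integration.integral_cong) (use e in \<open>auto simp: A_def k_def diff_divide_distrib add_divide_distrib\<close>)
  also have "\<dots> = near_part s d v x
      - (LINT z|lborel. (if norm z \<le> e then
          (2 * v x - v (x + z) - v (x - z)) / norm z powr (real CARD('n) + 2 * s) else 0))"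
    using iN iE by (simp add: near_part_def)
  finally show ?thesis by (simp add: diff_divide_distrib)
qed

text \<open>The part of the symmetrised integral over \<open>norm z \<le> e\<close> is controlled by
  the mass of the near kernel and vanishes with \<open>e\<close>. This proves that the principal
  value converges, hence that \<open>Lim\<close> has its intended value; all later facts about
  \<open>frac_laplacian\<close> rest on this identity.\<close>

lemma frac_laplacian_eq:
  fixes v :: "real ^ 'n \<Rightarrow> real"
  assumes [measurable]: "v \<in> borel_measurable borel" and v: "v \<in> Ls_space s"
    and b: "C2_bounded_at d B v x" and s: "0 < s" "s < 1" and d: "0 < d"
  shows "frac_laplacian s v x = frac_const CARD('n) s * (far_part s d v x + near_part s d v x / 2)"
proof -
  let ?E = "\<lambda>e. LINT z|lborel. (if norm z \<le> e then
          (2 * v x - v (x + z) - v (x - z)) / norm z powr (real CARD('n) + 2 * s) else 0)"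
  let ?T = "\<lambda>e. LINT y:{y. e < norm (x - y)}|lebesgue. (v x - v y) / norm (x - y) powr (real CARD('n) + 2 * s)"
  let ?K = "\<lambda>e. LINT z|lborel. near_kernel s e (z :: real ^ 'n)"
  have ev: "\<forall>\<^sub>F e in at_right 0. e \<in> {0<..<d / 2}"
    using d by (intro eventually_at_right_real) auto
  have "(?E \<longlongrightarrow> 0) (at_right 0)"
  proof (rule Lim_null_comparison)
    have "filterlim (\<lambda>e. 2 * e :: real) (at_right 0) (at_right 0)"
      by (rule filterlim_times_pos[OF filterlim_ident]) auto
    then show "((\<lambda>e. B * ?K (2 * e)) \<longlongrightarrow> 0) (at_right 0)"
      using filterlim_compose[OF near_kernel_integral_tendsto_0[OF s, where ?'n='n]]
      by (intro tendsto_mult_right_zero) 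
    show "\<forall>\<^sub>F e in at_right 0. norm (?E e) \<le> B * ?K (2 * e)"
      using ev
    proof eventually_elim
      case (elim e)
      \<comment> \<open>The remainder lives on the closed ball of radius \<open>e\<close>, the near
        kernel on an open one, hence the radius \<open>2 * e\<close>; it stays below
        \<open>d\<close> because \<open>e < d / 2\<close>.\<close>
      have b': "C2_bounded_at (2 * e) B v x"
        using b elim by (auto simp: C2_bounded_at_def)
      have le: "\<bar>if norm z \<le> e then (2 * v x - v (x + z) - v (x - z)) / norm z powr (real CARD('n) + 2 * s) else 0\<bar>
          \<le> B * near_kernel s (2 * e) z" for z
        using near_integrand_le[OF b', of z s] order_trans[OF abs_ge_zero near_integrand_le[OF b', of z s]] elim
        by (auto split: if_splits)
      have iK: "integrable lborel (\<lambda>z::real ^ 'n. B * near_kernel s (2 * e) z)"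
        using integrable_near_kernel[OF s, of "2 * e", where ?'n='n] elim by simp
      have "\<bar>?E e\<bar> \<le> (LINT z|lborel. B * near_kernel s (2 * e) (z :: real ^ 'n))"
      proof (rule integral_abs_bound_integral[OF _ iK le])
        show "integrable lborel (\<lambda>z. if norm z \<le> e then (2 * v x - v (x + z) - v (x - z)) / norm z powr (real CARD('n) + 2 * s) else 0)"
        proof (rule Bochner_Integration.integrable_bound[OF iK])
          show "AE z in lborel. norm (if norm z \<le> e then (2 * v x - v (x + z) - v (x - z)) / norm z powr (real CARD('n) + 2 * s) else 0)
              \<le> norm (B * near_kernel s (2 * e) z)"
            using order_trans[OF le abs_ge_self] by (intro AE_I2) (simp only: real_norm_def)
        qed measurable
      qed
      then show ?case by simp
    qed
  qed
  then have "((\<lambda>e. far_part s d v x + near_part s d v x / 2 - ?E e / 2) \<longlongrightarrow>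
      far_part s d v x + near_part s d v x / 2 - 0 / 2) (at_right 0)"
    by (intro tendsto_intros) simp_all
  moreover have "\<forall>\<^sub>F e in at_right 0. far_part s d v x + near_part s d v x / 2 - ?E e / 2 = ?T e"
    using ev
  proof eventually_elim
    case (elim e)
    then show ?case
      using truncated_frac_integral[of v e x s] truncated_frac_split[OF _ v b s, of e] by simp
  qed
  ultimately have "(?T \<longlongrightarrow> far_part s d v x + near_part s d v x / 2) (at_right 0)"
    by (simp add: tendsto_cong)
  then have "Lim (at_right 0) ?T = far_part s d v x + near_part s d v x / 2"
    by (intro tendsto_Lim) simp_all
  then show ?thesis by (simp add: frac_laplacian_def)
qed

text \<open>Not formal: for a divergent principal value \<open>Lim\<close> is unspecified and need
  not change sign. The hypotheses are those that force convergence.\<close>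

lemma frac_laplacian_uminus:
  fixes v :: "real ^ 'n \<Rightarrow> real"
  assumes [measurable]: "v \<in> borel_measurable borel" and v: "v \<in> Ls_space s"
    and b: "C2_bounded_at d B v x" and s: "0 < s" "s < 1" and d: "0 < d"
  shows "frac_laplacian s (\<lambda>y. - v y) x = - frac_laplacian s v x"
proof -
  have "(\<lambda>y. - v y) \<in> Ls_space s" using v by (simp add: Ls_space_def)
  moreover have "C2_bounded_at d B (\<lambda>y. - v y) x"
    using b by (auto simp: C2_bounded_at_def abs_if split: if_splits)
  ultimately have "frac_laplacian s (\<lambda>y. - v y) x
      = frac_const CARD('n) s * (far_part s d (\<lambda>y. - v y) x + near_part s d (\<lambda>y. - v y) x / 2)"
    by (intro frac_laplacian_eq) (use s d in auto)
  moreover have "far_part s d (\<lambda>y. - v y) x = - far_part s d v x"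
    unfolding far_part_def
    by (subst Bochner_Integration.integral_minus[symmetric], rule Bochner_Integration.integral_cong) (auto simp: algebra_simps)
  moreover have "near_part s d (\<lambda>y. - v y) x = - near_part s d v x"
    unfolding near_part_def
    by (subst Bochner_Integration.integral_minus[symmetric], rule Bochner_Integration.integral_cong) (auto simp: diff_divide_distrib add_divide_distrib)
  ultimately show ?thesis
    using frac_laplacian_eq[OF assms] by (simp add: algebra_simps)
qed

section \<open>Functions of class \<open>C\<^sup>2\<close>\<close>

lemma C2_on_imp_continuous_on:
  assumes "C2_on S f"
  shows "continuous_on S f"
  using assms unfolding C2_on_def
  by (blast intro: continuous_at_imp_continuous_on has_derivative_continuous)

lemma C2_on_add:
  assumes "C2_on S f" "C2_on S g"
  shows "C2_on S (\<lambda>x. f x + g x)"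
proof -
  obtain f' f'' where f: "\<And>x. x \<in> S \<Longrightarrow> (f has_derivative blinfun_apply (f' x)) (at x)"
      "\<And>x. x \<in> S \<Longrightarrow> (f' has_derivative blinfun_apply (f'' x)) (at x)" "continuous_on S f''"
    using assms(1) unfolding C2_on_def by blast
  obtain g' g'' where g: "\<And>x. x \<in> S \<Longrightarrow> (g has_derivative blinfun_apply (g' x)) (at x)"
      "\<And>x. x \<in> S \<Longrightarrow> (g' has_derivative blinfun_apply (g'' x)) (at x)" "continuous_on S g''"
    using assms(2) unfolding C2_on_def by blast
  show ?thesis
    unfolding C2_on_def
    by (rule exI[of _ "\<lambda>x. f' x + g' x"], rule exI[of _ "\<lambda>x. f'' x + g'' x"])
      (auto simp: plus_blinfun.rep_eq intro!: has_derivative_add f g continuous_on_add)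
qed

lemma C2_on_const: "C2_on S (\<lambda>x. k)"
  unfolding C2_on_def
  by (rule exI[of _ "\<lambda>x. 0"], rule exI[of _ "\<lambda>x. 0"]) (auto simp: zero_blinfun.rep_eq)

lemma C2_on_uminus:
  assumes "C2_on S f"
  shows "C2_on S (\<lambda>x. - f x)"
proof -
  obtain f' f'' where f: "\<And>x. x \<in> S \<Longrightarrow> (f has_derivative blinfun_apply (f' x)) (at x)"
      "\<And>x. x \<in> S \<Longrightarrow> (f' has_derivative blinfun_apply (f'' x)) (at x)" "continuous_on S f''"
    using assms(1) unfolding C2_on_def by blast
  show ?thesis
    unfolding C2_on_def
    by (rule exI[of _ "\<lambda>x. - f' x"], rule exI[of _ "\<lambda>x. - f'' x"])
      (auto simp: uminus_blinfun.rep_eq intro!: has_derivative_minus f continuous_on_minus)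
qed

lemma C2_on_norm_square:
  fixes b :: "'a::real_inner"
  shows "C2_on S (\<lambda>x. q * (norm (x - b))\<^sup>2)"
proof -
  have "((\<lambda>x. q * (norm (x - b))\<^sup>2) has_derivative blinfun_apply ((2 * q) *\<^sub>R blinfun_inner_right (x - b))) (at x)" for x
    unfolding power2_norm_eq_inner
    by (auto intro!: derivative_eq_intros ext simp: blinfun.scaleR_left inner_commute algebra_simps)
  moreover have "((\<lambda>x. (2 * q) *\<^sub>R blinfun_inner_right (x - b)) has_derivative
      blinfun_apply ((2 * q) *\<^sub>R Blinfun blinfun_inner_right)) (at x)" for x
    by (auto intro!: derivative_eq_intros bounded_linear.has_derivative[OF bounded_linear_blinfun_inner_right] ext
      simp: blinfun.scaleR_left bounded_linear_Blinfun_apply[OF bounded_linear_blinfun_inner_right])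
  ultimately show ?thesis
    unfolding C2_on_def
    by (intro exI[of _ "\<lambda>x. (2 * q) *\<^sub>R blinfun_inner_right (x - b)"]
        exI[of _ "\<lambda>x. (2 * q) *\<^sub>R Blinfun blinfun_inner_right"]) (auto intro: continuous_on_const)
qed

text \<open>Applied to the two projections of space-time, it turns functions of \<open>x\<close>
  alone or of \<open>t\<close> alone into parabolic test functions.\<close>

lemma C2_on_compose_linear:
  fixes L :: "'b::real_normed_vector \<Rightarrow>\<^sub>L 'a::real_normed_vector"
  assumes "C2_on UNIV f"
  shows "C2_on S (\<lambda>x. f (blinfun_apply L x))"
proof -
  obtain f' f'' where f: "\<And>x. (f has_derivative blinfun_apply (f' x)) (at x)"
      "\<And>x. (f' has_derivative blinfun_apply (f'' x)) (at x)" "continuous_on UNIV f''"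
    using assms(1) unfolding C2_on_def by blast
  \<comment> \<open>The derivative of \<open>f \<circ> L\<close> takes values in functionals on the
    new space, so precomposition with \<open>L\<close> must itself be packaged as a bounded linear
    map in order to differentiate a second time.\<close>
  define R :: "('a \<Rightarrow>\<^sub>L real) \<Rightarrow>\<^sub>L ('b \<Rightarrow>\<^sub>L real)" where "R = Blinfun (\<lambda>A. A o\<^sub>L L)"
  have bl: "bounded_linear (\<lambda>A::'a \<Rightarrow>\<^sub>L real. A o\<^sub>L L)"
    by (rule bounded_bilinear.bounded_linear_left[OF bounded_bilinear_blinfun_compose])
  have R: "blinfun_apply R A = A o\<^sub>L L" for A
    by (simp add: R_def bounded_linear_Blinfun_apply[OF bl])
  have L: "(blinfun_apply L has_derivative blinfun_apply L) (at x)" for x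
    by (rule bounded_linear_imp_has_derivative) (rule blinfun.bounded_linear_right)
  have 1: "((\<lambda>x. f (blinfun_apply L x)) has_derivative blinfun_apply (f' (blinfun_apply L x) o\<^sub>L L)) (at x)" for x
    using has_derivative_compose[OF L f(1)] by (simp add: o_def blinfun_compose.rep_eq)
  have 2: "((\<lambda>x. f' (blinfun_apply L x)) has_derivative (\<lambda>h. blinfun_apply (f'' (blinfun_apply L x)) (blinfun_apply L h))) (at x)" for x
    using has_derivative_compose[OF L f(2)] by (simp add: o_def)
  have 3: "((\<lambda>x. f' (blinfun_apply L x) o\<^sub>L L) has_derivative blinfun_apply (R o\<^sub>L f'' (blinfun_apply L x) o\<^sub>L L)) (at x)" for x
    using bounded_linear.has_derivative[OF bl 2, of x] by (simp add: R o_def blinfun_compose.rep_eq)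
  have "continuous_on S (\<lambda>x. f'' (blinfun_apply L x))"
    by (rule continuous_on_compose2[OF f(3)]) (auto intro!: continuous_intros)
  then have "continuous_on S (\<lambda>x. R o\<^sub>L f'' (blinfun_apply L x) o\<^sub>L L)"
    by (intro bounded_bilinear.continuous_on[OF bounded_bilinear_blinfun_compose] continuous_on_const)
  with 1 3 show ?thesis
    unfolding C2_on_def
    by (intro exI[of _ "\<lambda>x. f' (blinfun_apply L x) o\<^sub>L L"]
        exI[of _ "\<lambda>x. R o\<^sub>L f'' (blinfun_apply L x) o\<^sub>L L"]) simp
qed

text \<open>The even function \<open>f (x + t z) + f (x - t z)\<close> of \<open>t\<close> changes
  between 0 and 1 by exactly the second difference. One mean value step turns this into a difference
  of first derivatives at distance at most \<open>2 * norm z\<close>, and a bound of the second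
  derivative on \<open>K\<close> does the rest. The constant is uniform in \<open>x\<close>, which
  matters when contact points move.\<close>

lemma C2_on_second_difference:
  fixes f :: "'a::euclidean_space \<Rightarrow> real"
  assumes f: "C2_on S f" and K: "compact K" "convex K" "K \<subseteq> S"
  shows "\<exists>B\<ge>0. \<forall>x z. x + z \<in> K \<longrightarrow> x - z \<in> K \<longrightarrow> \<bar>f (x + z) + f (x - z) - 2 * f x\<bar> \<le> B * (norm z)\<^sup>2"
proof -
  obtain f' f'' where f: "\<And>x. x \<in> S \<Longrightarrow> (f has_derivative blinfun_apply (f' x)) (at x)"
      "\<And>x. x \<in> S \<Longrightarrow> (f' has_derivative blinfun_apply (f'' x)) (at x)" "continuous_on S f''"
    using assms(1) unfolding C2_on_def by blast
  have "bounded (f'' ` K)"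
    using K f(3) by (intro compact_imp_bounded compact_continuous_image) (auto intro: continuous_on_subset)
  then obtain M where M: "\<And>x. x \<in> K \<Longrightarrow> norm (f'' x) \<le> M" "0 < M"
    unfolding bounded_pos by blast
  have fK: "(f' has_derivative blinfun_apply (f'' x)) (at x within K)" if "x \<in> K" for x
    using has_derivative_at_withinI[OF f(2)] K(3) that by blast
  have lip: "norm (f' y - f' x) \<le> M * norm (y - x)" if "x \<in> K" "y \<in> K" for x y
    by (rule differentiable_bound[OF K(2), where f' = "\<lambda>x. blinfun_apply (f'' x)"])
      (use M(1) that fK in \<open>auto simp: norm_blinfun.rep_eq[symmetric]\<close>)
  have "\<bar>f (x + z) + f (x - z) - 2 * f x\<bar> \<le> (2 * M) * (norm z)\<^sup>2" if xz: "x + z \<in> K" "x - z \<in> K" for x z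
  proof -
    have seg: "x + t *\<^sub>R z \<in> K" if "\<bar>t\<bar> \<le> 1" for t
    proof -
      have "x + t *\<^sub>R z = ((1 + t) / 2) *\<^sub>R (x + z) + ((1 - t) / 2) *\<^sub>R (x - z)"
        by (simp add: algebra_simps add_divide_distrib diff_divide_distrib)
          (simp add: scaleR_add_left[symmetric] scaleR_diff_left[symmetric] add.assoc[symmetric])
      also have "\<dots> \<in> K"
        by (rule convexD[OF K(2)]) (use xz that in \<open>auto simp: field_simps abs_le_iff\<close>)
      finally show ?thesis .
    qed
    define h where "h t = f (x + t *\<^sub>R z) + f (x + (- t) *\<^sub>R z)" for t
    have h: "(h has_derivative (\<lambda>r. r * (blinfun_apply (f' (x + t *\<^sub>R z) - f' (x + (- t) *\<^sub>R z)) z))) (at t)"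
      if "0 \<le> t" "t \<le> 1" for t
    proof -
      have "((\<lambda>t. f (x + t *\<^sub>R z)) has_derivative (\<lambda>r. blinfun_apply (f' (x + t *\<^sub>R z)) (r *\<^sub>R z))) (at t)"
        by (rule has_derivative_compose[of "\<lambda>t. x + t *\<^sub>R z", OF _ f(1)])
          (use seg[of t] that K in \<open>auto intro!: derivative_eq_intros\<close>)
      moreover have "((\<lambda>t. f (x + (- t) *\<^sub>R z)) has_derivative (\<lambda>r. blinfun_apply (f' (x + (- t) *\<^sub>R z)) ((- r) *\<^sub>R z))) (at t)"
        by (rule has_derivative_compose[of "\<lambda>t. x + (- t) *\<^sub>R z", OF _ f(1)])
          (use seg[of "- t"] that K in \<open>auto intro!: derivative_eq_intros\<close>)
      ultimately have "(h has_derivative (\<lambda>r. blinfun_apply (f' (x + t *\<^sub>R z)) (r *\<^sub>R z)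
          + blinfun_apply (f' (x + (- t) *\<^sub>R z)) ((- r) *\<^sub>R z))) (at t)"
        unfolding h_def by (rule has_derivative_add)
      then show ?thesis
        by (simp add: blinfun.scaleR_right blinfun.diff_left blinfun.minus_right algebra_simps)
    qed
    obtain t where t: "0 < t" "t < 1"
      and eq: "h 1 - h 0 = (1 - 0) * (blinfun_apply (f' (x + t *\<^sub>R z) - f' (x + (- t) *\<^sub>R z)) z)"
    proof -
      have "\<exists>t\<in>{0<..<1}. h 1 - h 0 = (1 - 0) * (blinfun_apply (f' (x + t *\<^sub>R z) - f' (x + (- t) *\<^sub>R z)) z)"
        by (rule mvt_simple) (use h in \<open>simp_all add: has_derivative_at_withinI\<close>)
      then show ?thesis using that by (meson greaterThanLessThan_iff)
    qed
    have "\<bar>h 1 - h 0\<bar> \<le> norm (f' (x + t *\<^sub>R z) - f' (x + (- t) *\<^sub>R z)) * norm z"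
      unfolding eq using norm_blinfun[of "f' (x + t *\<^sub>R z) - f' (x + (- t) *\<^sub>R z)" z] by simp
    also have "\<dots> \<le> (M * norm ((x + t *\<^sub>R z) - (x + (- t) *\<^sub>R z))) * norm z"
      using lip[of "x + (- t) *\<^sub>R z" "x + t *\<^sub>R z"] seg[of t] seg[of "- t"] t by (intro mult_right_mono) auto
    also have "(x + t *\<^sub>R z) - (x + (- t) *\<^sub>R z) = (2 * t) *\<^sub>R z"
      by (simp add: scaleR_2[symmetric])
    also have "(M * norm ((2 * t) *\<^sub>R z)) * norm z \<le> (2 * M) * (norm z)\<^sup>2"
      using t M mult_right_mono[of t 1 "norm z * norm z"] by (simp add: power2_eq_square)
    finally show ?thesis by (simp add: h_def algebra_simps)
  qed
  then show ?thesis using M(2) by (intro exI[of _ "2 * M"]) auto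
qed

lemma C2_bounded_at_near:
  fixes \<phi> v :: "'a::euclidean_space \<Rightarrow> real"
  assumes "C2_on S \<phi>" and "open U" "x \<in> U" "open S" "x \<in> S" and "\<And>y. y \<in> U \<Longrightarrow> v y = \<phi> y"
  shows "\<exists>d>0. \<exists>B. C2_bounded_at d B v x"
proof -
  have "open (U \<inter> S)" "x \<in> U \<inter> S" using assms by auto
  then obtain d where d: "0 < d" "cball x d \<subseteq> U \<inter> S" using open_contains_cball by blast
  obtain B where B: "\<And>y z. y + z \<in> cball x d \<Longrightarrow> y - z \<in> cball x d \<Longrightarrow> \<bar>\<phi> (y + z) + \<phi> (y - z) - 2 * \<phi> y\<bar> \<le> B * (norm z)\<^sup>2"
    using C2_on_second_difference[OF assms(1), of "cball x d"] d by auto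
  have "C2_bounded_at d B v x"
    unfolding C2_bounded_at_def
  proof (intro allI impI)
    fix z :: 'a assume "norm z < d"
    then have "x + z \<in> cball x d" "x - z \<in> cball x d" "x \<in> cball x d" using d by (auto simp: dist_norm)
    moreover from this have "x + z \<in> U" "x - z \<in> U" "x \<in> U" using d by blast+
    ultimately show "\<bar>v (x + z) + v (x - z) - 2 * v x\<bar> \<le> B * (norm z)\<^sup>2"
      using B[of x z] by (simp add: assms(6))
  qed
  then show ?thesis using d by blast
qed

section \<open>Testing viscosity solutions\<close>

lemma usc_on_uminus_iff: "usc_on S (\<lambda>x. - f x) \<longleftrightarrow> lsc_on S f"
proof
  assume *: "usc_on S (\<lambda>x. - f x)"
  show "lsc_on S f"
    unfolding lsc_on_def
  proof (intro ballI allI impI)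
    fix x r assume "x \<in> S" "r < f x"
    then have "\<forall>\<^sub>F y in at x within S. - f y < - r"
      using *[unfolded usc_on_def, rule_format, of x "- r"] by simp
    then show "\<forall>\<^sub>F y in at x within S. r < f y" by simp
  qed
next
  assume *: "lsc_on S f"
  show "usc_on S (\<lambda>x. - f x)"
    unfolding usc_on_def
  proof (intro ballI allI impI)
    fix x r assume "x \<in> S" "- f x < r"
    then have "\<forall>\<^sub>F y in at x within S. - r < f y"
      using *[unfolded lsc_on_def, rule_format, of x "- r"] by simp
    then show "\<forall>\<^sub>F y in at x within S. - f y < r" by eventually_elim simp
  qed
qed

lemma usc_lsc_imp_continuous_on:
  assumes "usc_on S f" "lsc_on S f"
  shows "continuous_on S f"
  unfolding continuous_on_def
  by (intro ballI order_tendstoI) (use assms in \<open>auto simp: usc_on_def lsc_on_def\<close>)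

lemma continuous_on_imp_usc_lsc:
  assumes "continuous_on S f"
  shows "usc_on S f" "lsc_on S f"
  using assms unfolding continuous_on_def usc_on_def lsc_on_def by (auto dest: order_tendstoD)

lemma usc_on_UNIV_open:
  assumes "usc_on UNIV v"
  shows "open {x. v x < r}"
proof (subst open_subopen, safe)
  fix x assume "v x < r"
  then have "\<forall>\<^sub>F y in at x. v y < r" using assms by (auto simp: usc_on_def)
  then have "\<forall>\<^sub>F y in nhds x. v y < r" using \<open>v x < r\<close> by (simp add: eventually_nhds_conv_at)
  then show "\<exists>T. open T \<and> x \<in> T \<and> T \<subseteq> {x. v x < r}" unfolding eventually_nhds by blast
qed

lemma usc_on_UNIV_borel:
  fixes v :: "'a::topological_space \<Rightarrow> real"
  assumes "usc_on UNIV v"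
  shows "v \<in> borel_measurable borel"
  using usc_on_UNIV_open[OF assms] by (intro borel_measurableI_less) auto

lemma lsc_on_UNIV_borel:
  fixes v :: "'a::topological_space \<Rightarrow> real"
  assumes "lsc_on UNIV v"
  shows "v \<in> borel_measurable borel"
  using usc_on_UNIV_borel[of "\<lambda>x. - v x"] assms by (simp add: usc_on_uminus_iff)

text \<open>Splicing alters \<open>v\<close> only on a bounded set, where \<open>\<phi>\<close> is
  bounded by compactness of the closure, so the weighted integral changes by a finite
  amount.\<close>

lemma splice_on_borel_Ls:
  fixes v :: "real ^ 'n \<Rightarrow> real"
  assumes U: "open U" "bounded U" and \<phi>: "continuous_on UNIV \<phi>"
    and v[measurable]: "v \<in> borel_measurable borel" and Ls: "v \<in> Ls_space s"
  shows "splice_on U \<phi> v \<in> borel_measurable borel" "splice_on U \<phi> v \<in> Ls_space s"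
proof -
  have [measurable]: "\<phi> \<in> borel_measurable borel" using \<phi> by (rule borel_measurable_continuous_onI)
  have [measurable]: "U \<in> sets borel" using U by simp
  show [measurable]: "splice_on U \<phi> v \<in> borel_measurable borel"
    unfolding splice_on_def by measurable
  have "compact (closure U)" using U by (simp add: compact_closure)
  then have "bounded (\<phi> ` closure U)"
    using \<phi> by (intro compact_imp_bounded compact_continuous_image) (auto intro: continuous_on_subset)
  then obtain K where K: "\<And>x. x \<in> U \<Longrightarrow> \<bar>\<phi> x\<bar> \<le> K" "0 < K"
    unfolding bounded_pos using closure_subset[of U] by auto
  let ?w = "\<lambda>x::real ^ 'n. 1 + norm x powr (real CARD('n) + 2 * s)"
  have "integrable lborel (\<lambda>x. \<bar>splice_on U \<phi> v x\<bar> / ?w x)"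
  proof (rule Bochner_Integration.integrable_bound)
    have "integrable lborel (indicat_real U)"
      using emeasure_bounded_finite[OF U(2)] U by (intro integrable_real_indicator) auto
    then show "integrable lborel (\<lambda>x. \<bar>v x\<bar> / ?w x + K * indicator U x)"
      using Ls by (intro Bochner_Integration.integrable_add) (simp_all add: Ls_space_borel_iff)
    show "AE x in lborel. norm (\<bar>splice_on U \<phi> v x\<bar> / ?w x) \<le> norm (\<bar>v x\<bar> / ?w x + K * indicator U x)"
    proof (rule AE_I2)
      fix x
      have w: "1 \<le> ?w x" by simp
      then have v0: "0 \<le> \<bar>v x\<bar> / ?w x" by (intro divide_nonneg_nonneg) auto
      show "norm (\<bar>splice_on U \<phi> v x\<bar> / ?w x) \<le> norm (\<bar>v x\<bar> / ?w x + K * indicator U x)"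
      proof (cases "x \<in> U")
        case True
        have w0: "0 < ?w x" using w by linarith
        have "\<bar>\<phi> x\<bar> / ?w x \<le> \<bar>\<phi> x\<bar>"
          using mult_left_mono[OF w abs_ge_zero, of "\<phi> x"] by (simp only: pos_divide_le_eq[OF w0] mult_1_right)
        then have "\<bar>\<phi> x\<bar> / ?w x \<le> K" using K(1)[OF True] by simp
        moreover have "0 \<le> \<bar>\<phi> x\<bar> / ?w x" using w by (intro divide_nonneg_nonneg) auto
        ultimately have "norm (\<bar>\<phi> x\<bar> / ?w x) \<le> \<bar>v x\<bar> / ?w x + K"
          using v0 by (simp only: real_norm_def abs_of_nonneg)
        also have "\<dots> \<le> norm (\<bar>v x\<bar> / ?w x + K)" by simp
        finally show ?thesis using True by (simp add: splice_on_def)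
      next
        case False
        then show ?thesis using v0 by (simp add: splice_on_def)
      qed
    qed
  qed measurable
  then show "splice_on U \<phi> v \<in> Ls_space s" by (simp add: Ls_space_borel_iff)
qed

lemma C2_bounded_at_slice:
  fixes w :: "'a::real_normed_vector \<times> real \<Rightarrow> real"
  assumes "C2_bounded_at d B w (x, t)"
  shows "C2_bounded_at d B (\<lambda>y. w (y, t)) x"
  unfolding C2_bounded_at_def
proof (intro allI impI)
  fix z :: 'a assume "norm z < d"
  then show "\<bar>w (x + z, t) + w (x - z, t) - 2 * w (x, t)\<bar> \<le> B * (norm z)\<^sup>2"
    using assms[unfolded C2_bounded_at_def, rule_format, of "(z, 0)"] by (simp add: norm_Pair)
qed

lemma splice_on_slice:
  "(\<lambda>x. splice_on U \<phi> u (x, t)) = splice_on ((\<lambda>x. (x, t)) -` U) (\<lambda>x. \<phi> (x, t)) (\<lambda>x. u (x, t))"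
  by (auto simp: splice_on_def)

lemma splice_on_uminus: "splice_on U (\<lambda>x. - \<phi> x) (\<lambda>x. - v x) = (\<lambda>x. - splice_on U \<phi> v x)"
  by (auto simp: splice_on_def)

lemma open_S_inf: "open (S_inf :: ((real ^ 'n) \<times> real) set)"
  unfolding S_inf_def by (intro open_Times) auto

lemma slice_vimage_open_bounded:
  assumes "open U" "bounded U"
  shows "open ((\<lambda>x. (x, t)) -` U)" "bounded ((\<lambda>x. (x, t)) -` U)"
proof -
  show "open ((\<lambda>x. (x, t)) -` U)" by (rule open_vimage[OF assms(1)]) (intro continuous_intros)
  have "(\<lambda>x. (x, t)) -` U \<subseteq> fst ` U" by force
  then show "bounded ((\<lambda>x. (x, t)) -` U)" using bounded_fst[OF assms(2)] bounded_subset by blast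
qed

text \<open>A time slice of a splice is the splice of the slices over the slice of \<open>U\<close>,
  so the elliptic regularity facts apply at each fixed time.\<close>

lemma parabolic_splice_slice:
  fixes u :: "(real ^ 'n) \<times> real \<Rightarrow> real"
  assumes U: "open U" "bounded U" "U \<subseteq> S_inf" "(x0, t0) \<in> U" and \<phi>: "C2_on S_inf \<phi>"
    and u: "(\<lambda>x. u (x, t0)) \<in> borel_measurable borel" "(\<lambda>x. u (x, t0)) \<in> Ls_space s"
  shows "(\<lambda>x. splice_on U \<phi> u (x, t0)) \<in> borel_measurable borel"
    and "(\<lambda>x. splice_on U \<phi> u (x, t0)) \<in> Ls_space s"
    and "\<exists>d>0. \<exists>B. C2_bounded_at d B (\<lambda>x. splice_on U \<phi> u (x, t0)) x0"
proof -
  have "0 < t0" using U by (auto simp: S_inf_def)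
  then have "continuous_on UNIV (\<lambda>x. \<phi> (x, t0))"
    by (intro continuous_on_compose2[OF C2_on_imp_continuous_on[OF \<phi>]] continuous_intros) (auto simp: S_inf_def)
  from splice_on_borel_Ls[OF slice_vimage_open_bounded[OF U(1,2)] this u]
  show "(\<lambda>x. splice_on U \<phi> u (x, t0)) \<in> borel_measurable borel"
    and "(\<lambda>x. splice_on U \<phi> u (x, t0)) \<in> Ls_space s"
    by (simp_all add: splice_on_slice)
  have "\<exists>d>0. \<exists>B. C2_bounded_at d B (splice_on U \<phi> u) (x0, t0)"
    by (rule C2_bounded_at_near[OF \<phi> U(1,4) open_S_inf]) (use U in \<open>auto simp: splice_on_def\<close>)
  then show "\<exists>d>0. \<exists>B. C2_bounded_at d B (\<lambda>x. splice_on U \<phi> u (x, t0)) x0"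
    using C2_bounded_at_slice by blast
qed

lemma parabolic_splice_time_derivative:
  assumes U: "open U" "(x0, t0) \<in> U"
  shows "((\<lambda>t. splice_on U \<phi> u (x0, t)) has_real_derivative D) (at t0) \<longleftrightarrow>
    ((\<lambda>t. \<phi> (x0, t)) has_real_derivative D) (at t0)"
proof (rule DERIV_cong_ev)
  have "open ((\<lambda>t. (x0, t)) -` U)" by (rule open_vimage[OF U(1)]) (intro continuous_intros)
  then show "\<forall>\<^sub>F t in nhds t0. splice_on U \<phi> u (x0, t) = \<phi> (x0, t)"
    using U(2) unfolding eventually_nhds by (intro exI[of _ "(\<lambda>t. (x0, t)) -` U"]) (auto simp: splice_on_def)
qed simp_all

lemma C2_on_time_differentiable:
  assumes "C2_on S \<phi>" "(x0, t0) \<in> S"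
  shows "\<exists>D. ((\<lambda>t. \<phi> (x0, t)) has_real_derivative D) (at t0)"
proof -
  obtain f' where f': "(\<phi> has_derivative blinfun_apply f') (at (x0, t0))"
    using assms unfolding C2_on_def by blast
  have "((\<lambda>t. (x0, t)) has_derivative (\<lambda>h. (0, h))) (at t0)"
    by (auto intro!: derivative_eq_intros)
  from has_derivative_compose[OF this f']
  have "((\<lambda>t. \<phi> (x0, t)) has_derivative (\<lambda>h. blinfun_apply f' (0, h))) (at t0)" .
  then show ?thesis
    using has_derivative_imp_has_field_derivative differentiable_def real_differentiable_def by blast
qed

section \<open>Exchange of sub- and supersolutions by a change of sign\<close>

text \<open>By linearity, negating \<open>v\<close>, \<open>f\<close> and the test function reverses
  touching and inequality together. The only analytic point is the sign rule for the fractional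
  Laplacian of the splice, which is smooth near the contact point and lies in
  \<open>Ls_space\<close>.\<close>

lemma elliptic_supersolution_iff:
  fixes v :: "real ^ 'n \<Rightarrow> real"
  assumes s: "0 < s" "s < 1"
  shows "elliptic_supersolution s a c f v \<longleftrightarrow> elliptic_subsolution s a c (\<lambda>x. - f x) (\<lambda>x. - v x)"
proof -
  have L: "(\<lambda>x. - v x) \<in> Ls_space s \<longleftrightarrow> v \<in> Ls_space s" by (simp add: Ls_space_def)
  have neg: "frac_laplacian s (splice_on U (\<lambda>x. - \<phi> x) (\<lambda>x. - v x)) x0 = - frac_laplacian s (splice_on U \<phi> v) x0"
    if v: "v \<in> Ls_space s" "lsc_on UNIV v" and U: "open U" "bounded U" "x0 \<in> U" "C2_on UNIV \<phi>" for U \<phi> x0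
  proof -
    have vb: "v \<in> borel_measurable borel" using lsc_on_UNIV_borel v by blast
    have reg: "splice_on U \<phi> v \<in> borel_measurable borel" "splice_on U \<phi> v \<in> Ls_space s"
      using splice_on_borel_Ls[OF U(1,2) C2_on_imp_continuous_on[OF U(4)] vb v(1)] by auto
    obtain d B where "0 < d" "C2_bounded_at d B (splice_on U \<phi> v) x0"
      using C2_bounded_at_near[OF U(4,1,3), of "splice_on U \<phi> v"] by (auto simp: splice_on_def)
    then show ?thesis
      using frac_laplacian_uminus[OF reg _ s] unfolding splice_on_uminus by blast
  qed
  show ?thesis
  proof
    assume sup: "elliptic_supersolution s a c f v"
    show "elliptic_subsolution s a c (\<lambda>x. - f x) (\<lambda>x. - v x)"
      unfolding elliptic_subsolution_def
    proof (intro conjI allI impI)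
      fix U x0 \<phi>
      assume H: "open U \<and> bounded U \<and> x0 \<in> U \<and> C2_on UNIV \<phi> \<and> - v x0 = \<phi> x0 \<and> (\<forall>x\<in>U. - v x - \<phi> x \<le> - v x0 - \<phi> x0)"
      have C: "C2_on UNIV (\<lambda>x. - \<phi> x)" using H by (auto intro: C2_on_uminus)
      have 1: "\<forall>x\<in>U. v x0 - - \<phi> x0 \<le> v x - - \<phi> x" "v x0 = - \<phi> x0"
        using H by (auto simp: algebra_simps)
      have "a x0 * frac_laplacian s (splice_on U (\<lambda>x. - \<phi> x) v) x0 - c x0 * v x0 \<ge> f x0"
        using sup H C 1 unfolding elliptic_supersolution_def by blast
      moreover have "frac_laplacian s (splice_on U \<phi> (\<lambda>x. - v x)) x0 = - frac_laplacian s (splice_on U (\<lambda>x. - \<phi> x) v) x0"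
        using neg[of U x0 "\<lambda>x. - \<phi> x"] sup H C unfolding elliptic_supersolution_def by simp
      ultimately show "a x0 * frac_laplacian s (splice_on U \<phi> (\<lambda>x. - v x)) x0 - c x0 * - v x0 \<le> - f x0"
        by simp
    qed (use sup in \<open>auto simp: elliptic_supersolution_def L usc_on_uminus_iff\<close>)
  next
    assume sub: "elliptic_subsolution s a c (\<lambda>x. - f x) (\<lambda>x. - v x)"
    show "elliptic_supersolution s a c f v"
      unfolding elliptic_supersolution_def
    proof (intro conjI allI impI)
      fix U x0 \<phi>
      assume H: "open U \<and> bounded U \<and> x0 \<in> U \<and> C2_on UNIV \<phi> \<and> v x0 = \<phi> x0 \<and> (\<forall>x\<in>U. v x0 - \<phi> x0 \<le> v x - \<phi> x)"
      have C: "C2_on UNIV (\<lambda>x. - \<phi> x)" using H by (auto intro: C2_on_uminus)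
      have 1: "\<forall>x\<in>U. - v x0 - - \<phi> x0 \<ge> - v x - - \<phi> x" "- v x0 = - \<phi> x0"
        using H by (auto simp: algebra_simps)
      have "a x0 * frac_laplacian s (splice_on U (\<lambda>x. - \<phi> x) (\<lambda>x. - v x)) x0 - c x0 * - v x0 \<le> - f x0"
        using sub H C 1 unfolding elliptic_subsolution_def by blast
      moreover have "frac_laplacian s (splice_on U (\<lambda>x. - \<phi> x) (\<lambda>x. - v x)) x0 = - frac_laplacian s (splice_on U \<phi> v) x0"
        using neg[of U x0 \<phi>] sub H unfolding elliptic_subsolution_def by (simp add: L usc_on_uminus_iff)
      ultimately show "f x0 \<le> a x0 * frac_laplacian s (splice_on U \<phi> v) x0 - c x0 * v x0"
        by simp
    qed (use sub in \<open>auto simp: elliptic_subsolution_def L usc_on_uminus_iff\<close>)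
  qed
qed

text \<open>As in the elliptic case, but the time derivative must also be genuine before its sign
  may be changed; near the contact point the splice is the test function, which is differentiable in
  time.\<close>

lemma parabolic_supersolution_uminus:
  fixes u :: "(real ^ 'n) \<times> real \<Rightarrow> real"
  assumes s: "0 < s" "s < 1" and sup: "parabolic_supersolution s a c f u"
    and ub: "\<And>t. 0 < t \<Longrightarrow> (\<lambda>x. u (x, t)) \<in> borel_measurable borel"
  shows "parabolic_subsolution s a c (\<lambda>x. - f x) (\<lambda>z. - u z)"
  unfolding parabolic_subsolution_def
proof (intro conjI allI impI)
  have Ls: "\<And>t. 0 < t \<Longrightarrow> (\<lambda>x. u (x, t)) \<in> Ls_space s"
    using sup by (auto simp: parabolic_supersolution_def)
  then show "\<And>t. 0 < t \<Longrightarrow> (\<lambda>x. - u (x, t)) \<in> Ls_space s"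
    by (simp add: Ls_space_def)
  show "usc_on S_inf (\<lambda>z. - u z)"
    using sup by (auto simp: parabolic_supersolution_def usc_on_uminus_iff)
  fix U x0 t0 \<phi>
  assume H: "open U \<and> bounded U \<and> U \<subseteq> S_inf \<and> (x0, t0) \<in> U \<and> C2_on S_inf \<phi> \<and>
     - u (x0, t0) = \<phi> (x0, t0) \<and> (\<forall>z\<in>U. - u z - \<phi> z \<le> - u (x0, t0) - \<phi> (x0, t0))"
  define \<psi> where "\<psi> = (\<lambda>z. - \<phi> z)"
  have \<psi>: "C2_on S_inf \<psi>" "\<And>z. \<phi> z = - \<psi> z" using H by (auto simp: \<psi>_def intro: C2_on_uminus)
  have \<phi>: "\<phi> = (\<lambda>z. - \<psi> z)" by (simp add: \<psi>_def)
  have 1: "\<forall>z\<in>U. u (x0, t0) - \<psi> (x0, t0) \<le> u z - \<psi> z" "u (x0, t0) = \<psi> (x0, t0)"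
    using H by (auto simp: algebra_simps \<psi>(2))
  have t0: "0 < t0" using H by (auto simp: S_inf_def)
  have ineq: "deriv (\<lambda>t. splice_on U \<psi> u (x0, t)) t0 \<ge>
          - a x0 * frac_laplacian s (\<lambda>x. splice_on U \<psi> u (x, t0)) x0
          + c x0 * u (x0, t0) + f x0"
    using sup H 1 \<psi>(1) unfolding parabolic_supersolution_def by blast
  have reg: "(\<lambda>x. splice_on U \<psi> u (x, t0)) \<in> borel_measurable borel"
      "(\<lambda>x. splice_on U \<psi> u (x, t0)) \<in> Ls_space s"
      "\<exists>d>0. \<exists>B. C2_bounded_at d B (\<lambda>x. splice_on U \<psi> u (x, t0)) x0"
    using parabolic_splice_slice[of U x0 t0 \<psi> u s] H \<psi>(1) ub[OF t0] Ls[OF t0] by auto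
  then have fl: "frac_laplacian s (\<lambda>x. splice_on U \<phi> (\<lambda>z. - u z) (x, t0)) x0
      = - frac_laplacian s (\<lambda>x. splice_on U \<psi> u (x, t0)) x0"
    using frac_laplacian_uminus[OF reg(1,2) _ s] unfolding \<phi> splice_on_uminus by blast
  obtain D where "((\<lambda>t. \<psi> (x0, t)) has_real_derivative D) (at t0)"
    using C2_on_time_differentiable[OF \<psi>(1), of x0 t0] t0 by (auto simp: S_inf_def)
  then have D: "((\<lambda>t. splice_on U \<psi> u (x0, t)) has_real_derivative D) (at t0)"
    using H by (simp add: parabolic_splice_time_derivative)
  then have "((\<lambda>t. splice_on U \<phi> (\<lambda>z. - u z) (x0, t)) has_real_derivative - D) (at t0)"
    unfolding \<phi> splice_on_uminus by (rule DERIV_minus)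
  with D have "deriv (\<lambda>t. splice_on U \<phi> (\<lambda>z. - u z) (x0, t)) t0 = - deriv (\<lambda>t. splice_on U \<psi> u (x0, t)) t0"
    by (simp add: DERIV_imp_deriv)
  with ineq fl show "deriv (\<lambda>t. splice_on U \<phi> (\<lambda>z. - u z) (x0, t)) t0
      \<le> - a x0 * frac_laplacian s (\<lambda>x. splice_on U \<phi> (\<lambda>z. - u z) (x, t0)) x0
        + c x0 * - u (x0, t0) + - f x0"
    by simp
qed

section \<open>Viscosity inequalities with an explicit error term\<close>

text \<open>The far part reads \<open>w\<close> only at \<open>x0\<close> and outside the ball of
  radius \<open>d\<close>, where \<open>w\<close> and \<open>v\<close> agree; the near part is
  bounded below by \<open>- B\<close> times the mass of the near kernel.\<close>

lemma frac_laplacian_splice_ge: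
  fixes v :: "real ^ 'n \<Rightarrow> real"
  assumes w: "w \<in> borel_measurable borel" "w \<in> Ls_space s"
    and s: "0 < s" "s < 1" and d: "0 < d"
    and B: "C2_bounded_at d B w x0"
    and out: "\<And>y. d \<le> norm (y - x0) \<Longrightarrow> w y = v y" and x0: "w x0 = v x0"
  shows "frac_const CARD('n) s * (far_part s d v x0
    - B / 2 * (LINT z|lborel. near_kernel s d (z :: real ^ 'n))) \<le> frac_laplacian s w x0"
proof -
  have "far_part s d w x0 = far_part s d v x0"
    unfolding far_part_def
    by (rule Bochner_Integration.integral_cong) (use out x0 in \<open>auto simp: tail_kernel_def\<close>)
  moreover have "\<bar>near_part s d w x0\<bar> \<le> B * (LINT z|lborel. near_kernel s d (z :: real ^ 'n))"
    by (rule near_part_bound[OF w(1) B s d])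
  ultimately show ?thesis
    unfolding frac_laplacian_eq[OF w B s d]
    using frac_const_pos[OF s, of "CARD('n)"] by (intro mult_left_mono) auto
qed

text \<open>The usable form of the definition: the far part contains the true values of
  \<open>v\<close>, which can be compared with those of another function, and of the test function
  only the constant \<open>B\<close> remains.\<close>

lemma elliptic_subsolution_test:
  fixes v :: "real ^ 'n \<Rightarrow> real"
  assumes s: "0 < s" "s < 1" and sub: "elliptic_subsolution s a c f v" and a: "0 < a x0"
    and \<phi>: "C2_on UNIV \<phi>" "C2_bounded_at d B \<phi> x0" and d: "0 < d"
    and touch: "v x0 = \<phi> x0" "\<And>x. x \<in> ball x0 d \<Longrightarrow> v x \<le> \<phi> x"
  shows "a x0 * (frac_const CARD('n) s * (far_part s d v x0
    - B / 2 * (LINT z|lborel. near_kernel s d (z :: real ^ 'n)))) - c x0 * v x0 \<le> f x0"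
proof -
  let ?w = "splice_on (ball x0 d) \<phi> v"
  have v: "v \<in> borel_measurable borel" "v \<in> Ls_space s"
    using sub usc_on_UNIV_borel by (auto simp: elliptic_subsolution_def)
  have w: "?w \<in> borel_measurable borel" "?w \<in> Ls_space s"
    using splice_on_borel_Ls[OF _ _ C2_on_imp_continuous_on[OF \<phi>(1)] v] by auto
  have "C2_bounded_at d B ?w x0"
    using \<phi>(2) d by (auto simp: C2_bounded_at_def splice_on_def dist_norm)
  then have "frac_const CARD('n) s * (far_part s d v x0
    - B / 2 * (LINT z|lborel. near_kernel s d (z :: real ^ 'n))) \<le> frac_laplacian s ?w x0"
    by (rule frac_laplacian_splice_ge[OF w s d])
      (use touch d in \<open>auto simp: splice_on_def dist_norm norm_minus_commute\<close>)
  then have "a x0 * (frac_const CARD('n) s * (far_part s d v x0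
    - B / 2 * (LINT z|lborel. near_kernel s d (z :: real ^ 'n)))) \<le> a x0 * frac_laplacian s ?w x0"
    using a by (intro mult_left_mono) auto
  moreover have "a x0 * frac_laplacian s ?w x0 - c x0 * v x0 \<le> f x0"
    using sub \<phi>(1) touch d unfolding elliptic_subsolution_def by auto
  ultimately show ?thesis by linarith
qed

lemma parabolic_subsolution_test:
  fixes u :: "(real ^ 'n) \<times> real \<Rightarrow> real"
  assumes s: "0 < s" "s < 1" and sub: "parabolic_subsolution s a c f u" and a: "0 < a x0"
    and ub: "(\<lambda>x. u (x, t0)) \<in> borel_measurable borel"
    and \<phi>: "C2_on S_inf \<phi>" "C2_bounded_at d B (\<lambda>x. \<phi> (x, t0)) x0"
    and D: "((\<lambda>t. \<phi> (x0, t)) has_real_derivative D) (at t0)"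
    and d: "0 < d" and \<tau>: "0 < \<tau>" "\<tau> \<le> t0"
    and touch: "u (x0, t0) = \<phi> (x0, t0)"
      "\<And>x t. x \<in> ball x0 d \<Longrightarrow> t \<in> ball t0 \<tau> \<Longrightarrow> u (x, t) \<le> \<phi> (x, t)"
  shows "D + a x0 * (frac_const CARD('n) s * (far_part s d (\<lambda>x. u (x, t0)) x0
    - B / 2 * (LINT z|lborel. near_kernel s d (z :: real ^ 'n)))) - c x0 * u (x0, t0) \<le> f x0"
proof -
  \<comment> \<open>On a cylinder the slice at \<open>t0\<close> is exactly the ball of radius
    \<open>d\<close>, and \<open>\<tau> \<le> t0\<close> keeps all its times positive.\<close>
  define U where "U = ball x0 d \<times> ball t0 \<tau>"
  have U: "open U" "bounded U" "U \<subseteq> S_inf" "(x0, t0) \<in> U"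
    using d \<tau> by (auto simp: U_def S_inf_def dist_real_def intro: open_Times bounded_Times)
  let ?w = "\<lambda>x. splice_on U \<phi> u (x, t0)"
  have Ls: "(\<lambda>x. u (x, t0)) \<in> Ls_space s"
    using sub \<tau> by (auto simp: parabolic_subsolution_def)
  have w: "?w \<in> borel_measurable borel" "?w \<in> Ls_space s"
    using parabolic_splice_slice[OF U \<phi>(1) ub Ls] by auto
  have "C2_bounded_at d B ?w x0"
    using \<phi>(2) d \<tau> by (auto simp: C2_bounded_at_def splice_on_def U_def dist_norm)
  then have "frac_const CARD('n) s * (far_part s d (\<lambda>x. u (x, t0)) x0
    - B / 2 * (LINT z|lborel. near_kernel s d (z :: real ^ 'n))) \<le> frac_laplacian s ?w x0"
    by (rule frac_laplacian_splice_ge[OF w s d])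
      (use touch d in \<open>auto simp: splice_on_def U_def dist_norm norm_minus_commute\<close>)
  then have 1: "a x0 * (frac_const CARD('n) s * (far_part s d (\<lambda>x. u (x, t0)) x0
    - B / 2 * (LINT z|lborel. near_kernel s d (z :: real ^ 'n)))) \<le> a x0 * frac_laplacian s ?w x0"
    using a by (intro mult_left_mono) auto
  have "\<forall>z\<in>U. u (x0, t0) - \<phi> (x0, t0) \<ge> u z - \<phi> z"
    using touch by (auto simp: U_def)
  then have "deriv (\<lambda>t. splice_on U \<phi> u (x0, t)) t0 \<le>
          - a x0 * frac_laplacian s ?w x0 + c x0 * u (x0, t0) + f x0"
    using sub U \<phi>(1) touch(1) unfolding parabolic_subsolution_def by blast
  moreover have "deriv (\<lambda>t. splice_on U \<phi> u (x0, t)) t0 = D"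
    using D U by (intro DERIV_imp_deriv) (simp add: parabolic_splice_time_derivative)
  ultimately show ?thesis using 1 by simp
qed

section \<open>Comparison for the elliptic equation\<close>

lemma usc_on_add:
  assumes "usc_on S f" "usc_on S g"
  shows "usc_on S (\<lambda>x. f x + g x)"
  unfolding usc_on_def
proof (intro ballI allI impI)
  fix x r assume x: "x \<in> S" and r: "f x + g x < r"
  define e where "e = (r - f x - g x) / 2"
  have "0 < e" using r by (simp add: e_def)
  then have "\<forall>\<^sub>F y in at x within S. f y < f x + e" "\<forall>\<^sub>F y in at x within S. g y < g x + e"
    using assms x unfolding usc_on_def by simp_all
  then show "\<forall>\<^sub>F y in at x within S. f y + g y < r"
    by eventually_elim (simp add: e_def field_simps)
qed

lemma usc_on_compose:
  assumes "usc_on UNIV f" "continuous_on S h"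
  shows "usc_on S (\<lambda>x. f (h x))"
  unfolding usc_on_def
proof (intro ballI allI impI)
  fix x r assume x: "x \<in> S" and r: "f (h x) < r"
  have "(h \<longlongrightarrow> h x) (at x within S)" using assms(2) x by (simp add: continuous_on_def)
  from topological_tendstoD[OF this usc_on_UNIV_open[OF assms(1)], of r] r
  show "\<forall>\<^sub>F y in at x within S. f (h y) < r" by simp
qed

text \<open>Without a maximum the relatively open sets where \<open>f\<close> is below a value
  \<open>f y\<close> would cover \<open>S\<close>. In a finite subcover, the index with the largest
  value lies in no member of it.\<close>

lemma usc_on_compact_attains_max:
  fixes f :: "'a::metric_space \<Rightarrow> real"
  assumes S: "compact S" "S \<noteq> {}" and f: "usc_on S f"
  shows "\<exists>x\<in>S. \<forall>y\<in>S. f y \<le> f x"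
proof (rule ccontr)
  assume "\<not> ?thesis"
  then have ex: "\<And>x. x \<in> S \<Longrightarrow> \<exists>y\<in>S. f x < f y" by force
  have "openin (top_of_set S) {z \<in> S. f z < f y}" for y
    unfolding openin_euclidean_subtopology_iff
  proof (intro conjI ballI)
    fix x assume x: "x \<in> {z \<in> S. f z < f y}"
    then have "\<forall>\<^sub>F z in at x within S. f z < f y" using f by (auto simp: usc_on_def)
    then obtain d where "0 < d" "\<And>z. z \<in> S \<Longrightarrow> z \<noteq> x \<Longrightarrow> dist z x < d \<Longrightarrow> f z < f y"
      unfolding eventually_at by blast
    then show "\<exists>e>0. \<forall>x'\<in>S. dist x' x < e \<longrightarrow> x' \<in> {z \<in> S. f z < f y}"
      using x by (intro exI[of _ d]) auto
  qed auto
  then have "\<forall>A\<in>(\<lambda>y. {z \<in> S. f z < f y}) ` S. openin (top_of_set S) A" by blast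
  moreover have "S \<subseteq> \<Union> ((\<lambda>y. {z \<in> S. f z < f y}) ` S)" using ex by auto
  ultimately obtain D where D: "D \<subseteq> (\<lambda>y. {z \<in> S. f z < f y}) ` S" "finite D" "S \<subseteq> \<Union> D"
    using S(1)[unfolded compact_eq_openin_cover, rule_format, of "(\<lambda>y. {z \<in> S. f z < f y}) ` S"] by blast
  from finite_subset_image[OF D(2,1)]
  obtain Y where Y: "Y \<subseteq> S" "finite Y" "S \<subseteq> \<Union> ((\<lambda>y. {z \<in> S. f z < f y}) ` Y)"
    using D(3) by blast
  have ne: "Y \<noteq> {}" using Y(3) S(2) by auto
  have "finite (f ` Y)" "f ` Y \<noteq> {}" using Y ne by auto
  from Max_in[OF this] obtain y where y: "y \<in> Y" "f y = Max (f ` Y)" by auto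
  then obtain w where "w \<in> Y" "f y < f w" using Y by blast
  moreover from this have "f w \<le> Max (f ` Y)" using Y(2) by (intro Max_ge) auto
  ultimately show False using y by simp
qed

lemma norm_square_second_difference:
  fixes x y z :: "'a::real_inner"
  shows "(norm (x + z - y))\<^sup>2 + (norm (x - z - y))\<^sup>2 - 2 * (norm (x - y))\<^sup>2 = 2 * (norm z)\<^sup>2"
  by (simp add: power2_norm_eq_inner inner_add_left inner_add_right inner_diff_left inner_diff_right inner_commute)

text \<open>At a maximum point \<open>(x, y)\<close> of the doubled function, maximality along \<open>(x + z, y + z)\<close> makes the
  nonlocal increments of \<open>u\<close> and \<open>v\<close> comparable pointwise, without any regularity of \<open>u\<close> and \<open>v\<close>;
  the contribution of far-away \<open>z\<close> is bounded below independently of the penalty \<open>n\<close>.\<close>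

lemma doubling_inequality:
  fixes u v a c f :: "real ^ 'n \<Rightarrow> real"
  assumes s: "0 < s" "s < 1" and a: "\<And>x. 0 < a x" and c: "\<And>x. c x \<le> 0"
    and u: "elliptic_subsolution s a c f u" and v: "elliptic_supersolution s a c f v"
    and max: "\<And>x' y'. u x' - v y' - n * (norm (x' - y'))\<^sup>2 \<le> u x - v y - n * (norm (x - y))\<^sup>2"
    and m: "m \<le> u x - v y" "0 < m" and n: "0 \<le> n"
    and far: "\<And>z. Q \<le> norm z \<Longrightarrow> u (x + z) - v (y + z) \<le> m / 2" and Q: "0 < Q"
  shows "frac_const CARD('n) s * (m / 2 * (LINT z|lborel. tail_kernel s Q (z :: real ^ 'n)))
    \<le> (f x / a x - f y / a y) + v y * (c x / a x - c y / a y)"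
proof -
  define C where "C = frac_const CARD('n) s"
  have C: "0 < C" unfolding C_def by (rule frac_const_pos[OF s])
  define \<kappa> where "\<kappa> d = (LINT z|lborel. near_kernel s d (z :: real ^ 'n))" for d
  define T where "T = (LINT z|lborel. tail_kernel s Q (z :: real ^ 'n))"
  let ?rhs = "(f x / a x - f y / a y) + v y * (c x / a x - c y / a y)"
  have v': "elliptic_subsolution s a c (\<lambda>x. - f x) (\<lambda>x. - v x)"
    using v elliptic_supersolution_iff[OF s] by blast
  have reg: "u \<in> borel_measurable borel" "u \<in> Ls_space s" "(\<lambda>x. - v x) \<in> borel_measurable borel" "(\<lambda>x. - v x) \<in> Ls_space s"
    using u v' usc_on_UNIV_borel[of u] usc_on_UNIV_borel[of "\<lambda>x. - v x"]
    unfolding elliptic_subsolution_def by blast+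
  \<comment> \<open>The penalty \<open>n\<close> stays fixed while \<open>d\<close> tends to 0, so
    its contribution \<open>2 * n * \<kappa> d\<close> disappears however large \<open>n\<close>
    is.\<close>
  have key: "C * (m / 2 * T) - C * (2 * n * \<kappa> d) \<le> ?rhs" if d: "0 < d" "d < Q" for d
  proof -
    \<comment> \<open>The penalty with \<open>y\<close> frozen, normalised to touch \<open>u\<close>
      at \<open>x\<close>, is the test function. Its second difference is exactly
      \<open>2 * n * (norm z)\<^sup>2\<close>, which is where \<open>B = 2 * n\<close> comes from.
      The second inequality freezes \<open>x\<close> instead.\<close>
    have 1: "a x * (C * (far_part s d u x - (2 * n) / 2 * \<kappa> d)) - c x * u x \<le> f x"
      unfolding C_def \<kappa>_def
    proof (rule elliptic_subsolution_test[OF s u a _ _ d(1)])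
      show "C2_on UNIV (\<lambda>w. n * (norm (w - y))\<^sup>2 + (u x - n * (norm (x - y))\<^sup>2))"
        by (intro C2_on_add C2_on_norm_square C2_on_const)
      show "C2_bounded_at d (2 * n) (\<lambda>w. n * (norm (w - y))\<^sup>2 + (u x - n * (norm (x - y))\<^sup>2)) x"
        unfolding C2_bounded_at_def
      proof (intro allI impI)
        fix z :: "real ^ 'n"
        have "n * (norm (x + z - y))\<^sup>2 + (u x - n * (norm (x - y))\<^sup>2) +
            (n * (norm (x - z - y))\<^sup>2 + (u x - n * (norm (x - y))\<^sup>2)) -
            2 * (n * (norm (x - y))\<^sup>2 + (u x - n * (norm (x - y))\<^sup>2))
          = n * ((norm (x + z - y))\<^sup>2 + (norm (x - z - y))\<^sup>2 - 2 * (norm (x - y))\<^sup>2)"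
          by (simp add: algebra_simps)
        then show "\<bar>n * (norm (x + z - y))\<^sup>2 + (u x - n * (norm (x - y))\<^sup>2) +
            (n * (norm (x - z - y))\<^sup>2 + (u x - n * (norm (x - y))\<^sup>2)) -
            2 * (n * (norm (x - y))\<^sup>2 + (u x - n * (norm (x - y))\<^sup>2))\<bar> \<le> 2 * n * (norm z)\<^sup>2"
          using n by (simp only: norm_square_second_difference) simp
      qed
      show "u w \<le> n * (norm (w - y))\<^sup>2 + (u x - n * (norm (x - y))\<^sup>2)" for w
        using max[of w y] by simp
    qed simp
    have 2: "a y * (C * (far_part s d (\<lambda>x. - v x) y - (2 * n) / 2 * \<kappa> d)) - c y * - v y \<le> - f y"
      unfolding C_def \<kappa>_def
    proof (rule elliptic_subsolution_test[OF s v' a _ _ d(1)])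
      show "C2_on UNIV (\<lambda>w. n * (norm (w - x))\<^sup>2 + (- v y - n * (norm (x - y))\<^sup>2))"
        by (intro C2_on_add C2_on_norm_square C2_on_const)
      show "C2_bounded_at d (2 * n) (\<lambda>w. n * (norm (w - x))\<^sup>2 + (- v y - n * (norm (x - y))\<^sup>2)) y"
        unfolding C2_bounded_at_def
      proof (intro allI impI)
        fix z :: "real ^ 'n"
        have "n * (norm (y + z - x))\<^sup>2 + (- v y - n * (norm (x - y))\<^sup>2) +
            (n * (norm (y - z - x))\<^sup>2 + (- v y - n * (norm (x - y))\<^sup>2)) -
            2 * (n * (norm (y - x))\<^sup>2 + (- v y - n * (norm (x - y))\<^sup>2))
          = n * ((norm (y + z - x))\<^sup>2 + (norm (y - z - x))\<^sup>2 - 2 * (norm (y - x))\<^sup>2)"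
          by (simp add: algebra_simps)
        then show "\<bar>n * (norm (y + z - x))\<^sup>2 + (- v y - n * (norm (x - y))\<^sup>2) +
            (n * (norm (y - z - x))\<^sup>2 + (- v y - n * (norm (x - y))\<^sup>2)) -
            2 * (n * (norm (y - x))\<^sup>2 + (- v y - n * (norm (x - y))\<^sup>2))\<bar> \<le> 2 * n * (norm z)\<^sup>2"
          using n by (simp only: norm_square_second_difference) simp
      qed
      show "- v w \<le> n * (norm (w - x))\<^sup>2 + (- v y - n * (norm (x - y))\<^sup>2)" for w
        using max[of x w] by (simp add: norm_minus_commute)
    qed (simp add: norm_minus_commute)
    have "m / 2 * T = (LINT z|lborel. m / 2 * tail_kernel s Q (z :: real ^ 'n))"
      by (simp add: T_def)
    also have "\<dots> \<le> (LINT z|lborel. (u x - u (x + z)) * tail_kernel s d z + (- v y - - v (y + z)) * tail_kernel s d z)"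
    proof (rule integral_mono)
      show "integrable lborel (\<lambda>z. m / 2 * tail_kernel s Q (z :: real ^ 'n))"
        using integrable_tail_kernel[OF s(1) Q, where ?'n='n] by simp
      show "integrable lborel (\<lambda>z. (u x - u (x + z)) * tail_kernel s d z + (- v y - - v (y + z)) * tail_kernel s d z)"
        by (intro Bochner_Integration.integrable_add integrable_increment_tail reg s d)
      fix z :: "real ^ 'n"
      have *: "(u x - u (x + z)) * tail_kernel s d z + (- v y - - v (y + z)) * tail_kernel s d z
          = (u x - v y - (u (x + z) - v (y + z))) * tail_kernel s d z"
        by (simp add: algebra_simps)
      show "m / 2 * tail_kernel s Q z \<le> (u x - u (x + z)) * tail_kernel s d z + (- v y - - v (y + z)) * tail_kernel s d z"
      proof (cases "Q \<le> norm z")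
        case True
        then have "tail_kernel s d z = tail_kernel s Q z" using d by (simp add: tail_kernel_def)
        then show ?thesis unfolding * using far[OF True] m by (simp only:) (intro mult_right_mono, auto)
      next
        case False
        then have "tail_kernel s Q z = 0" by (simp add: tail_kernel_def)
        moreover have "0 \<le> u x - v y - (u (x + z) - v (y + z))" using max[of "x + z" "y + z"] by simp
        ultimately show ?thesis unfolding * by simp
      qed
    qed
    also have "\<dots> = far_part s d u x + far_part s d (\<lambda>x. - v x) y"
      unfolding far_part_def
      by (intro Bochner_Integration.integral_add integrable_increment_tail reg s d)
    finally have "C * (m / 2 * T) - C * (2 * n * \<kappa> d)
        \<le> C * (far_part s d u x + far_part s d (\<lambda>x. - v x) y) - C * (2 * n * \<kappa> d)"
      using C by simp
    also have "\<dots> = C * (far_part s d u x - (2 * n) / 2 * \<kappa> d) + C * (far_part s d (\<lambda>x. - v x) y - (2 * n) / 2 * \<kappa> d)"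
      by (simp add: algebra_simps)
    also have "\<dots> \<le> (f x + c x * u x) / a x + (- f y - c y * v y) / a y"
    proof (rule add_mono)
      show "C * (far_part s d u x - 2 * n / 2 * \<kappa> d) \<le> (f x + c x * u x) / a x"
        unfolding pos_le_divide_eq[OF a] using 1 by (simp add: mult.commute)
      show "C * (far_part s d (\<lambda>x. - v x) y - 2 * n / 2 * \<kappa> d) \<le> (- f y - c y * v y) / a y"
        unfolding pos_le_divide_eq[OF a] using 2 by (simp add: mult.commute)
    qed
    \<comment> \<open>Since \<open>c x \<le> 0\<close> and \<open>u x\<close> exceeds
      \<open>v y\<close>, replacing \<open>u x\<close> by \<open>v y\<close> in the zeroth-order
      term only increases the right side; what remains is an oscillation of
      \<open>c / a\<close>.\<close>
    also have "\<dots> \<le> ?rhs"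
    proof -
      have "c x / a x * (u x - v y) \<le> 0"
        using c[of x] a[of x] m by (intro mult_nonpos_nonneg divide_nonpos_pos) auto
      then show ?thesis by (simp add: add_divide_distrib diff_divide_distrib algebra_simps)
    qed
    finally show ?thesis .
  qed
  have "((\<lambda>d. C * (m / 2 * T) - C * (2 * n * \<kappa> d)) \<longlongrightarrow> C * (m / 2 * T) - C * (2 * n * 0)) (at_right 0)"
    unfolding \<kappa>_def by (intro tendsto_intros near_kernel_integral_tendsto_0 s)
  moreover have "\<forall>\<^sub>F d in at_right 0. C * (m / 2 * T) - C * (2 * n * \<kappa> d) \<le> ?rhs"
    using eventually_at_right_real[OF Q] by eventually_elim (use key in auto)
  ultimately have "C * (m / 2 * T) - C * (2 * n * 0) \<le> ?rhs"
    by (intro tendsto_upperbound) auto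
  then show ?thesis by (simp add: C_def T_def)
qed

text \<open>At a doubled maximum the far field gives a lower bound \<open>e > 0\<close> that depends
  on \<open>m\<close> and \<open>R\<close> but not on the penalty. Choosing the penalty so large
  that the two points lie within the matching modulus of continuity makes the upper bound smaller
  than \<open>e / 2\<close>.\<close>

lemma elliptic_comparison:
  fixes u v a c f :: "real ^ 'n \<Rightarrow> real"
  assumes s: "0 < s" "s < 1" and a: "\<And>x. 0 < a x" and c: "\<And>x. c x \<le> 0"
    and cont: "continuous_on UNIV a" "continuous_on UNIV c" "continuous_on UNIV f"
    and u: "elliptic_subsolution s a c f u" and v: "elliptic_supersolution s a c f v"
    and M: "\<And>x. \<bar>u x\<bar> \<le> M" "\<And>x. \<bar>v x\<bar> \<le> M"
    and lim: "(u \<longlongrightarrow> \<gamma>) at_infinity" "(v \<longlongrightarrow> \<gamma>) at_infinity"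
  shows "u p \<le> v p"
proof (rule ccontr)
  assume "\<not> u p \<le> v p"
  define m where "m = u p - v p"
  have m: "0 < m" using \<open>\<not> u p \<le> v p\<close> by (simp add: m_def)
  have M0: "0 \<le> M" using M(1)[of p] by linarith
  have "\<forall>\<^sub>F x in at_infinity. u x < \<gamma> + m / 4" "\<forall>\<^sub>F x in at_infinity. \<gamma> - m / 4 < v x"
    using lim m by (auto intro: order_tendstoD)
  then have "\<forall>\<^sub>F x in at_infinity. u x < \<gamma> + m / 4 \<and> \<gamma> - m / 4 < v x"
    by (rule eventually_conj)
  then obtain R0 where R0: "\<And>x. R0 \<le> norm x \<Longrightarrow> u x < \<gamma> + m / 4 \<and> \<gamma> - m / 4 < v x"
    unfolding eventually_at_infinity by blast
  define R where "R = max 0 (max R0 (norm p))"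
  have R: "u x - v y \<le> m / 2" if "R \<le> norm x" "R \<le> norm y" for x y
    using R0[of x] R0[of y] that by (simp add: R_def field_simps)
  have R': "0 \<le> R" "norm p \<le> R" by (simp_all add: R_def)
  \<comment> \<open>The margin 1 is for pairs outside \<open>K \<times> K\<close>: if their points
    are less than 1 apart, both have norm at least \<open>R\<close>, where the difference is at most
    \<open>m / 2\<close>.\<close>
  define K where "K = cball (0 :: real ^ 'n) (R + 1)"
  \<comment> \<open>Points of \<open>K\<close> have norm at most \<open>R + 1\<close>, so a shift of
    length at least \<open>2 * R + 1\<close> moves them to norm at least \<open>R\<close>.\<close>
  define T where "T = (LINT z|lborel. tail_kernel s (2 * R + 1) (z :: real ^ 'n))"
  define e where "e = frac_const CARD('n) s * (m / 2 * T)"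
  have e: "0 < e"
    using frac_const_pos[OF s, of "CARD('n)"] tail_kernel_integral_pos[OF s(1), of "2 * R + 1", where ?'n='n] m R'
    by (simp add: e_def T_def)
  have a0: "a x \<noteq> 0" for x using a[of x] by simp
  have uc: "uniformly_continuous_on K (\<lambda>x. f x / a x)" "uniformly_continuous_on K (\<lambda>x. c x / a x)"
    using cont a0 unfolding K_def
    by (auto intro!: compact_uniformly_continuous continuous_on_divide intro: continuous_on_subset)
  \<comment> \<open>The oscillations of \<open>f / a\<close> and \<open>c / a\<close> enter with
    weights 1 and at most \<open>M\<close>, so together they stay below
    \<open>e' * (1 + M) = e / 2\<close>.\<close>
  define e' where "e' = e / (2 * (1 + M))"
  have e': "0 < e'" using e M0 by (simp add: e'_def)
  obtain d1 where d1: "0 < d1" "\<And>x y. x \<in> K \<Longrightarrow> y \<in> K \<Longrightarrow> dist x y < d1 \<Longrightarrow> \<bar>f x / a x - f y / a y\<bar> < e'"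
    using uc(1) e' unfolding uniformly_continuous_on_def dist_real_def by metis
  obtain d2 where d2: "0 < d2" "\<And>x y. x \<in> K \<Longrightarrow> y \<in> K \<Longrightarrow> dist x y < d2 \<Longrightarrow> \<bar>c x / a x - c y / a y\<bar> < e'"
    using uc(2) e' unfolding uniformly_continuous_on_def dist_real_def by metis
  define d where "d = min d1 d2"
  have d: "0 < d" using d1 d2 by (simp add: d_def)
  \<comment> \<open>The first entry makes the penalty beat the oscillation \<open>2 * M\<close> for
    pairs at distance at least 1; the second forces a maximising pair, whose penalty is at most
    \<open>2 * M\<close>, to be closer than \<open>d\<close>.\<close>
  define n where "n = max (2 * M + 1) ((2 * M + 1) / d\<^sup>2)"
  have n: "2 * M + 1 \<le> n" "(2 * M + 1) / d\<^sup>2 \<le> n" "0 \<le> n" using M0 by (auto simp: n_def)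
  define \<Phi> where "\<Phi> = (\<lambda>q. u (fst q) - v (snd q) - n * (norm (fst q - snd q))\<^sup>2)"
  have "usc_on (K \<times> K) (\<lambda>q. u (fst q) + ((\<lambda>x. - v x) (snd q) + - n * (norm (fst q - snd q))\<^sup>2))"
  proof (intro usc_on_add)
    show "usc_on (K \<times> K) (\<lambda>q. u (fst q))"
      by (rule usc_on_compose) (use u in \<open>auto simp: elliptic_subsolution_def intro!: continuous_intros\<close>)
    show "usc_on (K \<times> K) (\<lambda>q. (\<lambda>x. - v x) (snd q))"
      by (rule usc_on_compose) (use v in \<open>auto simp: elliptic_supersolution_def usc_on_uminus_iff intro!: continuous_intros\<close>)
    show "usc_on (K \<times> K) (\<lambda>q. - n * (norm (fst q - snd q))\<^sup>2)"
      by (rule continuous_on_imp_usc_lsc) (intro continuous_intros)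
  qed
  then have "usc_on (K \<times> K) \<Phi>" by (simp add: \<Phi>_def add_diff_eq)
  moreover have "compact (K \<times> K)" "(p, p) \<in> K \<times> K" using R' by (auto simp: K_def intro!: compact_Times)
  ultimately have "\<exists>q\<in>K \<times> K. \<forall>q'\<in>K \<times> K. \<Phi> q' \<le> \<Phi> q"
    by (intro usc_on_compact_attains_max) auto
  then obtain x y where xy: "x \<in> K" "y \<in> K" and max: "\<And>q. q \<in> K \<times> K \<Longrightarrow> \<Phi> q \<le> \<Phi> (x, y)"
    by blast
  have ge_m: "m \<le> \<Phi> (x, y)"
    using max[of "(p, p)"] \<open>(p, p) \<in> K \<times> K\<close> by (simp add: \<Phi>_def m_def)
  \<comment> \<open>The maximum over the compact set has to be global, because the nonlocal term
    compares it with all common translates of the pair.\<close>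
  have gmax: "\<Phi> (x', y') \<le> \<Phi> (x, y)" for x' y'
  proof (cases "(x', y') \<in> K \<times> K")
    case False
    show ?thesis
    proof (cases "1 \<le> norm (x' - y')")
      case True
      then have "1 \<le> (norm (x' - y'))\<^sup>2" by (simp add: one_le_power)
      then have "n * 1 \<le> n * (norm (x' - y'))\<^sup>2" using n by (intro mult_left_mono) auto
      then have "\<Phi> (x', y') \<le> 2 * M - n" using M(1)[of x'] M(2)[of y'] by (simp add: \<Phi>_def)
      then show ?thesis using n ge_m m by linarith
    next
      case False
      then have "R \<le> norm x'" "R \<le> norm y'"
        using \<open>(x', y') \<notin> K \<times> K\<close> norm_triangle_ineq2[of x' y'] norm_triangle_ineq2[of y' x']
        by (auto simp: K_def norm_minus_commute)
      then have "u x' - v y' \<le> m / 2" by (rule R)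
      moreover have "0 \<le> n * (norm (x' - y'))\<^sup>2" using n by simp
      ultimately show ?thesis using ge_m m by (simp add: \<Phi>_def)
    qed
  qed (rule max)
  have pen: "0 \<le> n * (norm (x - y))\<^sup>2" using n by simp
  have "frac_const CARD('n) s * (m / 2 * (LINT z|lborel. tail_kernel s (2 * R + 1) (z :: real ^ 'n)))
    \<le> (f x / a x - f y / a y) + v y * (c x / a x - c y / a y)"
  proof (rule doubling_inequality[OF s a c u v])
    show "u x' - v y' - n * (norm (x' - y'))\<^sup>2 \<le> u x - v y - n * (norm (x - y))\<^sup>2" for x' y'
      using gmax[of x' y'] by (simp add: \<Phi>_def)
    show "m \<le> u x - v y" using ge_m pen by (simp add: \<Phi>_def)
    show "u (x + z) - v (y + z) \<le> m / 2" if "2 * R + 1 \<le> norm z" for z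
    proof (rule R)
      show "R \<le> norm (x + z)" "R \<le> norm (y + z)"
        using that xy norm_triangle_ineq2[of z "- x"] norm_triangle_ineq2[of z "- y"]
        by (auto simp: K_def add.commute)
    qed
  qed (use m n R' in auto)
  then have le: "e \<le> (f x / a x - f y / a y) + v y * (c x / a x - c y / a y)"
    by (simp add: e_def T_def)
  have "n * (norm (x - y))\<^sup>2 \<le> 2 * M"
    using ge_m m M(1)[of x] M(2)[of y] by (simp add: \<Phi>_def)
  moreover have "(2 * M + 1) / d\<^sup>2 * (norm (x - y))\<^sup>2 \<le> n * (norm (x - y))\<^sup>2"
    using n by (intro mult_right_mono) auto
  ultimately have "(2 * M + 1) / d\<^sup>2 * (norm (x - y))\<^sup>2 \<le> 2 * M" by linarith
  moreover have "0 < d\<^sup>2" using d by simp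
  ultimately have "(2 * M + 1) * (norm (x - y))\<^sup>2 \<le> 2 * M * d\<^sup>2"
    by (simp only: times_divide_eq_left pos_divide_le_eq)
  also have "\<dots> < (2 * M + 1) * d\<^sup>2" using d by (simp add: algebra_simps)
  finally have "(norm (x - y))\<^sup>2 < d\<^sup>2" using M0 by simp
  then have "dist x y < d" using d by (simp add: dist_norm power2_less_imp_less)
  then have "\<bar>f x / a x - f y / a y\<bar> < e'" "\<bar>c x / a x - c y / a y\<bar> < e'"
    using d1(2) d2(2) xy by (auto simp: d_def)
  moreover from this have "\<bar>v y\<bar> * \<bar>c x / a x - c y / a y\<bar> \<le> M * e'"
    using M(2)[of y] M0 by (intro mult_mono) linarith+
  moreover have "v y * (c x / a x - c y / a y) \<le> \<bar>v y\<bar> * \<bar>c x / a x - c y / a y\<bar>"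
    using abs_ge_self[of "v y * (c x / a x - c y / a y)"] by (simp only: abs_mult)
  ultimately have "e < e' + M * e'" using le by linarith
  also have "\<dots> = e' * (2 * (1 + M)) / 2" by (simp add: algebra_simps)
  also have "\<dots> = e / 2" using M0 by (simp add: e'_def)
  finally show False using e by simp
qed

section \<open>Boundedness in time\<close>

lemma C2_on_fst:
  fixes \<phi> :: "'a::real_normed_vector \<Rightarrow> real"
  assumes "C2_on UNIV \<phi>"
  shows "C2_on S (\<lambda>z :: 'a \<times> 'b::real_normed_vector. \<phi> (fst z))"
  using C2_on_compose_linear[OF assms, of S "Blinfun fst"]
  by (simp add: bounded_linear_Blinfun_apply[OF bounded_linear_fst])

lemma C2_on_snd:
  fixes \<phi> :: "'b::real_normed_vector \<Rightarrow> real"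
  assumes "C2_on UNIV \<phi>"
  shows "C2_on S (\<lambda>z :: 'a::real_normed_vector \<times> 'b. \<phi> (snd z))"
  using C2_on_compose_linear[OF assms, of S "Blinfun snd"]
  by (simp add: bounded_linear_Blinfun_apply[OF bounded_linear_snd])

lemma C2_on_time_square:
  "C2_on S (\<lambda>z :: 'a::real_normed_vector \<times> real. q * (snd z - b)\<^sup>2)"
  using C2_on_snd[OF C2_on_norm_square, of S q b] by simp

lemma continuous_time_slice_borel:
  fixes u :: "(real ^ 'n) \<times> real \<Rightarrow> real"
  assumes "continuous_on S_inf_closed u" "0 \<le> t"
  shows "(\<lambda>x. u (x, t)) \<in> borel_measurable borel"
  by (rule borel_measurable_continuous_onI, rule continuous_on_compose2[OF assms(1)])
    (use assms(2) in \<open>auto simp: S_inf_closed_def intro!: continuous_intros\<close>)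

lemma continuous_on_compact_bound:
  fixes f :: "'a::topological_space \<Rightarrow> real"
  assumes "compact K" "continuous_on K f"
  shows "\<exists>b\<ge>0. \<forall>x\<in>K. \<bar>f x\<bar> \<le> b"
proof -
  have "bounded (f ` K)" using assms by (intro compact_imp_bounded compact_continuous_image)
  then obtain b where "\<forall>x\<in>K. \<bar>f x\<bar> \<le> b" "0 < b" unfolding bounded_pos by auto
  then show ?thesis by (intro exI[of _ b]) auto
qed

text \<open>If \<open>u\<close> reaches a high level \<open>\<Lambda>\<close>, touch it at the first such time with a function of \<open>t\<close> alone: the
  values below \<open>G\<close> outside a ball make the nonlocal term at least of order \<open>\<Lambda> - G\<close>.\<close>

lemma parabolic_subsolution_bounded_above:
  fixes u :: "(real ^ 'n) \<times> real \<Rightarrow> real" and a c f :: "real ^ 'n \<Rightarrow> real"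
  assumes s: "0 < s" "s < 1" and a: "\<And>x. 0 < a x" and c: "\<And>x. c x \<le> 0"
    and cont: "continuous_on UNIV a" "continuous_on UNIV f"
    and sub: "parabolic_subsolution s a c f u" and u: "continuous_on S_inf_closed u"
    and out: "\<And>x t. R \<le> norm x \<Longrightarrow> 0 \<le> t \<Longrightarrow> u (x, t) \<le> G" and R: "0 \<le> R"
  shows "\<exists>\<Lambda>. \<forall>x t. 0 \<le> t \<longrightarrow> u (x, t) \<le> \<Lambda>"
proof -
  define K where "K = cball (0 :: real ^ 'n) R"
  have K: "compact K" "K \<noteq> {}" using R by (auto simp: K_def)
  have sub_closed: "K \<times> {0..t} \<subseteq> S_inf_closed" for t by (auto simp: S_inf_closed_def)
  obtain F where F: "0 \<le> F" "\<And>x. x \<in> K \<Longrightarrow> \<bar>f x\<bar> \<le> F"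
    using continuous_on_compact_bound[OF K(1) continuous_on_subset[OF cont(2)]] by auto
  obtain xa where xa: "xa \<in> K" "\<And>x. x \<in> K \<Longrightarrow> a xa \<le> a x"
    using continuous_attains_inf[OF K continuous_on_subset[OF cont(1)]] by auto
  obtain G0 where G0: "0 \<le> G0" "\<And>q. q \<in> K \<times> {0..0} \<Longrightarrow> \<bar>u q\<bar> \<le> G0"
    using continuous_on_compact_bound[of "K \<times> {0..0}", OF _ continuous_on_subset[OF u sub_closed]] K
    by (metis compact_Icc compact_Times)
  define C where "C = frac_const CARD('n) s"
  \<comment> \<open>From a point of \<open>K\<close>, a shift of length at least
    \<open>2 * R + 1\<close> leads to where \<open>u \<le> G\<close>; the radius is also at least 1,
    the radius on which the test function is used below.\<close>
  define T where "T = (LINT z|lborel. tail_kernel s (2 * R + 1) (z :: real ^ 'n))"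
  have CT: "0 < C" "0 < T"
    using frac_const_pos[OF s, of "CARD('n)"] tail_kernel_integral_pos[OF s(1), of "2 * R + 1", where ?'n='n] R
    by (simp_all add: C_def T_def)
  \<comment> \<open>Exceeding \<open>G\<close> confines the level to \<open>K\<close>, exceeding
    \<open>G0\<close> keeps it away from time 0, and the last summand makes the nonlocal term too
    large to be balanced by \<open>F\<close>.\<close>
  define \<Lambda> where "\<Lambda> = max \<bar>G\<bar> G0 + 1 + F / (a xa * C * T)"
  have "0 \<le> F / (a xa * C * T)" using F CT a[of xa] by simp
  then have \<Lambda>: "G < \<Lambda>" "G0 < \<Lambda>" "0 < \<Lambda>" "F / (a xa * C * T) < \<Lambda> - G"
    by (auto simp: \<Lambda>_def)
  have "u (p, t') \<le> \<Lambda>" if t': "0 \<le> t'" for p t'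
  proof (rule ccontr)
    assume "\<not> u (p, t') \<le> \<Lambda>"
    then have up: "\<Lambda> < u (p, t')" by simp
    have pK: "x \<in> K" if "\<Lambda> \<le> u (x, t)" "0 \<le> t" for x t
      using out[of x t] that \<Lambda> by (force simp: K_def)
    define Q where "Q = {q \<in> K \<times> {0..t'}. \<Lambda> \<le> u q}"
    have "compact (K \<times> {0..t'})" using K by (intro compact_Times) auto
    moreover have "Q = (K \<times> {0..t'}) \<inter> ((K \<times> {0..t'}) \<inter> u -` {\<Lambda>..})" by (auto simp: Q_def)
    moreover have "closed ((K \<times> {0..t'}) \<inter> u -` {\<Lambda>..})"
      using compact_imp_closed[OF calculation(1)]
      by (intro continuous_closed_preimage continuous_on_subset[OF u sub_closed] closed_atLeast)
    ultimately have "compact Q" using compact_Int_closed by metis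
    have "(p, t') \<in> Q" using up pK[of p t'] t' by (simp add: Q_def)
    then have "Q \<noteq> {}" by blast
    moreover have "continuous_on Q snd" by (intro continuous_intros)
    ultimately have "\<exists>q\<in>Q. \<forall>q'\<in>Q. snd q \<le> snd q'"
      using \<open>compact Q\<close> by (intro continuous_attains_inf)
    then obtain x1 t1 where q1: "(x1, t1) \<in> Q" "\<And>x t. (x, t) \<in> Q \<Longrightarrow> t1 \<le> t"
      by fastforce
    have t1: "0 < t1"
    proof (rule ccontr)
      assume "\<not> 0 < t1"
      then have "(x1, t1) \<in> K \<times> {0..0}" using q1 by (auto simp: Q_def)
      then have "u (x1, t1) \<le> G0" using G0(2) by fastforce
      then show False using q1(1) \<Lambda> by (simp add: Q_def)
    qed
    have first: "t1 \<le> t" if "\<Lambda> \<le> u (x, t)" "0 \<le> t" for x t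
    proof (rule ccontr)
      assume "\<not> t1 \<le> t"
      then have "(x, t) \<in> Q" using that pK[OF that] q1(1) by (auto simp: Q_def)
      then show False using q1(2) \<open>\<not> t1 \<le> t\<close> by blast
    qed
    have comp: "compact (K \<times> {0..t1 + 1})" using K by (intro compact_Times) auto
    obtain k where k: "0 \<le> k" "\<And>q. q \<in> K \<times> {0..t1 + 1} \<Longrightarrow> \<bar>u q\<bar> \<le> k"
      using continuous_on_compact_bound[OF comp continuous_on_subset[OF u sub_closed]] by auto
    \<comment> \<open>As \<open>k\<close> bounds \<open>u\<close> on the compact cylinder, the
      penalty, equal to \<open>k\<close> at time \<open>t1 + 1\<close>, makes \<open>\<Psi>\<close>
      nonpositive there. The maximum therefore avoids the final time and a two-sided neighbourhood
      in time is available.\<close>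
    define \<Psi> where "\<Psi> = (\<lambda>q. u q - k * (snd q - t1)\<^sup>2)"
    have "continuous_on (K \<times> {0..t1 + 1}) \<Psi>"
      unfolding \<Psi>_def by (intro continuous_intros continuous_on_subset[OF u sub_closed])
    moreover have q1': "(x1, t1) \<in> K \<times> {0..t1 + 1}" using q1(1) by (auto simp: Q_def)
    ultimately obtain x0 t0 where q0: "(x0, t0) \<in> K \<times> {0..t1 + 1}"
      and max: "\<And>q. q \<in> K \<times> {0..t1 + 1} \<Longrightarrow> \<Psi> q \<le> \<Psi> (x0, t0)"
      using continuous_attains_sup[OF comp, of \<Psi>] by (metis SigmaE empty_iff)
    have "\<Lambda> \<le> \<Psi> (x1, t1)" using q1(1) by (simp add: \<Psi>_def Q_def)
    then have ge: "\<Lambda> \<le> \<Psi> (x0, t0)" using max[OF q1'] by linarith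
    moreover have pen: "0 \<le> k * (t0 - t1)\<^sup>2" using k by simp
    ultimately have u0: "\<Lambda> \<le> u (x0, t0)" by (simp add: \<Psi>_def)
    \<comment> \<open>The level is not reached before \<open>t1\<close>, so the maximum is not
      earlier than \<open>t1\<close> and the time derivative \<open>2 * k * (t0 - t1)\<close> of the
      penalty has the favourable sign.\<close>
    then have t01: "t1 \<le> t0" using first q0 by auto
    have t02: "t0 < t1 + 1"
    proof (rule ccontr)
      assume "\<not> t0 < t1 + 1"
      then have "t0 = t1 + 1" using q0 by auto
      then have "\<Psi> (x0, t0) \<le> 0" using k(2)[OF q0] by (simp add: \<Psi>_def)
      then show False using ge \<Lambda> by linarith
    qed
    have gmax: "\<Psi> (x, t) \<le> \<Psi> (x0, t0)" if "0 \<le> t" "t \<le> t1 + 1" for x t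
    proof (cases "x \<in> K")
      case False
      then have "u (x, t) \<le> G" using out[of x t] that by (auto simp: K_def)
      moreover have "0 \<le> k * (t - t1)\<^sup>2" using k by simp
      ultimately show ?thesis using ge \<Lambda> by (simp add: \<Psi>_def)
    qed (use max that in auto)
    have x0: "x0 \<in> K" using q0 by simp
    have t0: "0 < t0" using t01 t1 by linarith
    have slice: "(\<lambda>x. u (x, t0)) \<in> borel_measurable borel" "(\<lambda>x. u (x, t0)) \<in> Ls_space s"
      using continuous_time_slice_borel[OF u, of t0] sub t0 by (auto simp: parabolic_subsolution_def)
    let ?\<phi> = "\<lambda>z. k * (snd z - t1)\<^sup>2 + (u (x0, t0) - k * (t0 - t1)\<^sup>2)"
    \<comment> \<open>The test function is constant in \<open>x\<close>, hence \<open>B = 0\<close>: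
      the near part costs nothing and radius 1 can be kept without a limit.\<close>
    have "2 * k * (t0 - t1) + a x0 * (frac_const CARD('n) s * (far_part s 1 (\<lambda>x. u (x, t0)) x0
      - 0 / 2 * (LINT z|lborel. near_kernel s 1 (z :: real ^ 'n)))) - c x0 * u (x0, t0) \<le> f x0"
    proof (rule parabolic_subsolution_test[OF s sub a slice(1)])
      show "C2_on S_inf ?\<phi>"
        by (intro C2_on_add C2_on_time_square C2_on_const)
      show "C2_bounded_at 1 0 (\<lambda>x. ?\<phi> (x, t0)) x0"
        by (simp add: C2_bounded_at_def)
      show "((\<lambda>t. ?\<phi> (x0, t)) has_real_derivative 2 * k * (t0 - t1)) (at t0)"
        by (auto intro!: derivative_eq_intros simp: power2_eq_square algebra_simps)
      show "0 < min t0 (t1 + 1 - t0)" using t0 t02 by simp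
      show "u (x, t) \<le> ?\<phi> (x, t)" if "t \<in> ball t0 (min t0 (t1 + 1 - t0))" for x t
        using gmax[of t x] that by (auto simp: \<Psi>_def dist_real_def abs_less_iff)
    qed auto
    moreover have "0 \<le> 2 * k * (t0 - t1)" using k t01 by simp
    moreover have "c x0 * u (x0, t0) \<le> 0" using c[of x0] u0 \<Lambda> by (intro mult_nonpos_nonneg) auto
    ultimately have le: "a x0 * (C * far_part s 1 (\<lambda>x. u (x, t0)) x0) \<le> F"
      using F(2)[OF x0] by (simp add: C_def)
    have "(\<Lambda> - G) * T = (LINT z|lborel. (\<Lambda> - G) * tail_kernel s (2 * R + 1) (z :: real ^ 'n))"
      by (simp add: T_def)
    also have "\<dots> \<le> far_part s 1 (\<lambda>x. u (x, t0)) x0"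
      unfolding far_part_def
    proof (rule integral_mono)
      show "integrable lborel (\<lambda>z. (\<Lambda> - G) * tail_kernel s (2 * R + 1) (z :: real ^ 'n))"
        using integrable_tail_kernel[OF s(1), of "2 * R + 1", where ?'n='n] R by simp
      show "integrable lborel (\<lambda>z. (u (x0, t0) - u (x0 + z, t0)) * tail_kernel s 1 z)"
        using integrable_increment_tail[OF slice s(1), of 1] by simp
      fix z :: "real ^ 'n"
      show "(\<Lambda> - G) * tail_kernel s (2 * R + 1) z \<le> (u (x0, t0) - u (x0 + z, t0)) * tail_kernel s 1 z"
      proof (cases "2 * R + 1 \<le> norm z")
        case True
        then have "tail_kernel s 1 z = tail_kernel s (2 * R + 1) z" using R by (simp add: tail_kernel_def)
        moreover have "R \<le> norm (x0 + z)"
          using True x0 norm_triangle_ineq2[of z "- x0"] by (auto simp: K_def add.commute)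
        ultimately show ?thesis
          using out[of "x0 + z" t0] u0 t0 by (simp only:) (intro mult_right_mono, auto)
      next
        case False
        then have "tail_kernel s (2 * R + 1) z = 0" by (simp add: tail_kernel_def)
        moreover have "0 \<le> u (x0, t0) - u (x0 + z, t0)"
          using gmax[of t0 "x0 + z"] t0 t02 by (simp add: \<Psi>_def)
        ultimately show ?thesis by simp
      qed
    qed
    finally have far: "(\<Lambda> - G) * T \<le> far_part s 1 (\<lambda>x. u (x, t0)) x0" .
    have "a xa * (C * ((\<Lambda> - G) * T)) \<le> a x0 * (C * far_part s 1 (\<lambda>x. u (x, t0)) x0)"
      using far xa(2)[OF x0] a[of xa] CT \<Lambda> by (intro mult_mono mult_left_mono) auto
    then have "(\<Lambda> - G) * (a xa * C * T) \<le> F" using le by (simp add: ac_simps)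
    then have "\<Lambda> - G \<le> F / (a xa * C * T)" using a[of xa] CT by (simp add: pos_le_divide_eq)
    then show False using \<Lambda> by linarith
  qed
  then show ?thesis by blast
qed

section \<open>Upper relaxed limits for large time\<close>

text \<open>The upper half-relaxed limit as an infimum of eventual upper bounds. One parameter
  \<open>r\<close> governs both the spatial radius and, through \<open>1 / r\<close>, the time
  threshold, so a single shrinking parameter describes the limit. The bound \<open>M\<close> fixed
  below keeps the infimum real and meaningful.\<close>

definition late_limsup :: "('a::metric_space \<times> real \<Rightarrow> real) \<Rightarrow> 'a \<Rightarrow> real" where
  "late_limsup u x = Inf {q. \<exists>r>0. \<forall>y t. dist y x < r \<longrightarrow> 1 / r < t \<longrightarrow> u (y, t) \<le> q}"

context
  fixes u :: "'a::metric_space \<times> real \<Rightarrow> real" and M :: real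
  assumes M: "\<And>x t. 0 \<le> t \<Longrightarrow> \<bar>u (x, t)\<bar> \<le> M"
begin

lemma late_limsup_ge:
  assumes "\<And>q r. 0 < r \<Longrightarrow> (\<And>y t. dist y x < r \<Longrightarrow> 1 / r < t \<Longrightarrow> u (y, t) \<le> q) \<Longrightarrow> b \<le> q"
  shows "b \<le> late_limsup u x"
  unfolding late_limsup_def
proof (rule cInf_greatest)
  have "u (y, t) \<le> M" if "1 / 1 < t" for y t using M[of t y] that by simp
  then have "M \<in> {q. \<exists>r>0. \<forall>y t. dist y x < r \<longrightarrow> 1 / r < t \<longrightarrow> u (y, t) \<le> q}"
    using zero_less_one by blast
  then show "{q. \<exists>r>0. \<forall>y t. dist y x < r \<longrightarrow> 1 / r < t \<longrightarrow> u (y, t) \<le> q} \<noteq> {}"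
    by blast
qed (use assms in blast)

lemma late_limsup_le:
  assumes "0 < r" "\<And>y t. dist y x < r \<Longrightarrow> 1 / r < t \<Longrightarrow> u (y, t) \<le> q"
  shows "late_limsup u x \<le> q"
  unfolding late_limsup_def
proof (rule cInf_lower)
  show "bdd_below {q. \<exists>r>0. \<forall>y t. dist y x < r \<longrightarrow> 1 / r < t \<longrightarrow> u (y, t) \<le> q}"
  proof (rule bdd_belowI[of _ "- M"], safe)
    fix q r :: real assume r: "0 < r" "\<forall>y t. dist y x < r \<longrightarrow> 1 / r < t \<longrightarrow> u (y, t) \<le> q"
    then have "u (x, 1 / r + 1) \<le> q" by simp
    moreover have "\<bar>u (x, 1 / r + 1)\<bar> \<le> M" using r by (intro M) auto
    ultimately show "- M \<le> q" by linarith
  qed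
qed (use assms in blast)

lemma late_limsup_less:
  assumes "late_limsup u x < q"
  shows "\<exists>r>0. \<forall>y t. dist y x < r \<longrightarrow> 1 / r < t \<longrightarrow> u (y, t) < q"
proof (rule ccontr)
  assume no: "\<not> ?thesis"
  have "q \<le> late_limsup u x"
  proof (rule late_limsup_ge)
    fix q' r :: real assume r: "0 < r" "\<And>y t. dist y x < r \<Longrightarrow> 1 / r < t \<Longrightarrow> u (y, t) \<le> q'"
    have "\<not> (\<forall>y t. dist y x < r \<longrightarrow> 1 / r < t \<longrightarrow> u (y, t) < q)" using no r(1) by blast
    then obtain y t where "dist y x < r" "1 / r < t" "q \<le> u (y, t)" by (meson not_le)
    then show "q \<le> q'" using r(2)[of y t] by linarith
  qed
  then show False using assms by linarith
qed

lemma abs_late_limsup_le: "\<bar>late_limsup u x\<bar> \<le> M"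
proof -
  have "late_limsup u x \<le> M"
  proof (rule late_limsup_le[of 1])
    show "u (y, t) \<le> M" if "1 / 1 < t" for y t using M[of t y] that by simp
  qed simp
  moreover have "- M \<le> late_limsup u x"
  proof (rule late_limsup_ge)
    fix q r :: real assume r: "0 < r" "\<And>y t. dist y x < r \<Longrightarrow> 1 / r < t \<Longrightarrow> u (y, t) \<le> q"
    then have "u (x, 1 / r + 1) \<le> q" by simp
    moreover have "\<bar>u (x, 1 / r + 1)\<bar> \<le> M" using r by (intro M) auto
    ultimately show "- M \<le> q" by linarith
  qed
  ultimately show ?thesis by linarith
qed

lemma usc_on_late_limsup: "usc_on UNIV (late_limsup u)"
  unfolding usc_on_def
proof (intro ballI allI impI)
  fix x r assume "late_limsup u x < r"
  then obtain q where q: "late_limsup u x < q" "q < r" using dense by blast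
  then obtain d where d: "0 < d" "\<And>y t. dist y x < d \<Longrightarrow> 1 / d < t \<Longrightarrow> u (y, t) < q"
    using late_limsup_less by blast
  have "late_limsup u y < r" if "dist y x < d / 2" for y
  proof -
    have "late_limsup u y \<le> q"
    proof (rule late_limsup_le[of "d / 2"])
      fix w t assume "dist w y < d / 2" "1 / (d / 2) < t"
      moreover have "1 / d \<le> 1 / (d / 2)" using d(1) by (intro divide_left_mono) auto
      ultimately have "dist w x < d" "1 / d < t"
        using that dist_triangle[of w x y] by linarith+
      then have "u (w, t) < q" by (rule d(2))
      then show "u (w, t) \<le> q" by simp
    qed (use d in simp)
    then show ?thesis using q by linarith
  qed
  then show "\<forall>\<^sub>F y in at x within UNIV. late_limsup u y < r"
    unfolding eventually_at using d(1) by (intro exI[of _ "d / 2"]) auto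
qed

lemma late_limsup_eventually:
  assumes "late_limsup u x < q" "(X \<longlongrightarrow> x) F" "filterlim T at_top F"
  shows "\<forall>\<^sub>F n in F. u (X n, T n) < q"
proof -
  obtain r where r: "0 < r" "\<And>y t. dist y x < r \<Longrightarrow> 1 / r < t \<Longrightarrow> u (y, t) < q"
    using late_limsup_less[OF assms(1)] by blast
  have "\<forall>\<^sub>F n in F. dist (X n) x < r" using assms(2) r(1) by (rule tendstoD)
  moreover have "\<forall>\<^sub>F n in F. 1 / r < T n" using assms(3) unfolding filterlim_at_top_dense by blast
  ultimately show ?thesis by eventually_elim (rule r(2))
qed

text \<open>A violating sequence of points with times tending to infinity would accumulate at some
  \<open>l\<close> in \<open>K\<close>. Because the relaxed limit lets the space point move as well,
  its value at \<open>l\<close> controls the whole subsequence, a contradiction.\<close>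

lemma late_limsup_uniform_upper:
  assumes K: "compact K" and \<phi>: "continuous_on K \<phi>" and le: "\<And>x. x \<in> K \<Longrightarrow> late_limsup u x \<le> \<phi> x"
    and e: "0 < e"
  shows "\<exists>T. \<forall>x\<in>K. \<forall>t>T. u (x, t) \<le> \<phi> x + e"
proof (rule ccontr)
  assume "\<not> ?thesis"
  then have "\<forall>n::nat. \<exists>x t. x \<in> K \<and> real n < t \<and> \<phi> x + e < u (x, t)"
    by (meson not_le)
  then obtain X T where X: "\<And>n. X n \<in> K" "\<And>n. real n < T n" "\<And>n. \<phi> (X n) + e < u (X n, T n)"
    by metis
  obtain l \<sigma> where l: "l \<in> K" "strict_mono \<sigma>" "(X \<circ> \<sigma>) \<longlonglongrightarrow> l"
    using K X(1) unfolding compact_def by blast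
  have "filterlim T at_top sequentially"
    by (rule filterlim_at_top_mono[OF filterlim_real_sequentially]) (simp add: X(2) less_imp_le)
  then have T: "filterlim (T \<circ> \<sigma>) at_top sequentially"
    using filterlim_compose[OF _ filterlim_subseq[OF l(2)]] by (simp add: o_def)
  have "late_limsup u l < \<phi> l + e / 2" using le[OF l(1)] e by linarith
  from late_limsup_eventually[OF this l(3) T]
  have 1: "\<forall>\<^sub>F n in sequentially. u (X (\<sigma> n), T (\<sigma> n)) < \<phi> l + e / 2" by simp
  have "(\<lambda>n. \<phi> ((X \<circ> \<sigma>) n)) \<longlonglongrightarrow> \<phi> l"
    by (rule continuous_on_tendsto_compose[OF \<phi> l(3,1)]) (use X(1) in auto)
  then have 2: "\<forall>\<^sub>F n in sequentially. \<phi> l - e / 2 < \<phi> ((X \<circ> \<sigma>) n)"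
    using e by (intro order_tendstoD(1)) auto
  have "\<forall>\<^sub>F n in sequentially. False"
    using 1 2
  proof eventually_elim
    case (elim n)
    then show ?case using X(3)[of "\<sigma> n"] by simp
  qed
  then show False by simp
qed

end

section \<open>Passage to the limit in the parabolic inequality\<close>

lemma bounded_borel_Ls:
  fixes v :: "real ^ 'n \<Rightarrow> real"
  assumes s: "0 < s" and v: "v \<in> borel_measurable borel" "\<And>x. \<bar>v x\<bar> \<le> M"
  shows "v \<in> Ls_space s"
proof -
  note [measurable] = v(1)
  let ?w = "\<lambda>x::real ^ 'n. 1 + norm x powr (real CARD('n) + 2 * s)"
  have M: "0 \<le> M" using v(2)[of 0] by linarith
  have "integrable lborel (\<lambda>x. \<bar>v x\<bar> / ?w x)"
  proof (rule Bochner_Integration.integrable_bound)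
    have "integrable lborel (indicat_real (ball (0 :: real ^ 'n) 1))"
      using emeasure_bounded_finite[of "ball (0 :: real ^ 'n) 1"] by (intro integrable_real_indicator) auto
    then show "integrable lborel (\<lambda>x::real ^ 'n. M * (indicator (ball 0 1) x + tail_kernel s 1 x))"
      using integrable_tail_kernel[OF s, of 1, where ?'n='n] by simp
    show "AE x in lborel. norm (\<bar>v x\<bar> / ?w x) \<le> norm (M * (indicator (ball 0 1) x + tail_kernel s 1 x))"
    proof (rule AE_I2)
      fix x :: "real ^ 'n"
      have w: "1 \<le> ?w x" by simp
      have w0: "0 < ?w x" using w by linarith
      have "1 / ?w x \<le> indicator (ball 0 1) x + tail_kernel s 1 x"
      proof (cases "norm x < 1")
        case True
        have "1 / ?w x \<le> 1" using w by (simp only: divide_le_eq_1_pos[OF w0])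
        also have "\<dots> \<le> indicator (ball 0 1) x + tail_kernel s 1 x"
          using True tail_kernel_nonneg[of s 1 x] by simp
        finally show ?thesis .
      next
        case False
        then have p: "0 < norm x powr (real CARD('n) + 2 * s)" by auto
        have "1 / ?w x \<le> 1 / norm x powr (real CARD('n) + 2 * s)"
          by (rule divide_left_mono[OF _ _ mult_pos_pos[OF w0 p]]) simp_all
        then show ?thesis using False by (simp add: tail_kernel_def)
      qed
      then have "\<bar>v x\<bar> * (1 / ?w x) \<le> M * (indicator (ball 0 1) x + tail_kernel s 1 x)"
        using v(2)[of x] M by (intro mult_mono) auto
      also have "\<dots> \<le> norm (M * (indicator (ball 0 1) x + tail_kernel s 1 x))" by simp
      finally show "norm (\<bar>v x\<bar> / ?w x) \<le> norm (M * (indicator (ball 0 1) x + tail_kernel s 1 x))"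
        using w0 by (simp add: abs_mult)
    qed
  qed measurable
  then show ?thesis by (simp add: Ls_space_borel_iff)
qed

text \<open>A one-sided Fatou lemma for bounded integrands: only a lower bound for the limit
  inferior of \<open>H n\<close> is available, but after truncation from above by \<open>h\<close>
  the sequence converges, and dominated convergence applies.\<close>

lemma weighted_integral_le_of_eventually_ge:
  fixes h :: "'a \<Rightarrow> real" and H :: "nat \<Rightarrow> 'a \<Rightarrow> real"
  assumes w: "integrable N w" "\<And>z. 0 \<le> w z"
    and meas[measurable]: "h \<in> borel_measurable N" "\<And>n. H n \<in> borel_measurable N"
    and bd: "\<And>z. \<bar>h z\<bar> \<le> B" "\<And>n z. \<bar>H n z\<bar> \<le> B"
    and ge: "\<And>z e. 0 < e \<Longrightarrow> \<forall>\<^sub>F n in sequentially. h z - e < H n z"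
    and le: "\<forall>\<^sub>F n in sequentially. (LINT z|N. H n z * w z) \<le> r n" and r: "r \<longlonglongrightarrow> l"
  shows "(LINT z|N. h z * w z) \<le> l"
proof -
  have [measurable]: "w \<in> borel_measurable N" using w(1) by simp
  have intB: "integrable N (\<lambda>z. B * w z)" using w(1) by simp
  have bw: "norm (k * w z) \<le> B * w z" if "\<bar>k\<bar> \<le> B" for k z
    using that w(2)[of z] by (simp add: abs_mult mult_right_mono)
  have int: "integrable N (\<lambda>z. min (H n z) (h z) * w z)" "integrable N (\<lambda>z. H n z * w z)" for n
  proof -
    have "\<bar>min (H n z) (h z)\<bar> \<le> B" for z using bd(1)[of z] bd(2)[of n z] by linarith
    then have "norm (min (H n z) (h z) * w z) \<le> norm (B * w z)" "norm (H n z * w z) \<le> norm (B * w z)" for z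
      using bw[of "min (H n z) (h z)" z] bw[of "H n z" z] bd(2)[of n z] order_trans[OF _ abs_ge_self] by (metis real_norm_def)+
    then show "integrable N (\<lambda>z. min (H n z) (h z) * w z)" "integrable N (\<lambda>z. H n z * w z)"
      by (intro Bochner_Integration.integrable_bound[OF intB] AE_I2; simp)+
  qed
  have "(\<lambda>n. LINT z|N. min (H n z) (h z) * w z) \<longlonglongrightarrow> (LINT z|N. h z * w z)"
  proof (rule integral_dominated_convergence[OF _ _ intB])
    show "AE z in N. (\<lambda>n. min (H n z) (h z) * w z) \<longlonglongrightarrow> h z * w z"
    proof (intro AE_I2 tendsto_mult_right)
      fix z
      show "(\<lambda>n. min (H n z) (h z)) \<longlonglongrightarrow> h z"
      proof (rule tendstoI)
        fix e :: real assume "0 < e"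
        from ge[OF this, of z] show "\<forall>\<^sub>F n in sequentially. dist (min (H n z) (h z)) (h z) < e"
          by eventually_elim (use \<open>0 < e\<close> in \<open>auto simp: dist_real_def min_def\<close>)
      qed
    qed
    show "AE z in N. norm (min (H n z) (h z) * w z) \<le> B * w z" for n
    proof (intro AE_I2 bw)
      fix z show "\<bar>min (H n z) (h z)\<bar> \<le> B" using bd(1)[of z] bd(2)[of n z] by linarith
    qed
  qed measurable
  moreover have "\<forall>\<^sub>F n in sequentially. (LINT z|N. min (H n z) (h z) * w z) \<le> r n"
    using le
  proof eventually_elim
    case (elim n)
    have "(LINT z|N. min (H n z) (h z) * w z) \<le> (LINT z|N. H n z * w z)"
      by (rule integral_mono[OF int]) (intro mult_right_mono w(2), simp)
    then show ?case using elim by linarith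
  qed
  ultimately show ?thesis using r by (intro tendsto_le[OF sequentially_bot r])
qed

text \<open>The time penalty is \<open>1\<close> at the ends of the window \<open>\<bar>t - t1\<bar> \<le> t1 / 2\<close>, yet its derivative is
  at most \<open>4 / t1\<close>, which disappears as \<open>t1 \<rightarrow> \<infinity>\<close>.\<close>

lemma late_limsup_touching:
  fixes u :: "(real ^ 'n) \<times> real \<Rightarrow> real" and \<phi> :: "real ^ 'n \<Rightarrow> real"
  assumes M: "\<And>x t. 0 \<le> t \<Longrightarrow> \<bar>u (x, t)\<bar> \<le> M" and u: "continuous_on S_inf_closed u"
    and \<phi>: "continuous_on UNIV \<phi>" and \<rho>: "0 < \<rho>"
    and eq: "late_limsup u x0 = \<phi> x0" and le: "\<And>x. x \<in> cball x0 \<rho> \<Longrightarrow> late_limsup u x \<le> \<phi> x"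
    and \<epsilon>: "0 < \<epsilon>"
  shows "\<exists>x1 s1 t1. 1 / \<epsilon> < t1 \<and> \<bar>s1 - t1\<bar> < t1 / 2 \<and> dist x1 x0 < \<epsilon> \<and> \<bar>u (x1, s1) - late_limsup u x0\<bar> < \<epsilon> \<and>
    (\<forall>x\<in>cball x0 \<rho>. \<forall>t. \<bar>t - t1\<bar> \<le> t1 / 2 \<longrightarrow>
      u (x, t) - (\<phi> x + (norm (x - x0))\<^sup>2) - 4 / t1\<^sup>2 * (t - t1)\<^sup>2
      \<le> u (x1, s1) - (\<phi> x1 + (norm (x1 - x0))\<^sup>2) - 4 / t1\<^sup>2 * (s1 - t1)\<^sup>2)"
proof -
  have "isCont \<phi> x0" using \<phi> by (simp add: continuous_on_eq_continuous_at)
  then have cont: "\<exists>d>0. \<forall>x. dist x x0 < d \<longrightarrow> \<bar>\<phi> x - \<phi> x0\<bar> < e" if "0 < e" for e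
    using that unfolding continuous_at_eps_delta dist_real_def by blast
  obtain d0 where d0: "0 < d0" "\<And>x. dist x x0 < d0 \<Longrightarrow> \<bar>\<phi> x - \<phi> x0\<bar> < \<epsilon> / 4" using cont[of "\<epsilon> / 4"] \<epsilon> by auto
  define b where "b = min \<epsilon> d0"
  have b: "0 < b" "b \<le> \<epsilon>" "b \<le> d0" using \<epsilon> d0(1) by (auto simp: b_def)
  \<comment> \<open>The comparison below gives
    \<open>(norm (x1 - x0))\<^sup>2 + P \<le> 4 * e\<close>. The last two entries thus yield
    \<open>P \<le> 1 / 2\<close>, away from the ends of the time window, and a squared distance of
    at most \<open>b\<^sup>2 / 2\<close>; the first serves the closeness of the values.\<close>
  define e where "e = min (\<epsilon> / 8) (min (1 / 8) (b\<^sup>2 / 8))"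
  have e: "0 < e" "e \<le> \<epsilon> / 8" "e \<le> 1 / 8" "e \<le> b\<^sup>2 / 8" using \<epsilon> b by (auto simp: e_def)
  obtain T where T: "\<And>x t. x \<in> cball x0 \<rho> \<Longrightarrow> T < t \<Longrightarrow> u (x, t) \<le> \<phi> x + e"
    using late_limsup_uniform_upper[of u M "cball x0 \<rho>" \<phi> e] M continuous_on_subset[OF \<phi>] le e(1)
    by (metis compact_cball top_greatest)
  obtain d1 where d1: "0 < d1" "\<And>x. dist x x0 < d1 \<Longrightarrow> \<bar>\<phi> x - \<phi> x0\<bar> < e" using cont[OF e(1)] by auto
  \<comment> \<open>The last entry turns \<open>1 / r < t1\<close> into
    \<open>1 / \<epsilon> < t1\<close> and \<open>2 * \<bar>T\<bar> < t1\<close>, so that the whole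
    window from \<open>t1 / 2\<close> on lies beyond \<open>T\<close>.\<close>
  define r where "r = min (min d1 \<rho>) (min (min e 1) (1 / (2 * \<bar>T\<bar> + 1 / \<epsilon> + 1)))"
  have pos: "0 < 2 * \<bar>T\<bar> + 1 / \<epsilon> + 1" using \<epsilon> by (intro add_nonneg_pos add_nonneg_nonneg) auto
  then have r: "0 < r" "r \<le> d1" "r \<le> \<rho>" "r \<le> e" "r \<le> 1" "r \<le> 1 / (2 * \<bar>T\<bar> + 1 / \<epsilon> + 1)"
    using d1(1) \<rho> e(1) by (auto simp: r_def)
  have r_inv: "2 * \<bar>T\<bar> + 1 / \<epsilon> + 1 \<le> 1 / r"
    using r(1,6) pos by (simp add: pos_le_divide_eq mult.commute)
  have "\<exists>y t. dist y x0 < r \<and> 1 / r < t \<and> late_limsup u x0 - e < u (y, t)"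
  proof (rule ccontr)
    assume no: "\<not> ?thesis"
    have "u (y, t) \<le> late_limsup u x0 - e" if "dist y x0 < r" "1 / r < t" for y t
    proof (rule ccontr)
      assume "\<not> u (y, t) \<le> late_limsup u x0 - e"
      then have "late_limsup u x0 - e < u (y, t)" by simp
      with no that show False by blast
    qed
    note ub = this
    have "late_limsup u x0 \<le> late_limsup u x0 - e"
    proof (rule late_limsup_le[of u M r])
      show "u (y, t) \<le> late_limsup u x0 - e" if "dist y x0 < r" "1 / r < t" for y t
        using that by (rule ub)
    qed (use M r in auto)
    then show False using e(1) by simp
  qed
  then obtain y t1 where y: "dist y x0 < r" "1 / r < t1" "late_limsup u x0 - e < u (y, t1)" by blast
  have t1: "1 / \<epsilon> < t1" "2 * \<bar>T\<bar> < t1" "0 < t1"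
    using y(2) r_inv \<epsilon> by (simp_all add: add_nonneg_pos) (smt (verit) divide_pos_pos)+
  \<comment> \<open>The term \<open>(norm (x - x0))\<^sup>2\<close> makes the contact strict in
    space and forces the maximiser towards \<open>x0\<close>.\<close>
  define \<Phi> where "\<Phi> = (\<lambda>q. u q - (\<phi> (fst q) + (norm (fst q - x0))\<^sup>2) - 4 / t1\<^sup>2 * (snd q - t1)\<^sup>2)"
  define K where "K = cball x0 \<rho> \<times> {t1 / 2..3 * t1 / 2}"
  have K: "compact K" "(y, t1) \<in> K" "K \<subseteq> S_inf_closed"
    using y(1) r t1(3) by (auto simp: K_def S_inf_closed_def dist_commute intro: compact_Times)
  have "continuous_on K \<Phi>"
    unfolding \<Phi>_def
    by (intro continuous_intros continuous_on_subset[OF u K(3)] continuous_on_compose2[OF \<phi>]) auto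
  then obtain q where q: "q \<in> K" "\<And>q'. q' \<in> K \<Longrightarrow> \<Phi> q' \<le> \<Phi> q"
    using continuous_attains_sup[OF K(1)] K(2) by blast
  obtain x1 s1 where q_eq: "q = (x1, s1)" by (cases q)
  have x1: "x1 \<in> cball x0 \<rho>" "t1 / 2 \<le> s1" "s1 \<le> 3 * t1 / 2" using q(1) by (auto simp: K_def q_eq)
  define P where "P = 4 / t1\<^sup>2 * (s1 - t1)\<^sup>2"
  have P: "0 \<le> P" by (simp add: P_def)
  \<comment> \<open>At \<open>(y, t1)\<close> the time penalty is 0; the gap in \<open>u\<close>,
    the variation of \<open>\<phi>\<close> and the squared distance cost at most \<open>e\<close>
    each.\<close>
  have low: "- 3 * e \<le> \<Phi> (x1, s1)"
  proof -
    have "norm (y - x0) < r" using y(1) by (simp add: dist_norm)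
    then have "(norm (y - x0))\<^sup>2 \<le> r\<^sup>2" by (intro power_mono) auto
    also have "r\<^sup>2 \<le> r" using r(1,5) by (simp add: power2_eq_square mult_left_le)
    finally have "(norm (y - x0))\<^sup>2 \<le> e" using r(4) by linarith
    moreover have "\<bar>\<phi> y - \<phi> x0\<bar> < e" using d1(2) y(1) r(2) by simp
    ultimately have "- 3 * e \<le> \<Phi> (y, t1)" using y(3) eq by (simp add: \<Phi>_def)
    then show ?thesis using q(2)[OF K(2)] by (simp add: q_eq)
  qed
  have up: "u (x1, s1) \<le> \<phi> x1 + e"
    using x1 t1 by (intro T) auto
  have \<Phi>1: "\<Phi> (x1, s1) = u (x1, s1) - (\<phi> x1 + (norm (x1 - x0))\<^sup>2) - P" by (simp add: \<Phi>_def P_def)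
  have "(norm (x1 - x0))\<^sup>2 + P \<le> 4 * e" using low up \<Phi>1 by linarith
  then have n1: "(norm (x1 - x0))\<^sup>2 \<le> b\<^sup>2 / 2" and P1: "P \<le> 1 / 2" using e P zero_le_power2[of "norm (x1 - x0)"] by linarith+
  have "b\<^sup>2 / 2 < b\<^sup>2" using b by simp
  then have "(norm (x1 - x0))\<^sup>2 < b\<^sup>2" using n1 by linarith
  then have x1b: "dist x1 x0 < b" using b by (simp add: dist_norm power2_less_imp_less)
  have "(s1 - t1)\<^sup>2 < (t1 / 2)\<^sup>2"
  proof -
    have "4 * (s1 - t1)\<^sup>2 \<le> 1 / 2 * t1\<^sup>2" using P1 t1(3) by (simp add: P_def pos_divide_le_eq)
    moreover have "0 < t1\<^sup>2" using t1(3) by simp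
    ultimately have "4 * (s1 - t1)\<^sup>2 < t1\<^sup>2" by linarith
    then show ?thesis by (simp add: power_divide)
  qed
  then have "\<bar>s1 - t1\<bar>\<^sup>2 < (t1 / 2)\<^sup>2" by simp
  then have s1: "\<bar>s1 - t1\<bar> < t1 / 2" by (rule power2_less_imp_less) (use t1(3) in simp)
  have "\<bar>\<phi> x1 - \<phi> x0\<bar> < \<epsilon> / 4" using d0(2) x1b b by simp
  moreover have "- 3 * e \<le> u (x1, s1) - \<phi> x1" using low \<Phi>1 P zero_le_power2[of "norm (x1 - x0)"] by linarith
  ultimately have "\<bar>u (x1, s1) - late_limsup u x0\<bar> < \<epsilon>" using up e(2) eq \<epsilon> unfolding abs_less_iff by linarith
  moreover have "\<Phi> (x, t) \<le> \<Phi> (x1, s1)" if "x \<in> cball x0 \<rho>" "\<bar>t - t1\<bar> \<le> t1 / 2" for x t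
  proof -
    have "t1 / 2 \<le> t" "t \<le> 3 * t1 / 2" using that(2) unfolding abs_le_iff by linarith+
    then show ?thesis using q(2)[of "(x, t)"] that(1) by (simp add: K_def q_eq)
  qed
  ultimately show ?thesis
    using t1(1) s1 x1b b by (intro exI[of _ x1] exI[of _ s1] exI[of _ t1]) (auto simp: \<Phi>_def)
qed

text \<open>Two limits are taken in succession. At a fixed radius \<open>d\<close>, the contact
  points approach \<open>x0\<close> at times tending to infinity, which produces an inequality for
  the far part of the relaxed limit itself. Letting \<open>d\<close> tend to 0 then removes the near
  parts of both the perturbed and the original test function.\<close>

lemma late_limsup_elliptic_subsolution:
  fixes u :: "(real ^ 'n) \<times> real \<Rightarrow> real" and a c f :: "real ^ 'n \<Rightarrow> real"
  assumes s: "0 < s" "s < 1" and a: "\<And>x. 0 < a x"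
    and cont: "continuous_on UNIV a" "continuous_on UNIV c" "continuous_on UNIV f"
    and sub: "parabolic_subsolution s a c f u" and u: "continuous_on S_inf_closed u"
    and M: "\<And>x t. 0 \<le> t \<Longrightarrow> \<bar>u (x, t)\<bar> \<le> M"
  shows "elliptic_subsolution s a c f (late_limsup u)"
proof -
  define v where "v = late_limsup u"
  define C where "C = frac_const CARD('n) s"
  define \<kappa> where "\<kappa> d = (LINT z|lborel. near_kernel s d (z :: real ^ 'n))" for d
  have C: "0 < C" unfolding C_def by (rule frac_const_pos[OF s])
  have usc: "usc_on UNIV v" unfolding v_def by (rule usc_on_late_limsup[of u M, OF M])
  have vb[measurable]: "v \<in> borel_measurable borel" by (rule usc_on_UNIV_borel[OF usc])
  have vM: "\<bar>v x\<bar> \<le> M" for x unfolding v_def by (rule abs_late_limsup_le[of u M, OF M])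
  have vLs: "v \<in> Ls_space s" by (rule bounded_borel_Ls[OF s(1) vb vM])
  have main: "a x0 * frac_laplacian s (splice_on U \<phi> v) x0 - c x0 * v x0 \<le> f x0"
    if U: "open U" "bounded U" "x0 \<in> U" and \<phi>: "C2_on UNIV \<phi>" and eq: "v x0 = \<phi> x0"
      and le: "\<And>x. x \<in> U \<Longrightarrow> v x - \<phi> x \<le> v x0 - \<phi> x0" for U x0 \<phi>
  proof -
    define w where "w = splice_on U \<phi> v"
    have \<phi>c: "continuous_on UNIV \<phi>" by (rule C2_on_imp_continuous_on[OF \<phi>])
    have w: "w \<in> borel_measurable borel" "w \<in> Ls_space s"
      unfolding w_def by (rule splice_on_borel_Ls[OF U(1,2) \<phi>c vb vLs])+
    obtain \<rho> where \<rho>: "0 < \<rho>" "cball x0 \<rho> \<subseteq> U" using U open_contains_cball by blast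
    \<comment> \<open>The spatially perturbed test function; its constant \<open>B\<close> must hold
      for all centres near \<open>x0\<close>, since the contact points move with
      \<open>n\<close>.\<close>
    have C2: "C2_on UNIV (\<lambda>x. \<phi> x + 1 * (norm (x - x0))\<^sup>2)"
      by (intro C2_on_add \<phi> C2_on_norm_square)
    obtain B where B: "\<And>x z. x + z \<in> cball x0 \<rho> \<Longrightarrow> x - z \<in> cball x0 \<rho> \<Longrightarrow>
        \<bar>\<phi> (x + z) + 1 * (norm (x + z - x0))\<^sup>2 + (\<phi> (x - z) + 1 * (norm (x - z - x0))\<^sup>2)
          - 2 * (\<phi> x + 1 * (norm (x - x0))\<^sup>2)\<bar> \<le> B * (norm z)\<^sup>2"
      using C2_on_second_difference[OF C2, of "cball x0 \<rho>"] by auto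
    \<comment> \<open>In contrast to \<open>B\<close>, the constant \<open>B'\<close> belongs to the
      splice in the elliptic definition and is needed at \<open>x0\<close> only.\<close>
    obtain d0 B' where d0: "0 < d0" and B': "C2_bounded_at d0 B' w x0"
      using C2_bounded_at_near[OF \<phi> U(1,3), of w] by (auto simp: w_def splice_on_def)
    have "\<forall>n. \<exists>x1 s1 t1. real (Suc n) < t1 \<and> \<bar>s1 - t1\<bar> < t1 / 2 \<and> dist x1 x0 < 1 / real (Suc n) \<and>
      \<bar>u (x1, s1) - v x0\<bar> < 1 / real (Suc n) \<and>
      (\<forall>x\<in>cball x0 \<rho>. \<forall>t. \<bar>t - t1\<bar> \<le> t1 / 2 \<longrightarrow>
        u (x, t) - (\<phi> x + (norm (x - x0))\<^sup>2) - 4 / t1\<^sup>2 * (t - t1)\<^sup>2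
        \<le> u (x1, s1) - (\<phi> x1 + (norm (x1 - x0))\<^sup>2) - 4 / t1\<^sup>2 * (s1 - t1)\<^sup>2)"
    proof
      fix n :: nat
      have "late_limsup u x \<le> \<phi> x" if "x \<in> cball x0 \<rho>" for x
        using le[of x] that \<rho>(2) eq by (auto simp: v_def)
      from late_limsup_touching[of u M, OF M u \<phi>c \<rho>(1) eq[unfolded v_def] this, of "1 / real (Suc n)"]
      show "\<exists>x1 s1 t1. real (Suc n) < t1 \<and> \<bar>s1 - t1\<bar> < t1 / 2 \<and> dist x1 x0 < 1 / real (Suc n) \<and>
      \<bar>u (x1, s1) - v x0\<bar> < 1 / real (Suc n) \<and>
      (\<forall>x\<in>cball x0 \<rho>. \<forall>t. \<bar>t - t1\<bar> \<le> t1 / 2 \<longrightarrow>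
        u (x, t) - (\<phi> x + (norm (x - x0))\<^sup>2) - 4 / t1\<^sup>2 * (t - t1)\<^sup>2
        \<le> u (x1, s1) - (\<phi> x1 + (norm (x1 - x0))\<^sup>2) - 4 / t1\<^sup>2 * (s1 - t1)\<^sup>2)"
        unfolding v_def by simp
    qed
    then obtain X S T where T: "\<And>n. real (Suc n) < T n" and S: "\<And>n. \<bar>S n - T n\<bar> < T n / 2"
      and X: "\<And>n. dist (X n) x0 < 1 / real (Suc n)"
      and uX: "\<And>n. \<bar>u (X n, S n) - v x0\<bar> < 1 / real (Suc n)"
      and max: "\<And>n x t. x \<in> cball x0 \<rho> \<Longrightarrow> \<bar>t - T n\<bar> \<le> T n / 2 \<Longrightarrow>
        u (x, t) - (\<phi> x + (norm (x - x0))\<^sup>2) - 4 / (T n)\<^sup>2 * (t - T n)\<^sup>2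
        \<le> u (X n, S n) - (\<phi> (X n) + (norm (X n - x0))\<^sup>2) - 4 / (T n)\<^sup>2 * (S n - T n)\<^sup>2"
      unfolding choice_iff by blast
    have inv0: "(\<lambda>n. 1 / real (Suc n)) \<longlonglongrightarrow> 0"
      using LIMSEQ_inverse_real_of_nat by (simp add: inverse_eq_divide)
    have Xlim: "X \<longlonglongrightarrow> x0"
      by (rule tendsto_dist_iff[THEN iffD2], rule Lim_null_comparison[OF _ inv0])
        (use X in \<open>auto intro!: always_eventually less_imp_le simp del: of_nat_Suc\<close>)
    have uXlim: "(\<lambda>n. u (X n, S n)) \<longlonglongrightarrow> v x0"
      by (rule LIM_zero_cancel, rule Lim_null_comparison[OF _ inv0])
        (use uX in \<open>auto intro!: always_eventually less_imp_le simp del: of_nat_Suc\<close>)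
    have T0: "0 < T n" for n using T[of n] by linarith
    have Sge: "T n / 2 < S n" for n using S[of n] unfolding abs_less_iff by linarith
    then have S0: "0 < S n" for n using T0[of n] by (meson half_gt_zero order.strict_trans)
    have "filterlim (\<lambda>n. real n * (1 / 2)) at_top sequentially"
      by (rule filterlim_at_top_mult_tendsto_pos[OF tendsto_const _ filterlim_real_sequentially]) simp
    then have Slim: "filterlim S at_top sequentially"
    proof (rule filterlim_at_top_mono)
      show "\<forall>\<^sub>F n in sequentially. real n * (1 / 2) \<le> S n"
      proof (intro always_eventually allI)
        fix n show "real n * (1 / 2) \<le> S n" using Sge[of n] T[of n] by simp
      qed
    qed
    \<comment> \<open>Time derivative of the penalty at the contact point; the window gives the
      bound \<open>4 / T n\<close>, so it vanishes in the limit.\<close>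
    define D where "D n = 8 / (T n)\<^sup>2 * (S n - T n)" for n
    have Dlim: "D \<longlonglongrightarrow> 0"
    proof (rule Lim_null_comparison)
      show "(\<lambda>n. 4 * (1 / real (Suc n))) \<longlonglongrightarrow> 0" using tendsto_mult_right_zero[OF inv0] .
      show "\<forall>\<^sub>F n in sequentially. norm (D n) \<le> 4 * (1 / real (Suc n))"
      proof (intro always_eventually allI)
        fix n
        have "norm (D n) = 8 / (T n)\<^sup>2 * \<bar>S n - T n\<bar>" by (simp only: D_def real_norm_def abs_mult) simp
        also have "\<dots> \<le> 8 / (T n)\<^sup>2 * (T n / 2)" using S[of n] by (intro mult_left_mono) auto
        also have "\<dots> = 4 * (1 / T n)" using T0[of n] by (simp add: power2_eq_square)
        also have "\<dots> \<le> 4 * (1 / real (Suc n))" using T[of n] by (intro mult_left_mono divide_left_mono) auto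
        finally show "norm (D n) \<le> 4 * (1 / real (Suc n))" .
      qed
    qed
    \<comment> \<open>With \<open>d < \<rho> / 2\<close> and contact points eventually within
      \<open>\<rho> / 2\<close> of \<open>x0\<close>, every test ball stays in
      \<open>cball x0 \<rho>\<close>, where both the constant \<open>B\<close> and the maximality
      are valid.\<close>
    have claim: "a x0 * (C * (far_part s d v x0 - B / 2 * \<kappa> d)) - c x0 * v x0 \<le> f x0"
      if d: "0 < d" "d < \<rho> / 2" for d
    proof -
      define r where "r n = (f (X n) + c (X n) * u (X n, S n) - D n) / a (X n) / C + B / 2 * \<kappa> d" for n
      have lims: "(\<lambda>n. a (X n)) \<longlonglongrightarrow> a x0" "(\<lambda>n. c (X n)) \<longlonglongrightarrow> c x0" "(\<lambda>n. f (X n)) \<longlonglongrightarrow> f x0"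
        using cont Xlim by (auto intro: continuous_on_tendsto_compose)
      have rlim: "r \<longlonglongrightarrow> (f x0 + c x0 * v x0 - 0) / a x0 / C + B / 2 * \<kappa> d"
        unfolding r_def using a[of x0] C by (intro tendsto_intros lims uXlim Dlim) auto
      have rle: "\<forall>\<^sub>F n in sequentially. (LINT z|lborel. (u (X n, S n) - u (X n + z, S n)) * tail_kernel s d z) \<le> r n"
      proof -
        have "\<forall>\<^sub>F n in sequentially. dist (X n) x0 < \<rho> / 2" using Xlim \<rho>(1) by (intro tendstoD) auto
        then show ?thesis
        proof eventually_elim
          case (elim n)
          let ?\<phi> = "\<lambda>z. \<phi> (fst z) + 1 * (norm (fst z - x0))\<^sup>2 + (4 / (T n)\<^sup>2 * (snd z - T n)\<^sup>2
            + (u (X n, S n) - (\<phi> (X n) + (norm (X n - x0))\<^sup>2) - 4 / (T n)\<^sup>2 * (S n - T n)\<^sup>2))"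
          have inball: "X n + z \<in> cball x0 \<rho>" "X n - z \<in> cball x0 \<rho>" if z: "norm z < \<rho> / 2" for z
          proof -
            have "dist (X n + z) x0 = norm (X n - x0 + z)" "dist (X n - z) x0 = norm (X n - x0 - z)"
              by (simp_all add: dist_norm algebra_simps)
            then show "X n + z \<in> cball x0 \<rho>" "X n - z \<in> cball x0 \<rho>"
              unfolding mem_cball dist_commute[of x0]
              using z elim norm_triangle_ineq[of "X n - x0" z] norm_triangle_ineq4[of "X n - x0" z]
              by (simp_all add: dist_norm)
          qed
          have "D n + a (X n) * (frac_const CARD('n) s * (far_part s d (\<lambda>x. u (x, S n)) (X n)
            - B / 2 * (LINT z|lborel. near_kernel s d (z :: real ^ 'n)))) - c (X n) * u (X n, S n) \<le> f (X n)"
          proof (rule parabolic_subsolution_test[OF s sub a])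
            show "(\<lambda>x. u (x, S n)) \<in> borel_measurable borel"
              by (rule continuous_time_slice_borel[OF u less_imp_le[OF S0]])
            show "C2_on S_inf ?\<phi>"
              by (intro C2_on_add C2_on_fst[OF C2] C2_on_time_square C2_on_const)
            show "C2_bounded_at d B (\<lambda>x. ?\<phi> (x, S n)) (X n)"
              unfolding C2_bounded_at_def
            proof (intro allI impI)
              fix z :: "real ^ 'n" assume "norm z < d"
              then show "\<bar>?\<phi> (X n + z, S n) + ?\<phi> (X n - z, S n) - 2 * ?\<phi> (X n, S n)\<bar> \<le> B * (norm z)\<^sup>2"
                using B[OF inball, of z] d by (simp add: algebra_simps)
            qed
            show "((\<lambda>t. ?\<phi> (X n, t)) has_real_derivative D n) (at (S n))"
              unfolding D_def using T0[of n] by (auto intro!: derivative_eq_intros simp: power2_eq_square)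
            \<comment> \<open>The largest radius for which the time interval around
              \<open>S n\<close> remains inside the window around \<open>T n\<close>.\<close>
            show "0 < T n / 2 - \<bar>S n - T n\<bar>" "T n / 2 - \<bar>S n - T n\<bar> \<le> S n"
              using S[of n] Sge[of n] by auto
            show "u (x, t) \<le> ?\<phi> (x, t)"
              if "x \<in> ball (X n) d" "t \<in> ball (S n) (T n / 2 - \<bar>S n - T n\<bar>)" for x t
            proof -
              have "x \<in> cball x0 \<rho>"
                using inball(1)[of "x - X n"] that(1) d by (simp add: dist_norm norm_minus_commute)
              moreover have "\<bar>t - T n\<bar> \<le> T n / 2" using that(2) unfolding mem_ball dist_real_def by linarith
              ultimately show ?thesis using max[of x t n] by simp
            qed
          qed (use d in auto)
          then have "(C * (far_part s d (\<lambda>x. u (x, S n)) (X n) - B / 2 * \<kappa> d)) * a (X n) \<le> f (X n) + c (X n) * u (X n, S n) - D n"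
            by (simp add: C_def \<kappa>_def mult.commute)
          then have "(far_part s d (\<lambda>x. u (x, S n)) (X n) - B / 2 * \<kappa> d) * C \<le> (f (X n) + c (X n) * u (X n, S n) - D n) / a (X n)"
            unfolding pos_le_divide_eq[OF a] by (simp add: mult.commute)
          then have "far_part s d (\<lambda>x. u (x, S n)) (X n) - B / 2 * \<kappa> d \<le> (f (X n) + c (X n) * u (X n, S n) - D n) / a (X n) / C"
            unfolding pos_le_divide_eq[OF C] .
          then show ?case by (simp add: r_def far_part_def)
        qed
      qed
      have "(LINT z|lborel. (v x0 - v (x0 + z)) * tail_kernel s d z) \<le> (f x0 + c x0 * v x0 - 0) / a x0 / C + B / 2 * \<kappa> d"
      proof (rule weighted_integral_le_of_eventually_ge[where B = "2 * M"
            and H = "\<lambda>n z. u (X n, S n) - u (X n + z, S n)", OF _ _ _ _ _ _ _ rle rlim])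
        show "integrable lborel (tail_kernel s d :: real ^ 'n \<Rightarrow> real)" by (rule integrable_tail_kernel[OF s(1) d(1)])
        show "(\<lambda>z. v x0 - v (x0 + z)) \<in> borel_measurable lborel" by measurable
        show "(\<lambda>z. u (X n, S n) - u (X n + z, S n)) \<in> borel_measurable lborel" for n
        proof -
          have [measurable]: "(\<lambda>x. u (x, S n)) \<in> borel_measurable borel"
            by (rule continuous_time_slice_borel[OF u less_imp_le[OF S0]])
          have "(\<lambda>z. (\<lambda>x. u (x, S n)) (X n + z)) \<in> borel_measurable borel" by measurable
          then show ?thesis by simp
        qed
        show "\<bar>v x0 - v (x0 + z)\<bar> \<le> 2 * M" for z using vM[of x0] vM[of "x0 + z"] by linarith
        show "\<bar>u (X n, S n) - u (X n + z, S n)\<bar> \<le> 2 * M" for n z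
          using M[of "S n" "X n"] M[of "S n" "X n + z"] S0[of n] by linarith
        \<comment> \<open>Along the contact points \<open>u\<close> converges to
          \<open>v x0\<close>, while at the translates the relaxed limit only bounds it from above;
          the increments are thus controlled from below, as the one-sided lemma requires.\<close>
        show "\<forall>\<^sub>F n in sequentially. v x0 - v (x0 + z) - e < u (X n, S n) - u (X n + z, S n)" if e: "0 < e" for z e
        proof -
          have "\<forall>\<^sub>F n in sequentially. u (X n + z, S n) < v (x0 + z) + e / 2"
            by (rule late_limsup_eventually[of u M, OF M _ _ Slim]) (use e Xlim in \<open>auto simp: v_def intro!: tendsto_intros\<close>)
          moreover have "\<forall>\<^sub>F n in sequentially. v x0 - e / 2 < u (X n, S n)"
            using e by (intro order_tendstoD(1)[OF uXlim]) auto
          ultimately show ?thesis by eventually_elim (simp add: field_simps)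
        qed
      qed simp_all
      then have "(far_part s d v x0 - B / 2 * \<kappa> d) \<le> (f x0 + c x0 * v x0) / a x0 / C"
        by (simp add: far_part_def)
      then have "(far_part s d v x0 - B / 2 * \<kappa> d) * C * a x0 \<le> f x0 + c x0 * v x0"
        unfolding pos_le_divide_eq[OF C] pos_le_divide_eq[OF a] .
      then show ?thesis by (simp add: ac_simps)
    qed
    have bound: "a x0 * frac_laplacian s w x0 - c x0 * v x0 \<le> f x0 + a x0 * C * ((B + B') / 2 * \<kappa> d)"
      if d: "0 < d" "d < min (\<rho> / 2) d0" for d
    proof -
      have Bd: "C2_bounded_at d B' w x0" using B' d by (auto simp: C2_bounded_at_def)
      have "frac_laplacian s w x0 = C * (far_part s d w x0 + near_part s d w x0 / 2)"
        unfolding C_def by (rule frac_laplacian_eq[OF w Bd s d(1)])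
      also have "\<dots> \<le> C * (far_part s d v x0 + B' / 2 * \<kappa> d)"
      proof (intro mult_left_mono add_mono)
        have wx0: "w x0 = v x0" using U eq by (simp add: w_def splice_on_def)
        \<comment> \<open>Touching from above means that the splice dominates \<open>v\<close> with
          equality at \<open>x0\<close>, so its increments, and with them its far part, are no
          larger.\<close>
        have "v y \<le> w y" for y using le[of y] eq by (auto simp: w_def splice_on_def)
        then show "far_part s d w x0 \<le> far_part s d v x0"
          unfolding far_part_def wx0
          by (intro integral_mono integrable_increment_tail[OF w s(1) d(1)]
              integrable_increment_tail[OF vb vLs s(1) d(1)] mult_right_mono) auto
        show "near_part s d w x0 / 2 \<le> B' / 2 * \<kappa> d"
          using near_part_bound[OF w(1) Bd s d(1)] by (simp add: \<kappa>_def abs_le_iff)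
      qed (use C in simp)
      finally have "a x0 * frac_laplacian s w x0 \<le> a x0 * (C * (far_part s d v x0 + B' / 2 * \<kappa> d))"
        using a[of x0] by (intro mult_left_mono) auto
      also have "\<dots> = a x0 * (C * (far_part s d v x0 - B / 2 * \<kappa> d)) + a x0 * C * ((B + B') / 2 * \<kappa> d)"
        by (simp add: algebra_simps add_divide_distrib)
      finally show ?thesis using claim[of d] d by simp
    qed
    have "((\<lambda>d. f x0 + a x0 * C * ((B + B') / 2 * \<kappa> d)) \<longlongrightarrow> f x0 + a x0 * C * ((B + B') / 2 * 0)) (at_right 0)"
      unfolding \<kappa>_def by (intro tendsto_intros near_kernel_integral_tendsto_0 s)
    moreover have "\<forall>\<^sub>F d in at_right 0. a x0 * frac_laplacian s w x0 - c x0 * v x0 \<le> f x0 + a x0 * C * ((B + B') / 2 * \<kappa> d)"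
    proof (rule eventually_mono)
      show "\<forall>\<^sub>F d in at_right 0. d \<in> {0<..<min (\<rho> / 2) d0}"
        using \<rho>(1) d0 by (intro eventually_at_right_real) simp
    qed (use bound in \<open>simp only: greaterThanLessThan_iff\<close>)
    ultimately have "a x0 * frac_laplacian s w x0 - c x0 * v x0 \<le> f x0 + a x0 * C * ((B + B') / 2 * 0)"
      by (intro tendsto_lowerbound) auto
    then show ?thesis by (simp add: w_def)
  qed
  then show ?thesis
    using usc vLs unfolding elliptic_subsolution_def v_def[symmetric] by blast
qed

section \<open>Behaviour at infinity and the convergence theorem\<close>

lemma late_limsup_tendsto_at_infinity:
  fixes u :: "'a::real_normed_vector \<times> real \<Rightarrow> real"
  assumes M: "\<And>x t. 0 \<le> t \<Longrightarrow> \<bar>u (x, t)\<bar> \<le> M"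
    and lim: "\<And>e. 0 < e \<Longrightarrow> \<exists>R T. \<forall>x t. R \<le> norm x \<longrightarrow> T \<le> t \<longrightarrow> \<bar>u (x, t) - \<gamma>\<bar> < e"
  shows "(late_limsup u \<longlongrightarrow> \<gamma>) at_infinity"
proof (rule tendstoI)
  fix e :: real assume e: "0 < e"
  then obtain R T where RT: "\<And>x t. R \<le> norm x \<Longrightarrow> T \<le> t \<Longrightarrow> \<bar>u (x, t) - \<gamma>\<bar> < e / 2"
    using lim[of "e / 2"] by auto
  have "\<bar>late_limsup u x - \<gamma>\<bar> < e" if x: "R + 1 \<le> norm x" for x
  proof -
    \<comment> \<open>The radius \<open>1 / (\<bar>T\<bar> + 1)\<close> is at most 1, which the
      margin in \<open>R + 1\<close> absorbs, and its reciprocal is a time threshold beyond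
      \<open>T\<close>.\<close>
    have "late_limsup u x \<le> \<gamma> + e / 2"
    proof (rule late_limsup_le[of u M "1 / (\<bar>T\<bar> + 1)", OF M])
      fix y t assume y: "dist y x < 1 / (\<bar>T\<bar> + 1)" and t: "1 / (1 / (\<bar>T\<bar> + 1)) < t"
      have "1 / (\<bar>T\<bar> + 1) \<le> 1" by simp
      then have "dist y x < 1" using y by linarith
      then have "R \<le> norm y"
        using x norm_triangle_ineq2[of x "x - y"] by (simp add: dist_norm norm_minus_commute)
      moreover have "T \<le> t" using t by simp
      ultimately show "u (y, t) \<le> \<gamma> + e / 2" using RT[of y t] unfolding abs_less_iff by linarith
    qed auto
    moreover have "\<gamma> - e / 2 \<le> late_limsup u x"
    proof (rule late_limsup_ge[of u M, OF M])
      fix q r :: real assume r: "0 < r" "\<And>y t. dist y x < r \<Longrightarrow> 1 / r < t \<Longrightarrow> u (y, t) \<le> q"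
      have "u (x, max T (1 / r + 1)) \<le> q" using r by (intro r(2)) auto
      moreover have "\<bar>u (x, max T (1 / r + 1)) - \<gamma>\<bar> < e / 2" using x by (intro RT) auto
      ultimately show "\<gamma> - e / 2 \<le> q" unfolding abs_less_iff by linarith
    qed
    ultimately show ?thesis using e unfolding abs_less_iff by linarith
  qed
  then show "\<forall>\<^sub>F x in at_infinity. dist (late_limsup u x) \<gamma> < e"
    unfolding eventually_at_infinity dist_real_def by blast
qed

lemma locally_Holder_imp_continuous_on:
  fixes f :: "'a::euclidean_space \<Rightarrow> real"
  assumes "locally_Holder \<sigma> f" "0 < \<sigma>"
  shows "continuous_on UNIV f"
proof (rule continuous_at_imp_continuous_on, rule ballI)
  fix x :: 'a
  obtain L where L: "\<And>y. y \<in> cball x 1 \<Longrightarrow> \<bar>f y - f x\<bar> \<le> L * dist y x powr \<sigma>"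
    using assms(1)[unfolded locally_Holder_def, rule_format, OF compact_cball[of x 1]]
    by (metis centre_in_cball zero_le_one)
  have "((\<lambda>y. dist y x powr \<sigma>) \<longlongrightarrow> 0) (at x)"
    using tendsto_zero_powrI[of "\<lambda>y. dist y x" "at x" "\<lambda>_. \<sigma>" \<sigma>] assms(2) tendsto_dist_iff[of "\<lambda>y. y" x "at x"]
    by (simp add: tendsto_ident_at)
  then have "((\<lambda>y. L * dist y x powr \<sigma>) \<longlongrightarrow> 0) (at x)" by (rule tendsto_mult_right_zero)
  moreover have "\<forall>\<^sub>F y in at x. norm (f y - f x) \<le> L * dist y x powr \<sigma>"
    unfolding eventually_at by (rule exI[of _ 1]) (use L in \<open>auto simp: dist_commute\<close>)
  ultimately have "((\<lambda>y. f y - f x) \<longlongrightarrow> 0) (at x)" by (rule Lim_null_comparison[rotated])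
  then show "isCont f x" unfolding isCont_def by (rule LIM_zero_cancel)
qed

lemma continuous_tendsto_at_infinity_bounded:
  fixes f :: "'a::euclidean_space \<Rightarrow> real"
  assumes "continuous_on UNIV f" "(f \<longlongrightarrow> \<gamma>) at_infinity"
  shows "\<exists>M. \<forall>x. \<bar>f x\<bar> \<le> M"
proof -
  have "\<forall>\<^sub>F x in at_infinity. dist (f x) \<gamma> < 1" using assms(2) by (intro tendstoD) auto
  then obtain R where R: "\<And>x. R \<le> norm x \<Longrightarrow> \<bar>f x - \<gamma>\<bar> < 1"
    unfolding eventually_at_infinity dist_real_def by blast
  obtain b where b: "\<And>x. x \<in> cball 0 R \<Longrightarrow> \<bar>f x\<bar> \<le> b"
    using continuous_on_compact_bound[OF compact_cball continuous_on_subset[OF assms(1)], of 0 R] by blast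
  have "\<bar>f x\<bar> \<le> max b (\<bar>\<gamma>\<bar> + 1)" for x
  proof (cases "norm x \<le> R")
    case True
    then show ?thesis using b[of x] by simp
  next
    case False
    then show ?thesis using R[of x] by linarith
  qed
  then show ?thesis by blast
qed

theorem theorem2p11:
  fixes s \<sigma> \<gamma> :: real
    and a c f u0 :: "real ^ 'n \<Rightarrow> real"
    and g :: "real \<Rightarrow> real"
    and u :: "(real ^ 'n) \<times> real \<Rightarrow> real"
  assumes "0 < s" and "s < 1" and "real CARD('n) > 2 * s"
    and "0 < \<sigma>" and "\<sigma> < 1"
    and "locally_Holder \<sigma> a" and "\<And>x. a x > 0"
    and "\<exists>C0>0. \<exists>\<alpha>>2 * s. \<forall>x. a x \<ge> C0 * (1 + (norm x)\<^sup>2) powr (\<alpha> / 2)"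
    and "locally_Holder \<sigma> c" and "ess_bounded lebesgue c"
    and "locally_Holder \<sigma> f" and "ess_bounded lebesgue f"
    and "continuous_on {0..} g" and "ess_bounded (lebesgue_on {0<..}) g"
    and "continuous_on UNIV u0" and "ess_bounded lebesgue u0"
    and "\<And>x. c x \<le> 0"
    and "(u0 \<longlongrightarrow> g 0) at_infinity"
    and "(g \<longlongrightarrow> \<gamma>) at_top"
    and "cauchy_solution s a c f u0 u"
    and "uniform_limit {0..} (\<lambda>x t. u (x, t)) g at_infinity"
  shows "\<exists>W. elliptic_solution s a c f W \<and> (W \<longlongrightarrow> \<gamma>) at_infinity \<and>
           (\<forall>V. elliptic_solution s a c f V \<and> (V \<longlongrightarrow> \<gamma>) at_infinity \<longrightarrow> V = W) \<and>
           (\<forall>x. ((\<lambda>t. u (x, t)) \<longlongrightarrow> W x) at_top)"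
proof -
  note s = assms(1,2) and a = assms(7) and c = assms(17)
  have cont: "continuous_on UNIV a" "continuous_on UNIV c" "continuous_on UNIV f"
    using assms(4,6,9,11) by (blast intro: locally_Holder_imp_continuous_on)+
  have sup: "parabolic_supersolution s a c f u" and sub: "parabolic_subsolution s a c f u"
    and uc: "continuous_on S_inf_closed u"
    using assms(20)
    by (auto simp: cauchy_solution_def cauchy_subsolution_def cauchy_supersolution_def
        intro: usc_lsc_imp_continuous_on)
  \<comment> \<open>Being a subsolution with source \<open>- f\<close>, \<open>w\<close> receives
    the same upper bound and relaxed limit results; read for \<open>u\<close>, they give the lower
    bound and the lower relaxed limit.\<close>
  define w where "w = (\<lambda>z. - u z)"
  have wc: "continuous_on S_inf_closed w" unfolding w_def by (intro continuous_intros uc)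
  have wsub: "parabolic_subsolution s a c (\<lambda>x. - f x) w"
    unfolding w_def
    by (rule parabolic_supersolution_uminus[OF s sup continuous_time_slice_borel[OF uc less_imp_le]])
  have unif: "\<exists>R. \<forall>x t. R \<le> norm x \<longrightarrow> 0 \<le> t \<longrightarrow> \<bar>u (x, t) - g t\<bar> < e" if "0 < e" for e
    using uniform_limitD[OF assms(21) that] unfolding eventually_at_infinity dist_real_def by force
  have g_late: "\<exists>T\<ge>0. \<forall>t\<ge>T. \<bar>g t - \<gamma>\<bar> < e" if e: "0 < e" for e
  proof -
    obtain T where "\<And>t. T \<le> t \<Longrightarrow> \<bar>g t - \<gamma>\<bar> < e"
      using tendstoD[OF assms(19) e] unfolding eventually_at_top_linorder dist_real_def by blast
    then show ?thesis by (intro exI[of _ "max T 0"]) auto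
  qed
  have lim_u: "\<exists>R T. \<forall>x t. R \<le> norm x \<longrightarrow> T \<le> t \<longrightarrow> \<bar>u (x, t) - \<gamma>\<bar> < e" if e: "0 < e" for e
  proof -
    obtain R where R: "\<And>x t. R \<le> norm x \<Longrightarrow> 0 \<le> t \<Longrightarrow> \<bar>u (x, t) - g t\<bar> < e / 2"
      using unif[of "e / 2"] e by auto
    obtain T where T: "0 \<le> T" "\<And>t. T \<le> t \<Longrightarrow> \<bar>g t - \<gamma>\<bar> < e / 2"
      using g_late[of "e / 2"] e by auto
    have "\<bar>u (x, t) - \<gamma>\<bar> < e" if "R \<le> norm x" "T \<le> t" for x t
      using R[of x t] T(2)[of t] T(1) that by linarith
    then show ?thesis by blast
  qed
  have lim_w: "\<exists>R T. \<forall>x t. R \<le> norm x \<longrightarrow> T \<le> t \<longrightarrow> \<bar>w (x, t) - - \<gamma>\<bar> < e" if "0 < e" for e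
    using lim_u[OF that] by (simp add: w_def abs_minus_commute)
  obtain T where T: "0 \<le> T" "\<And>t. T \<le> t \<Longrightarrow> \<bar>g t - \<gamma>\<bar> < 1"
    using g_late[of 1] by auto
  obtain b where b: "\<And>t. t \<in> {0..T} \<Longrightarrow> \<bar>g t\<bar> \<le> b"
    using continuous_on_compact_bound[OF compact_Icc continuous_on_subset[OF assms(13)], of 0 T] by fastforce
  \<comment> \<open>\<open>G - 1\<close> bounds \<open>g\<close> for all times; the extra 1 absorbs
    the distance between \<open>u\<close> and \<open>g\<close> far out in space.\<close>
  define G where "G = max b (\<bar>\<gamma>\<bar> + 1) + 1"
  have G: "\<bar>g t\<bar> \<le> G - 1" if "0 \<le> t" for t
    using b[of t] T(2)[of t] that by (cases "t \<le> T") (auto simp: G_def)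
  obtain R0 where "\<And>x t. R0 \<le> norm x \<Longrightarrow> 0 \<le> t \<Longrightarrow> \<bar>u (x, t) - g t\<bar> < 1"
    using unif[of 1] by auto
  then have out: "\<bar>u (x, t)\<bar> \<le> G" if "max 0 R0 \<le> norm x" "0 \<le> t" for x t
    using G[of t] that by (smt (verit) max.bounded_iff)
  obtain \<Lambda>1 where \<Lambda>1: "\<And>x t. 0 \<le> t \<Longrightarrow> u (x, t) \<le> \<Lambda>1"
    using parabolic_subsolution_bounded_above[OF s a c cont(1,3) sub uc, of "max 0 R0" G] out
    by (auto simp: abs_le_iff)
  obtain \<Lambda>2 where \<Lambda>2: "\<And>x t. 0 \<le> t \<Longrightarrow> w (x, t) \<le> \<Lambda>2"
    using parabolic_subsolution_bounded_above[OF s a c cont(1) continuous_on_minus[OF cont(3)] wsub wc, of "max 0 R0" G] out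
    by (auto simp: abs_le_iff w_def)
  define M where "M = max \<Lambda>1 \<Lambda>2"
  have M: "\<bar>u (x, t)\<bar> \<le> M" "\<bar>w (x, t)\<bar> \<le> M" if "0 \<le> t" for x t
    using \<Lambda>1[OF that, of x] \<Lambda>2[OF that, of x] by (auto simp: M_def w_def abs_le_iff)
  define W where "W = late_limsup u"
  define W' where "W' = (\<lambda>x. - late_limsup w x)"
  have W_sub: "elliptic_subsolution s a c f W"
    unfolding W_def by (rule late_limsup_elliptic_subsolution[of s a c f u M]) (use s a cont sub uc M in auto)
  have "elliptic_subsolution s a c (\<lambda>x. - f x) (late_limsup w)"
    by (rule late_limsup_elliptic_subsolution[of s a c "\<lambda>x. - f x" w M])
      (use s a cont wsub wc M in \<open>auto intro: continuous_on_minus\<close>)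
  then have W'_sup: "elliptic_supersolution s a c f W'"
    by (simp add: elliptic_supersolution_iff[OF s] W'_def)
  have W_lim: "(W \<longlongrightarrow> \<gamma>) at_infinity"
    unfolding W_def by (rule late_limsup_tendsto_at_infinity[of u M]) (use M lim_u in auto)
  have "(late_limsup w \<longlongrightarrow> - \<gamma>) at_infinity"
    by (rule late_limsup_tendsto_at_infinity[of w M]) (use M lim_w in auto)
  then have W'_lim: "(W' \<longlongrightarrow> \<gamma>) at_infinity"
    unfolding W'_def using tendsto_minus by fastforce
  have bd: "\<bar>W x\<bar> \<le> M" "\<bar>W' x\<bar> \<le> M" for x
    using abs_late_limsup_le[of u M x] abs_late_limsup_le[of w M x] M by (auto simp: W_def W'_def)
  have upper: "\<forall>\<^sub>F t in at_top. u (x, t) < q" if "W x < q" for x q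
    using late_limsup_eventually[of u M x q "\<lambda>_. x" at_top "\<lambda>t. t"] that M
    by (simp add: W_def filterlim_ident)
  have lower: "\<forall>\<^sub>F t in at_top. q < u (x, t)" if "q < W' x" for x q
    using late_limsup_eventually[of w M x "- q" "\<lambda>_. x" at_top "\<lambda>t. t"] that M
    by (simp add: W'_def w_def filterlim_ident)
  have "W x \<le> W' x" for x
    by (rule elliptic_comparison[OF s a c cont W_sub W'_sup bd W_lim W'_lim])
  moreover have "W' x \<le> W x" for x
  proof (rule ccontr)
    assume "\<not> W' x \<le> W x"
    then obtain q where q: "W x < q" "q < W' x" using dense[of "W x" "W' x"] by auto
    have "\<forall>\<^sub>F t :: real in at_top. False"
      using eventually_conj[OF upper[OF q(1)] lower[OF q(2)]] by (rule eventually_mono) auto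
    then show False by simp
  qed
  ultimately have WW: "W' = W" by (intro ext antisym)
  have W_sol: "elliptic_solution s a c f W"
    using W_sub W'_sup WW by (simp add: elliptic_solution_def)
  \<comment> \<open>A competitor is continuous and has a limit at infinity, hence is bounded; with a
    common bound for \<open>V\<close> and \<open>W\<close>, comparison applies in both
    directions.\<close>
  have "V = W" if V: "elliptic_solution s a c f V" "(V \<longlongrightarrow> \<gamma>) at_infinity" for V
  proof -
    have Vs: "elliptic_subsolution s a c f V" "elliptic_supersolution s a c f V"
      using V(1) by (auto simp: elliptic_solution_def)
    then have "continuous_on UNIV V"
      by (intro usc_lsc_imp_continuous_on) (auto simp: elliptic_subsolution_def elliptic_supersolution_def)
    then obtain b where b: "\<And>x. \<bar>V x\<bar> \<le> b"
      using continuous_tendsto_at_infinity_bounded[OF _ V(2)] by blast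
    have bdV: "\<bar>V x\<bar> \<le> max M b" "\<bar>W x\<bar> \<le> max M b" for x
      using b[of x] bd(1)[of x] by auto
    have "V x \<le> W x" "W x \<le> V x" for x
      using elliptic_comparison[OF s a c cont Vs(1) _ bdV V(2) W_lim, of x]
        elliptic_comparison[OF s a c cont W_sub Vs(2) bdV(2,1) W_lim V(2), of x] W'_sup WW by auto
    then show ?thesis by (intro ext antisym)
  qed
  moreover have "((\<lambda>t. u (x, t)) \<longlongrightarrow> W x) at_top" for x
    using upper lower WW by (intro order_tendstoI) auto
  ultimately show ?thesis using W_sol W_lim by blast
qed

end
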